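(* Let $(\mathcal{A},E,\mathcal{B})$ be an operator-valued $C^*$-probability space, $N\in\mathbb{N}$, and let $x=\{x_1,\dots,x_N\}$, $y=\{y_1,\dots,y_N\}$ be self-adjoint elements of $\mathcal{A}$ with $E[x_j]=E[y_j]=0$ and $E[x_jbx_j]=E[y_jby_j]$ for all $j$ and all $b\in\mathcal{B}$, such that $\mathcal{A}_{x_1}\prec\mathcal{A}_{x_2}\prec\dots\prec\mathcal{A}_{x_N}$ over $\mathcal{B}$ and $\mathcal{A}_{y_1}\prec\dots\prec\mathcal{A}_{y_N}$ over $\mathcal{B}$. Put $\mathbf{x}_N=\sum_i x_i$, $\mathbf{y}_N=\sum_i y_i$. Then for every $\mathfrak b\in\mathbb{H}^+(\mathcal{B})$, $$\big\|E[G_{\mathbf{x}_N}(\mathfrak b)]-E[G_{\mathbf{y}_N}(\mathfrak b)]\big\|\le\|(\operatorname{Im}\mathfrak b)^{-1}\|^4\sqrt{\alpha_2(x)}\Big(\sqrt{\alpha_4(x)}+\sqrt{\alpha_4(y)}\Big)N.$$ In the scalar case where $\mathcal{A}$ is a von Neumann algebra with faithful normal state $\varphi$, $\mathcal{B}=\mathbb{C}$ and $E=\varphi$, one has in addition for every $\epsilon>0$ $$\int_{\mathbb{R}}\big|\operatorname{Im}\varphi[G_{\mathbf{x}_N}(t+i\epsilon)]-\operatorname{Im}\varphi[G_{\mathbf{y}_N}(t+i\epsilon)]\big|\,dt\le\frac{\pi}{\epsilon^3}\sqrt{\alpha_2(x)}\Big(\sqrt{\widetilde\alpha_4(x)}+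\sqrt{\widetilde\alpha_4(y)}\Big)N.$$
   Context: An operator-valued $C^*$-probability space $(\mathcal{A},E,\mathcal{B})$ consists of a unital $C^*$-algebra $\mathcal{A}$, a unital $C^*$-subalgebra $\mathcal{B}\subseteq\mathcal{A}$, and a completely positive conditional expectation $E:\mathcal{A}\to\mathcal{B}$ (linear, $E[b_1ab_2]=b_1E[a]b_2$ and $E[b]=b$). $\mathbb{H}^+(\mathcal{B})$ is the set of $\mathfrak b\in\mathcal{B}$ with $\operatorname{Im}\mathfrak b:=\frac{1}{2i}(\mathfrak b-\mathfrak b^* )$ positive and invertible; $G_a(\mathfrak b)=(\mathfrak b-a)^{-1}$ for self-adjoint $a$. For $a\in\mathcal{A}$, $\mathcal{A}_a$ is the (possibly non-unital) $\mathcal{B}$-bimodule subalgebra generated by $a$. For a linearly ordered index set, $\mathcal{B}$-bimodule subalgebras $(\mathcal{A}_i)$ are monotone independent over $\mathcal{B}$ if $E[a_1\cdots a_j\cdots a_n]=E[a_1\cdots a_{j-1}E[a_j]a_{j+1}\cdots a_n]$ whenever $a_k\in\mathcal{A}_{i_k}$ and $i_{j-1}<i_j>i_{j+1}$ (one inequality dropped if $j=1$ or $j=n$); we write $\mathcal{A}_{1}\prec\mathcal{A}_{2}\prec\cdots$ to indicate monotone independence with this order. Notation: $\alpha_2(x)=\max_i\|E[x_i^2]\|$, $\alpha_4(x)=\max_i\sup_{b\in\mathcal{B},\|b\|=1}\|E[x_ib^*x_i^2bx_i]\|$, $\widetilde\alpha_4(x)=\max_i\|E[x_i^4]\|$ (in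 the scalar case these are $|\varphi(\cdot)|$), similarly for $y$. *)

theory Defs
  imports "HOL-Analysis.Analysis"
begin

class cstar_algebra = real_normed_algebra_1 + banach +
  fixes scaleC :: "complex \<Rightarrow> 'a \<Rightarrow> 'a"
    and star :: "'a \<Rightarrow> 'a"
  assumes scaleC_of_real: "scaleC (complex_of_real r) x = scaleR r x"
    and scaleC_add_right: "scaleC c (x + y) = scaleC c x + scaleC c y"
    and scaleC_add_left: "scaleC (c + d) x = scaleC c x + scaleC d x"
    and scaleC_scaleC: "scaleC c (scaleC d x) = scaleC (c * d) x"
    and scaleC_one: "scaleC 1 x = x"
    and norm_scaleC: "norm (scaleC c x) = cmod c * norm x"
    and mult_scaleC_left: "scaleC c x * y = scaleC c (x * y)"
    and mult_scaleC_right: "x * scaleC c y = scaleC c (x * y)"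
    and star_add: "star (x + y) = star x + star y"
    and star_scaleC: "star (scaleC c x) = scaleC (cnj c) (star x)"
    and star_mult: "star (x * y) = star y * star x"
    and star_star: "star (star x) = x"
    and cstar_identity: "norm (star x * x) = (norm x)\<^sup>2"

context cstar_algebra begin

definition invertible_in :: "'a set \<Rightarrow> 'a \<Rightarrow> bool" where
  "invertible_in S c \<longleftrightarrow> (\<exists>d\<in>S. c * d = 1 \<and> d * c = 1)"

definition inv_el :: "'a \<Rightarrow> 'a" where
  "inv_el c = (THE d. c * d = 1 \<and> d * c = 1)"

definition selfadj :: "'a \<Rightarrow> bool" where
  "selfadj a \<longleftrightarrow> star a = a"

definition positive_in :: "'a set \<Rightarrow> 'a \<Rightarrow> bool" where
  "positive_in S a \<longleftrightarrow> a \<in> S \<and> star a = a \<and>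
     (\<forall>z::complex. z \<notin> complex_of_real ` {0..} \<longrightarrow> invertible_in S (a - scaleC z 1))"

definition Im_el :: "'a \<Rightarrow> 'a" where
  "Im_el b = scaleC (1 / (2 * \<i>)) (b - star b)"

definition upper_half :: "'a set \<Rightarrow> 'a set" where
  "upper_half B = {b \<in> B. positive_in B (Im_el b) \<and> invertible_in B (Im_el b)}"

definition resolvent :: "'a \<Rightarrow> 'a \<Rightarrow> 'a" where
  "resolvent a b = inv_el (b - a)"

definition cstar_subalgebra :: "'a set \<Rightarrow> bool" where
  "cstar_subalgebra B \<longleftrightarrow> 1 \<in> B \<and> closed B \<and>
     (\<forall>x\<in>B. \<forall>y\<in>B. x + y \<in> B \<and> x * y \<in> B) \<and>
     (\<forall>c. \<forall>x\<in>B. scaleC c x \<in> B) \<and> (\<forall>x\<in>B. star x \<in> B)"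

definition mat_mul :: "nat \<Rightarrow> (nat \<Rightarrow> nat \<Rightarrow> 'a) \<Rightarrow> (nat \<Rightarrow> nat \<Rightarrow> 'a) \<Rightarrow> nat \<Rightarrow> nat \<Rightarrow> 'a" where
  "mat_mul n M N i j = (\<Sum>k<n. M i k * N k j)"

definition mat_id :: "nat \<Rightarrow> nat \<Rightarrow> 'a" where
  "mat_id i j = (if i = j then 1 else 0)"

definition mat_invertible_in :: "'a set \<Rightarrow> nat \<Rightarrow> (nat \<Rightarrow> nat \<Rightarrow> 'a) \<Rightarrow> bool" where
  "mat_invertible_in S n M \<longleftrightarrow> (\<exists>N. (\<forall>i<n. \<forall>j<n. N i j \<in> S) \<and>
      (\<forall>i<n. \<forall>j<n. mat_mul n M N i j = mat_id i j \<and> mat_mul n N M i j = mat_id i j))"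

definition mat_positive_in :: "'a set \<Rightarrow> nat \<Rightarrow> (nat \<Rightarrow> nat \<Rightarrow> 'a) \<Rightarrow> bool" where
  "mat_positive_in S n M \<longleftrightarrow> (\<forall>i<n. \<forall>j<n. M i j \<in> S) \<and>
     (\<forall>i<n. \<forall>j<n. star (M j i) = M i j) \<and>
     (\<forall>z::complex. z \<notin> complex_of_real ` {0..} \<longrightarrow>
        mat_invertible_in S n (\<lambda>i j. M i j - scaleC z (mat_id i j)))"

definition cond_exp :: "'a set \<Rightarrow> ('a \<Rightarrow> 'a) \<Rightarrow> bool" where
  "cond_exp B E \<longleftrightarrow>
     (\<forall>a. E a \<in> B) \<and>
     (\<forall>a c. E (a + c) = E a + E c) \<and> (\<forall>z a. E (scaleC z a) = scaleC z (E a)) \<and>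
     (\<forall>b1\<in>B. \<forall>b2\<in>B. \<forall>a. E (b1 * a * b2) = b1 * E a * b2) \<and>
     (\<forall>b\<in>B. E b = b)"

definition completely_positive :: "'a set \<Rightarrow> ('a \<Rightarrow> 'a) \<Rightarrow> bool" where
  "completely_positive B E \<longleftrightarrow>
     (\<forall>n M. mat_positive_in UNIV n M \<longrightarrow> mat_positive_in B n (\<lambda>i j. E (M i j)))"

definition opval_cstar_prob_space :: "'a set \<Rightarrow> ('a \<Rightarrow> 'a) \<Rightarrow> bool" where
  "opval_cstar_prob_space B E \<longleftrightarrow>
     cstar_subalgebra B \<and> cond_exp B E \<and> completely_positive B E"

text \<open>The (possibly non-unital) B-bimodule subalgebra generated by a.\<close>
inductive_set bimod_gen :: "'a set \<Rightarrow> 'a \<Rightarrow> 'a set" for B a where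
  gen: "a \<in> bimod_gen B a"
| add: "x \<in> bimod_gen B a \<Longrightarrow> y \<in> bimod_gen B a \<Longrightarrow> x + y \<in> bimod_gen B a"
| mult: "x \<in> bimod_gen B a \<Longrightarrow> y \<in> bimod_gen B a \<Longrightarrow> x * y \<in> bimod_gen B a"
| lmult: "b \<in> B \<Longrightarrow> x \<in> bimod_gen B a \<Longrightarrow> b * x \<in> bimod_gen B a"
| rmult: "b \<in> B \<Longrightarrow> x \<in> bimod_gen B a \<Longrightarrow> x * b \<in> bimod_gen B a"

definition monotone_indep :: "('a \<Rightarrow> 'a) \<Rightarrow> nat set \<Rightarrow> (nat \<Rightarrow> 'a set) \<Rightarrow> bool" where
  "monotone_indep E I Al \<longleftrightarrow>
     (\<forall>n (ix::nat \<Rightarrow> nat) (w::nat \<Rightarrow> 'a) j.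
        (\<forall>k<n. ix k \<in> I \<and> w k \<in> Al (ix k)) \<and> j < n \<and>
        (0 < j \<longrightarrow> ix (j - 1) < ix j) \<and> (j + 1 < n \<longrightarrow> ix (j + 1) < ix j) \<longrightarrow>
        E (prod_list (map w [0..<n])) =
        E (prod_list (map (w(j := E (w j))) [0..<n])))"

definition alpha2 :: "('a \<Rightarrow> 'a) \<Rightarrow> nat \<Rightarrow> (nat \<Rightarrow> 'a) \<Rightarrow> real" where
  "alpha2 E N x = Max ((\<lambda>i. norm (E (x i * x i))) ` {1..N})"

definition alpha4 :: "'a set \<Rightarrow> ('a \<Rightarrow> 'a) \<Rightarrow> nat \<Rightarrow> (nat \<Rightarrow> 'a) \<Rightarrow> real" where
  "alpha4 B E N x = Max ((\<lambda>i. Sup ((\<lambda>b. norm (E (x i * star b * (x i * x i) * b * x i)))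
                                      ` {b \<in> B. norm b = 1})) ` {1..N})"

definition alpha4_tilde :: "('a \<Rightarrow> 'a) \<Rightarrow> nat \<Rightarrow> (nat \<Rightarrow> 'a) \<Rightarrow> real" where
  "alpha4_tilde E N x = Max ((\<lambda>i. norm (E (x i * x i * x i * x i))) ` {1..N})"

definition ord_le :: "'a \<Rightarrow> 'a \<Rightarrow> bool" where
  "ord_le a b \<longleftrightarrow> positive_in UNIV (b - a)"

definition bdd_directed :: "'a set \<Rightarrow> bool" where
  "bdd_directed D \<longleftrightarrow> D \<noteq> {} \<and> (\<forall>d\<in>D. selfadj d) \<and>
     (\<forall>a\<in>D. \<forall>b\<in>D. \<exists>c\<in>D. ord_le a c \<and> ord_le b c) \<and>
     (\<exists>u. selfadj u \<and> (\<forall>d\<in>D. ord_le d u))"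

definition is_lub_el :: "'a \<Rightarrow> 'a set \<Rightarrow> bool" where
  "is_lub_el s D \<longleftrightarrow> selfadj s \<and> (\<forall>d\<in>D. ord_le d s) \<and>
     (\<forall>u. selfadj u \<and> (\<forall>d\<in>D. ord_le d u) \<longrightarrow> ord_le s u)"

definition monotone_complete :: "'a itself \<Rightarrow> bool" where
  "monotone_complete _ \<longleftrightarrow> (\<forall>D::'a set. bdd_directed D \<longrightarrow> (\<exists>s. is_lub_el s D))"

definition normal_functional :: "('a \<Rightarrow> complex) \<Rightarrow> bool" where
  "normal_functional \<phi> \<longleftrightarrow> (\<forall>D s. bdd_directed D \<and> is_lub_el s D \<longrightarrow>
      Re (\<phi> s) = (SUP d\<in>D. Re (\<phi> d)))"

definition faithful_functional :: "('a \<Rightarrow> complex) \<Rightarrow> bool" where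
  "faithful_functional \<phi> \<longleftrightarrow> (\<forall>a. \<phi> (star a * a) = 0 \<longrightarrow> a = 0)"

end

end

theory Submission
  imports Defs "HOL-Complex_Analysis.Cauchy_Integral_Theorem"
begin

text \<open>Write \<open>F\<^sub>x(w) = E[(w - x)\<^sup>-\<^sup>1]\<^sup>-\<^sup>1\<close>. Monotone independence gives
  \<open>E[G(b)] = (F\<^sub>1 \<circ> \<dots> \<circ> F\<^sub>N)(b)\<^sup>-\<^sup>1\<close> for the resolvent \<open>G\<close> of the sum, so the variables can be
  replaced one at a time without realising the \<open>x\<^sub>i\<close> and the \<open>y\<^sub>i\<close> jointly: every \<open>F\<^sub>i\<close> preserves
  the half-plane \<open>Im w \<ge> \<delta>\<close>, on which resolvents are bounded by \<open>1/\<delta>\<close>. A Schur complement argument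
  yields \<open>F\<^sub>x(w) = w - E[x w\<^sup>-\<^sup>1 x] - E[x w\<^sup>-\<^sup>1 x c]\<close> with \<open>\<parallel>E[c\<^sup>*c]\<parallel> \<le> \<delta>\<^sup>-\<^sup>2 \<parallel>E[x\<^sup>2]\<parallel>\<close>; the middle term
  agrees for \<open>x\<^sub>i\<close> and \<open>y\<^sub>i\<close>, and the Cauchy--Schwarz inequality bounds the last one. In the scalar case
  Cauchy--Schwarz also turns each step into \<open>|u - v| / (2\<epsilon>)\<close> times the sum of two Poisson-type densities
  \<open>- Im G\<close>, each of total mass at most \<open>\<pi>\<close>.\<close>

section \<open>Positivity in C*-algebras\<close>

text \<open>The fourth power of 1/\<delta> has two sources: the remainder of one F-transform
  contributes two factors, one from \<open>inv_el w\<close> and one from the bound on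
  \<open>c\<close>, and the two resolvents around the difference contribute the others. In the
  scalar case these resolvents are integrated over the line rather than bounded: the weight is
  1/(2\<epsilon>) and the two densities have total mass at most 2 pi, whence pi/\<epsilon>^3. Only
  \<open>alpha2 E N x\<close> occurs, because the covariance condition at 1 makes the second moments
  of both families agree. Since the top variable acts on the argument first, peeling it off moves
  the argument to one of two different points. The inductions must therefore hold for every
  argument: all points of \<open>B\<close> above \<delta> in the operator-valued case, and all maps
  of a class stable under composition with F-transforms in the scalar case, where a horizontal line
  is not preserved. Positivity is a norm condition throughout, as sums and limits are then easy; the
  spectral conditions of the statement are translated into it and back.\<close>

lemma scaleC_zero_left [simp]: "scaleC 0 (x::'a::cstar_algebra) = 0"
  using norm_scaleC[of 0 x] by simp

lemma scaleC_zero_right [simp]: "scaleC c (0::'a::cstar_algebra) = 0"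
  using norm_scaleC[of c "0::'a"] by simp

lemma scaleC_minus_left: "scaleC (- c) (x::'a::cstar_algebra) = - scaleC c x"
  using scaleC_add_left[of c "-c" x] by (simp add: eq_neg_iff_add_eq_0 add.commute)

lemma scaleC_minus_right: "scaleC c (- (x::'a::cstar_algebra)) = - scaleC c x"
  using scaleC_add_right[of c x "-x"] by (simp add: eq_neg_iff_add_eq_0 add.commute)

lemma scaleC_diff_right: "scaleC c ((x::'a::cstar_algebra) - y) = scaleC c x - scaleC c y"
  using scaleC_add_right[of c x "-y"] by (simp add: scaleC_minus_right)

lemma scaleC_diff_left: "scaleC (c - d) (x::'a::cstar_algebra) = scaleC c x - scaleC d x"
  using scaleC_add_left[of c "-d" x] by (simp add: scaleC_minus_left)

lemma scaleR_scaleC_commute: "r *\<^sub>R scaleC c (x::'a::cstar_algebra) = scaleC c (r *\<^sub>R x)"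
  by (simp add: scaleC_of_real[symmetric] scaleC_scaleC mult.commute)

lemma star_zero [simp]: "star (0::'a::cstar_algebra) = 0"
  using star_scaleC[of 0 "0::'a"] by simp

lemma star_one [simp]: "star (1::'a::cstar_algebra) = 1"
  by (metis mult_1 mult_1_right star_mult star_star)

lemma star_minus: "star (- (x::'a::cstar_algebra)) = - star x"
  using star_add[of x "-x"] by (simp add: eq_neg_iff_add_eq_0 add.commute)

lemma star_diff: "star ((x::'a::cstar_algebra) - y) = star x - star y"
  using star_add[of x "-y"] by (simp add: star_minus)

lemma star_scaleR [simp]: "star (r *\<^sub>R (x::'a::cstar_algebra)) = r *\<^sub>R star x"
  using star_scaleC[of "complex_of_real r" x] by (simp add: scaleC_of_real)

lemma norm_star [simp]: "norm (star (x::'a::cstar_algebra)) = norm x"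
proof -
  have *: "norm x \<le> norm (star x)" for x :: 'a
  proof (cases "x = 0")
    case False
    have "norm x * norm x \<le> norm (star x) * norm x"
      using norm_mult_ineq[of "star x" x] by (simp add: cstar_identity power2_eq_square)
    with False show ?thesis by simp
  qed simp
  from *[of x] *[of "star x"] show ?thesis by (simp add: star_star)
qed

lemma bounded_linear_star: "bounded_linear (star :: 'a::cstar_algebra \<Rightarrow> 'a)"
  by (rule bounded_linear_intro[where K=1]) (simp_all add: star_add)

lemma bounded_linear_scaleC: "bounded_linear (scaleC c :: 'a::cstar_algebra \<Rightarrow> 'a)"
  by (rule bounded_linear_intro[where K="cmod c"])
     (simp_all add: scaleC_add_right scaleR_scaleC_commute norm_scaleC)

lemma star_sum: "star (sum f I) = (\<Sum>i\<in>I. star (f i :: 'a::cstar_algebra))"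
  by (rule bounded_linear.linear[OF bounded_linear_star, THEN linear_sum])

text \<open>For self-adjoint \<open>a\<close> this says that the spectrum lies in some interval
  [0, 2t]. In this form sums and nonnegative multiples need only the triangle inequality and no
  spectral theory.\<close>

definition pos :: "'a::cstar_algebra \<Rightarrow> bool" where
  "pos a \<longleftrightarrow> star a = a \<and> (\<exists>t. norm (t *\<^sub>R 1 - a) \<le> t)"

lemma posD: "pos a \<Longrightarrow> star a = a"
  by (simp add: pos_def)

lemma pos_add:
  assumes "pos a" "pos b" shows "pos (a + b)"
proof -
  from assms obtain t u where "norm (t *\<^sub>R 1 - a) \<le> t" "norm (u *\<^sub>R 1 - b) \<le> u"
    by (auto simp: pos_def)
  then have "norm ((t + u) *\<^sub>R 1 - (a + b)) \<le> t + u"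
    using norm_triangle_ineq[of "t *\<^sub>R 1 - a" "u *\<^sub>R 1 - b"] by (simp add: algebra_simps)
  then show ?thesis using assms by (auto simp: pos_def star_add)
qed

lemma pos_scaleR:
  assumes "pos a" "r \<ge> 0" shows "pos (r *\<^sub>R a)"
proof -
  from assms obtain t where t: "norm (t *\<^sub>R 1 - a) \<le> t" by (auto simp: pos_def)
  have "norm ((r * t) *\<^sub>R 1 - r *\<^sub>R a) = r * norm (t *\<^sub>R 1 - a)"
    using assms(2) by (simp add: scaleR_scaleR[symmetric] scaleR_diff_right[symmetric] del: scaleR_scaleR)
  also have "\<dots> \<le> r * t" using t assms(2) by (simp add: mult_left_mono)
  finally show ?thesis using assms(1) by (auto simp: pos_def)
qed

lemma pos_scaleR_one: "r \<ge> 0 \<Longrightarrow> pos (r *\<^sub>R (1::'a::cstar_algebra))"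
  by (auto simp: pos_def intro!: exI[of _ r])

lemma pos_zero [simp]: "pos 0"
  using pos_scaleR_one[of 0] by simp

lemma pos_norm_diff:
  assumes "star h = h" "norm h \<le> t" shows "pos (t *\<^sub>R 1 - h)" "pos (t *\<^sub>R 1 + h)"
  using assms by (auto simp: pos_def star_diff star_add intro!: exI[of _ t])

text \<open>The root is \<open>1 - l\<close>, where \<open>l\<close> is a fixed point of the map
  sending \<open>r\<close> to \<open>(q + r * r) / 2\<close> and \<open>q = 1 - p\<close>. Since
  \<open>norm q\<close> may equal 1, there is no contraction; the same recursion for the number 1
  gives a bounded increasing majorant \<open>\<rho>\<close> whose increments dominate those of
  \<open>r\<close>. The commutation clause is inherited from the iterates, which are polynomials in
  \<open>q\<close>.\<close>

lemma sqrt_near_one: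
  fixes p :: "'a::cstar_algebra"
  assumes p: "star p = p" "norm (1 - p) \<le> 1"
  shows "\<exists>s. star s = s \<and> s * s = p \<and> norm (1 - s) \<le> 1 \<and> (\<forall>d. d * p = p * d \<longrightarrow> d * s = s * d)"
proof -
  define q where "q = 1 - p"
  define r where "r = rec_nat 0 (\<lambda>_ r. (1/2) *\<^sub>R (q + r * r))"
  define \<rho> :: "nat \<Rightarrow> real" where "\<rho> = rec_nat 0 (\<lambda>_ r. (1/2) * (1 + r * r))"
  have r0: "r 0 = 0" and rS: "\<And>n. r (Suc n) = (1/2) *\<^sub>R (q + r n * r n)"
    by (simp_all add: r_def)
  have \<rho>0: "\<rho> 0 = 0" and \<rho>S: "\<And>n. \<rho> (Suc n) = (1/2) * (1 + \<rho> n * \<rho> n)"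
    by (simp_all add: \<rho>_def)
  have q: "norm q \<le> 1" using p by (simp add: q_def)
  have \<rho>1: "0 \<le> \<rho> n \<and> \<rho> n \<le> 1" for n
  proof (induction n)
    case (Suc n)
    then have "\<rho> n * \<rho> n \<le> 1 * 1" "0 \<le> \<rho> n * \<rho> n" by (intro mult_mono) auto
    then show ?case by (simp add: \<rho>S)
  qed (simp add: \<rho>0)
  have nr: "norm (r n) \<le> \<rho> n" for n
  proof (induction n)
    case (Suc n)
    have "norm (q + r n * r n) \<le> norm q + norm (r n) * norm (r n)"
      using norm_triangle_ineq[of q "r n * r n"] norm_mult_ineq[of "r n" "r n"] by linarith
    also have "\<dots> \<le> 1 + \<rho> n * \<rho> n"
      using q Suc \<rho>1[of n] by (intro add_mono mult_mono) auto
    finally show ?case by (simp add: rS \<rho>S)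
  qed (simp add: r0 \<rho>0)
  have step: "norm (r (Suc n) - r n) \<le> \<rho> (Suc n) - \<rho> n" for n
  proof (induction n)
    case 0
    show ?case using q by (simp add: rS \<rho>S r0 \<rho>0)
  next
    case (Suc n)
    let ?a = "r (Suc n)" and ?b = "r n"
    have "?a * ?a - ?b * ?b = ?a * (?a - ?b) + (?a - ?b) * ?b" by (simp add: algebra_simps)
    then have "norm (?a * ?a - ?b * ?b) \<le> norm (?a * (?a - ?b)) + norm ((?a - ?b) * ?b)"
      using norm_triangle_ineq by metis
    also have "\<dots> \<le> norm ?a * norm (?a - ?b) + norm (?a - ?b) * norm ?b"
      by (intro add_mono norm_mult_ineq)
    also have "\<dots> = (norm ?a + norm ?b) * norm (?a - ?b)" by (simp add: algebra_simps)
    also have "\<dots> \<le> (\<rho> (Suc n) + \<rho> n) * (\<rho> (Suc n) - \<rho> n)"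
      using Suc nr[of n] nr[of "Suc n"] \<rho>1[of n] \<rho>1[of "Suc n"] by (intro mult_mono add_mono) auto
    also have "\<dots> = 2 * (\<rho> (Suc (Suc n)) - \<rho> (Suc n))"
      using \<rho>S[of "Suc n"] \<rho>S[of n] by algebra
    finally have "norm (?a * ?a - ?b * ?b) \<le> 2 * (\<rho> (Suc (Suc n)) - \<rho> (Suc n))" .
    moreover have "r (Suc (Suc n)) - r (Suc n) = (1/2) *\<^sub>R (?a * ?a - ?b * ?b)"
      using rS[of "Suc n"] rS[of n] by (simp add: scaleR_diff_right scaleR_right_distrib)
    ultimately show ?case by simp
  qed
  have tele: "norm (r (n + k) - r n) \<le> \<rho> (n + k) - \<rho> n" for n k
  proof (induction k)
    case (Suc k)
    have "norm (r (n + Suc k) - r n) \<le> norm (r (Suc (n + k)) - r (n + k)) + norm (r (n + k) - r n)"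
      using norm_triangle_ineq[of "r (Suc (n + k)) - r (n + k)" "r (n + k) - r n"] by simp
    with Suc step[of "n + k"] show ?case by simp
  qed simp
  have tele': "norm (r m - r n) \<le> \<bar>\<rho> m - \<rho> n\<bar>" for m n
    using tele[of n "m - n"] tele[of m "n - m"]
    by (cases "n \<le> m") (auto simp: norm_minus_commute)
  have "incseq \<rho>"
    by (rule incseq_SucI) (use step norm_ge_zero order.trans in \<open>smt (verit)\<close>)
  then have "Cauchy \<rho>"
    using incseq_convergent[of \<rho> 1] \<rho>1 by (metis convergentI convergent_Cauchy)
  then have "Cauchy r"
    unfolding Cauchy_iff real_norm_def by (blast intro: order.strict_trans1[OF tele'])
  then obtain l where l: "r \<longlonglongrightarrow> l" by (auto simp: Cauchy_convergent_iff convergent_def)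
  have "(\<lambda>n. r (Suc n)) \<longlonglongrightarrow> (1/2) *\<^sub>R (q + l * l)"
    unfolding rS by (intro tendsto_intros l)
  then have leq: "l = (1/2) *\<^sub>R (q + l * l)"
    using LIMSEQ_Suc[OF l] LIMSEQ_unique by blast
  have "norm l \<le> 1"
    by (rule LIMSEQ_le_const2[OF tendsto_norm[OF l]]) (use nr \<rho>1 order.trans in blast)
  have "star (r n) = r n" for n
    by (induction n) (simp_all add: r0 rS star_add star_mult star_diff q_def p)
  then have sl: "star l = l"
    using bounded_linear.tendsto[OF bounded_linear_star l] LIMSEQ_unique[OF l, of "star l"] by simp
  show ?thesis
  proof (intro exI[of _ "1 - l"] conjI)
    show "star (1 - l) = 1 - l" by (simp add: star_diff sl)
    have "2 *\<^sub>R l = q + l * l" using arg_cong[OF leq, of "\<lambda>z. 2 *\<^sub>R z"] by simp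
    then show "(1 - l) * (1 - l) = p" by (simp add: algebra_simps q_def scaleR_2)
    show "norm (1 - (1 - l)) \<le> 1" using \<open>norm l \<le> 1\<close> by simp
    have "d * (1 - l) = (1 - l) * d" if d: "d * p = p * d" for d
    proof -
    have "d * r n = r n * d" for n
    proof (induction n)
      case (Suc n)
      have "d * (r n * r n) = r n * r n * d" by (metis Suc mult.assoc)
      with d show ?case by (simp add: rS q_def algebra_simps)
    qed (simp add: r0)
    moreover have "(\<lambda>n. d * r n) \<longlonglongrightarrow> d * l" "(\<lambda>n. r n * d) \<longlonglongrightarrow> l * d"
      by (intro tendsto_intros l)+
    ultimately have "d * l = l * d" using LIMSEQ_unique by auto
    then show ?thesis by (simp add: algebra_simps)
    qed
    then show "\<forall>d. d * p = p * d \<longrightarrow> d * (1 - l) = (1 - l) * d" by blast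
  qed
qed

lemma pos_sqrt:
  assumes "pos (a :: 'a::cstar_algebra)"
  shows "\<exists>s. pos s \<and> s * s = a \<and> (\<forall>d. d * a = a * d \<longrightarrow> d * s = s * d)"
proof -
  from assms obtain t where t: "star a = a" "norm (t *\<^sub>R 1 - a) \<le> t" by (auto simp: pos_def)
  then have "t \<ge> 0" using norm_ge_zero order.trans by blast
  show ?thesis
  proof (cases "t = 0")
    case True
    with t have "a = 0" by simp
    then show ?thesis by (intro exI[of _ 0]) simp
  next
    case False
    with \<open>t \<ge> 0\<close> have tp: "t > 0" by simp
    have "1 - (1/t) *\<^sub>R a = (1/t) *\<^sub>R (t *\<^sub>R 1 - a)" using tp by (simp add: algebra_simps)
    then have "norm (1 - (1/t) *\<^sub>R a) = norm (t *\<^sub>R 1 - a) / t" using tp by simp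
    then have "norm (1 - (1/t) *\<^sub>R a) \<le> 1" using t tp by simp
    moreover have "star ((1/t) *\<^sub>R a) = (1/t) *\<^sub>R a" using t by simp
    ultimately obtain s where s: "star s = s" "s * s = (1/t) *\<^sub>R a" "norm (1 - s) \<le> 1"
       "\<forall>d. d * ((1/t) *\<^sub>R a) = ((1/t) *\<^sub>R a) * d \<longrightarrow> d * s = s * d"
      using sqrt_near_one by blast
    have ps: "pos s" using s(1,3) by (auto simp: pos_def intro!: exI[of _ 1])
    show ?thesis
    proof (intro exI[of _ "sqrt t *\<^sub>R s"] conjI)
      show "pos (sqrt t *\<^sub>R s)" using ps tp by (intro pos_scaleR) auto
      show "sqrt t *\<^sub>R s * (sqrt t *\<^sub>R s) = a" using s(2) tp by simp
      show "\<forall>d. d * a = a * d \<longrightarrow> d * (sqrt t *\<^sub>R s) = sqrt t *\<^sub>R s * d"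
        using s(4) by (metis mult_scaleR_left mult_scaleR_right)
    qed
  qed
qed

text \<open>If \<open>h\<close> and \<open>v\<close> are commuting self-adjoint elements, \<open>h + iv\<close> is a multiple of a
  unitary as soon as \<open>h\<^sup>2 + v\<^sup>2\<close> is scalar.\<close>

lemma norm_le_of_squares:
  fixes h v :: "'a::cstar_algebra"
  assumes "star h = h" "star v = v" "h * v = v * h" "h * h + v * v = t *\<^sub>R 1" "t \<ge> 0"
  shows "(norm h)\<^sup>2 \<le> t"
proof -
  define u where "u = h + scaleC \<i> v"
  have su: "star u = h - scaleC \<i> v"
    by (simp add: u_def star_add star_scaleC assms scaleC_minus_left)
  have "star u * u = h * h + v * v"
    unfolding su
    by (simp add: u_def ring_distribs mult_scaleC_left mult_scaleC_right scaleC_scaleC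
        assms(3) scaleC_minus_left scaleC_one scaleC_diff_right)
  then have "(norm u)\<^sup>2 = t" using cstar_identity[of u] assms(4,5) by simp
  moreover have "2 *\<^sub>R h = u + star u" unfolding su by (simp add: u_def scaleR_2)
  then have "2 * norm h \<le> norm u + norm u"
    using norm_triangle_ineq[of u "star u"] by (metis norm_scaleR norm_star abs_numeral)
  then have "(norm h)\<^sup>2 \<le> (norm u)\<^sup>2" by (intro power_mono) auto
  ultimately show ?thesis by simp
qed

text \<open>For a contraction \<open>v\<close> the root \<open>r\<close> of \<open>1 - v * v\<close>
  exists, and \<open>r * r + v * v = 1\<close> forces \<open>norm r \<le> 1\<close>. Hence
  \<open>norm (1 - v * v) \<le> 1\<close>, which is positivity with \<open>t = 1\<close>; rescaling
  covers general \<open>v\<close>.\<close>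

lemma pos_square:
  assumes "star v = (v :: 'a::cstar_algebra)" shows "pos (v * v)"
proof -
  have unit: "norm (1 - v * v) \<le> 1" if v: "star v = v" "norm v \<le> 1" for v :: 'a
  proof -
    have "norm (v * v) = (norm v)\<^sup>2" using cstar_identity[of v] v by simp
    then have n: "norm (1 - (1 - v * v)) \<le> 1" using v by (simp add: power_le_one)
    have "star (1 - v * v) = 1 - v * v" by (simp add: star_diff star_mult v)
    from sqrt_near_one[OF this n] obtain r where r: "star r = r" "r * r = 1 - v * v"
      "\<forall>d. d * (1 - v * v) = (1 - v * v) * d \<longrightarrow> d * r = r * d"
      by blast
    have "v * r = r * v" by (rule r(3)[rule_format]) (simp add: algebra_simps)
    then have "(norm r)\<^sup>2 \<le> 1" using r(1,2) v \<open>v * r = r * v\<close> by (intro norm_le_of_squares[of r v]) auto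
    moreover have "norm (r * r) = (norm r)\<^sup>2" using cstar_identity[of r] r(1) by simp
    ultimately show ?thesis using r(2) by (simp add: power_le_one_iff)
  qed
  show ?thesis
  proof (cases "v = 0")
    case False
    let ?n = "norm v"
    have "norm (1 - (1/?n) *\<^sub>R v * ((1/?n) *\<^sub>R v)) \<le> 1"
      using False assms by (intro unit) auto
    then have "pos ((1/?n) *\<^sub>R v * ((1/?n) *\<^sub>R v))"
      using assms by (auto simp: pos_def star_mult intro!: exI[of _ 1])
    then have "pos (?n\<^sup>2 *\<^sub>R ((1/?n) *\<^sub>R v * ((1/?n) *\<^sub>R v)))" by (rule pos_scaleR) auto
    then show ?thesis using False by (simp add: power2_eq_square)
  qed simp
qed

text \<open>The product of the two square roots is a self-adjoint root of the product. The root
  itself, with its commutation property, is returned because \<open>norm_le_of_pos\<close> needs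
  more than positivity of \<open>a * b\<close>.\<close>

lemma pos_commuting_mult:
  assumes "pos (a :: 'a::cstar_algebra)" "pos b" "a * b = b * a"
  shows "\<exists>v. star v = v \<and> v * v = a * b \<and> (\<forall>d. d * a = a * d \<longrightarrow> d * b = b * d \<longrightarrow> d * v = v * d)"
proof -
  obtain s where s: "pos s" "s * s = a" "\<forall>d. d * a = a * d \<longrightarrow> d * s = s * d"
    using pos_sqrt[OF assms(1)] by blast
  obtain w where w: "pos w" "w * w = b" "\<forall>d. d * b = b * d \<longrightarrow> d * w = w * d"
    using pos_sqrt[OF assms(2)] by blast
  have "b * s = s * b" by (rule s(3)[rule_format]) (rule assms(3)[symmetric])
  then have sw: "s * w = w * s" by (intro w(3)[rule_format]) (rule sym)
  show ?thesis
  proof (intro exI[of _ "s * w"] conjI)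
    show "star (s * w) = s * w" using s(1) w(1) sw by (simp add: star_mult posD)
    have "s * w * (s * w) = s * (w * s) * w" by (simp add: mult.assoc)
    also have "\<dots> = s * s * (w * w)" by (simp add: mult.assoc sw[symmetric])
    finally show "s * w * (s * w) = a * b" using s(2) w(2) by simp
    show "\<forall>d. d * a = a * d \<longrightarrow> d * b = b * d \<longrightarrow> d * (s * w) = s * w * d"
      using s(3) w(3) by (metis mult.assoc)
  qed
qed

lemma pos_scaleR_one_iff: "pos (r *\<^sub>R (1 :: 'a::cstar_algebra)) \<longleftrightarrow> r \<ge> 0"
proof
  assume "pos (r *\<^sub>R (1 :: 'a))"
  then obtain k where "norm (k *\<^sub>R 1 - r *\<^sub>R (1 :: 'a)) \<le> k" by (auto simp: pos_def)
  then have "\<bar>k - r\<bar> \<le> k" by (simp add: scaleR_left_diff_distrib[symmetric])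
  then show "r \<ge> 0" by linarith
qed (rule pos_scaleR_one)

text \<open>The two positive elements multiply to \<open>t\<^sup>2 - h\<^sup>2\<close>, hence to a
  square \<open>v * v\<close>, and \<open>h + iv\<close> then has norm \<open>t\<close>.\<close>

lemma norm_le_of_pos:
  assumes "pos (t *\<^sub>R 1 - (h :: 'a::cstar_algebra))" "pos (t *\<^sub>R 1 + h)"
  shows "norm h \<le> t"
proof -
  have "pos ((2 * t) *\<^sub>R (1 :: 'a))" using pos_add[OF assms] by (simp add: scaleR_2[symmetric])
  then have t: "t \<ge> 0" by (simp add: pos_scaleR_one_iff)
  have "star (t *\<^sub>R 1 - (t *\<^sub>R 1 - h)) = t *\<^sub>R 1 - (t *\<^sub>R 1 - h)"
    using posD[OF assms(1)] by (simp only: star_diff star_scaleR star_one)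
  then have h: "star h = h" by simp
  have "(t *\<^sub>R 1 - h) * (t *\<^sub>R 1 + h) = (t *\<^sub>R 1 + h) * (t *\<^sub>R 1 - h)"
    by (simp add: algebra_simps)
  from pos_commuting_mult[OF assms this] obtain v where v: "star v = v"
     "v * v = (t *\<^sub>R 1 - h) * (t *\<^sub>R 1 + h)"
     "\<forall>d. d * (t *\<^sub>R 1 - h) = (t *\<^sub>R 1 - h) * d \<longrightarrow> d * (t *\<^sub>R 1 + h) = (t *\<^sub>R 1 + h) * d \<longrightarrow> d * v = v * d"
    by blast
  have "h * v = v * h" by (rule v(3)[rule_format]) (simp_all add: algebra_simps)
  moreover have "h * h + v * v = (t\<^sup>2) *\<^sub>R 1"
    unfolding v(2) by (simp add: algebra_simps power2_eq_square)
  ultimately have "(norm h)\<^sup>2 \<le> t\<^sup>2" using norm_le_of_squares[OF h v(1)] by simp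
  from power2_le_imp_le[OF this t] show ?thesis .
qed

lemma pos_norm_mono:
  assumes "pos (a :: 'a::cstar_algebra)" "pos (b - a)" shows "norm a \<le> norm b"
proof (rule norm_le_of_pos)
  have "star (b - a + a) = b - a + a" using assms by (simp only: star_add posD)
  then have "star b = b" by simp
  then have "pos (norm b *\<^sub>R 1 - b)" by (intro pos_norm_diff) auto
  from pos_add[OF this assms(2)] show "pos (norm b *\<^sub>R 1 - a)" by simp
  show "pos (norm b *\<^sub>R 1 + a)" by (intro pos_add assms pos_scaleR_one) simp
qed

text \<open>The witness in \<open>pos\<close> can always be chosen as the norm. It then varies
  continuously with the element, which is what makes \<open>pos\<close> a closed condition.\<close>

lemma pos_norm_bound:
  assumes "pos (a :: 'a::cstar_algebra)" shows "norm (norm a *\<^sub>R 1 - a) \<le> norm a"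
proof (rule norm_le_of_pos)
  show "pos (norm a *\<^sub>R 1 - (norm a *\<^sub>R 1 - a))" using assms by simp
  have "pos (norm a *\<^sub>R 1 - a)" using assms by (intro pos_norm_diff) (auto simp: posD)
  then show "pos (norm a *\<^sub>R 1 + (norm a *\<^sub>R 1 - a))" by (intro pos_add pos_scaleR_one) auto
qed

lemma pos_closed:
  assumes "\<And>n. pos (f n :: 'a::cstar_algebra)" "f \<longlonglongrightarrow> a" shows "pos a"
proof -
  have "(\<lambda>n. star (f n)) \<longlonglongrightarrow> star a"
    using bounded_linear.tendsto[OF bounded_linear_star assms(2)] .
  then have "star a = a" using assms LIMSEQ_unique[OF assms(2), of "star a"] by (simp add: posD)
  moreover have "norm (norm a *\<^sub>R 1 - a) \<le> norm a"
  proof (rule LIMSEQ_le)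
    show "(\<lambda>n. norm (norm (f n) *\<^sub>R 1 - f n)) \<longlonglongrightarrow> norm (norm a *\<^sub>R 1 - a)"
      "(\<lambda>n. norm (f n)) \<longlonglongrightarrow> norm a"
      by (intro tendsto_intros assms)+
    show "\<exists>N. \<forall>n\<ge>N. norm (norm (f n) *\<^sub>R 1 - f n) \<le> norm (f n)"
      using pos_norm_bound[OF assms(1)] by auto
  qed
  ultimately show ?thesis by (auto simp: pos_def)
qed

text \<open>\<open>a * (M - r) = M * a - 1\<close> is a product of commuting positive elements;
  dividing by \<open>M\<close> turns a norm bound on the inverse into a lower bound for
  \<open>a\<close>.\<close>

lemma pos_inverse_bound:
  assumes "pos (a :: 'a::cstar_algebra)" and r: "a * r = 1" "r * a = 1" and M: "norm r \<le> M" "M > 0"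
  shows "pos (a - (1/M) *\<^sub>R 1)"
proof -
  have "star r * (a * r) = star (a * r) * r" using assms(1) by (simp add: star_mult posD mult.assoc)
  then have sr: "star r = r" using r by simp
  have "pos (M *\<^sub>R 1 - r)" using sr M by (intro pos_norm_diff) auto
  moreover have "a * (M *\<^sub>R 1 - r) = (M *\<^sub>R 1 - r) * a" using r by (simp add: algebra_simps)
  ultimately obtain v where v: "star v = v" "v * v = a * (M *\<^sub>R 1 - r)"
    using pos_commuting_mult[OF assms(1)] by blast
  have "(1/M) *\<^sub>R (v * v) = a - (1/M) *\<^sub>R 1"
    using r M by (simp add: v(2) right_diff_distrib scaleR_diff_right)
  then show ?thesis using pos_scaleR[OF pos_square[OF v(1)], of "1/M"] M by simp
qed

text \<open>The infimum of the \<open>\<mu> \<ge> 0\<close> with \<open>p + \<mu>\<close> positive is attained; were it nonzero,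
  invertibility of \<open>p + \<mu>\<close> would allow to lower it.\<close>

lemma pos_of_invertible_shifts:
  fixes p :: "'a::cstar_algebra"
  assumes p: "star p = p" and inv: "\<And>\<mu>. \<mu> > 0 \<Longrightarrow> \<exists>r. (p + \<mu> *\<^sub>R 1) * r = 1 \<and> r * (p + \<mu> *\<^sub>R 1) = 1"
  shows "pos p"
proof -
  define \<Lambda> where "\<Lambda> = {\<mu>. \<mu> \<ge> 0 \<and> pos (p + \<mu> *\<^sub>R 1)}"
  have "norm p \<in> \<Lambda>" using p pos_norm_diff(2)[of p "norm p"] by (simp add: \<Lambda>_def add.commute)
  have bdd: "bdd_below \<Lambda>" by (auto simp: \<Lambda>_def intro: bdd_belowI[of _ 0])
  have "closed \<Lambda>"
    unfolding closed_sequential_limits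
  proof safe
    fix f l assume f: "\<forall>n. f n \<in> \<Lambda>" "f \<longlonglongrightarrow> l"
    have "l \<ge> 0" using f by (intro LIMSEQ_le_const[OF f(2)]) (auto simp: \<Lambda>_def)
    moreover have "(\<lambda>n. p + f n *\<^sub>R 1) \<longlonglongrightarrow> p + l *\<^sub>R 1" by (intro tendsto_intros f)
    then have "pos (p + l *\<^sub>R 1)" 
      by (rule pos_closed[rotated]) (use f in \<open>auto simp: \<Lambda>_def\<close>)
    ultimately show "l \<in> \<Lambda>" by (simp add: \<Lambda>_def)
  qed
  then have mem: "Inf \<Lambda> \<in> \<Lambda>" using closed_contains_Inf[OF _ bdd] \<open>norm p \<in> \<Lambda>\<close> by blast
  define l where "l = Inf \<Lambda>"
  have l: "l \<ge> 0" "pos (p + l *\<^sub>R 1)" using mem by (auto simp: \<Lambda>_def l_def)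
  have "l = 0"
  proof (rule ccontr)
    assume "l \<noteq> 0"
    with l have "l > 0" by simp
    with inv obtain r where r: "(p + l *\<^sub>R 1) * r = 1" "r * (p + l *\<^sub>R 1) = 1" by blast
    then have "r \<noteq> 0" by auto
    then have "pos (p + l *\<^sub>R 1 - (1 / norm r) *\<^sub>R 1)"
      using pos_inverse_bound[OF l(2) r, of "norm r"] by simp
    then have *: "pos (p + (l - 1 / norm r) *\<^sub>R 1)" by (simp add: algebra_simps)
    \<comment> \<open>Shifts in \<open>\<Lambda>\<close> are nonnegative, so the lowered shift is
      truncated at 0.\<close>
    define m where "m = max 0 (l - 1 / norm r)"
    have "pos (p + (l - 1 / norm r) *\<^sub>R 1 + (m - (l - 1 / norm r)) *\<^sub>R 1)"
      by (intro pos_add * pos_scaleR_one) (simp add: m_def)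
    then have "m \<in> \<Lambda>" by (simp add: \<Lambda>_def m_def algebra_simps)
    then have "l \<le> m" unfolding l_def using bdd by (rule cInf_lower)
    moreover have "m < l" using \<open>l > 0\<close> \<open>r \<noteq> 0\<close> by (simp add: m_def)
    ultimately show False by simp
  qed
  with l show ?thesis by simp
qed

lemma two_sided_inverse:
  fixes a :: "'a::monoid_mult"
  assumes "a * r = 1" "l * a = 1" shows "r * a = 1"
proof -
  have "l * (a * r) = l * a * r" by (simp add: mult.assoc)
  with assms show ?thesis by simp
qed

lemma neumann_inverse:
  fixes q :: "'a::cstar_algebra"
  assumes S: "closed S" "1 \<in> S" "\<And>x y. x \<in> S \<Longrightarrow> y \<in> S \<Longrightarrow> x + y \<in> S" "\<And>x y. x \<in> S \<Longrightarrow> y \<in> S \<Longrightarrow> x * y \<in> S"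
    and q: "q \<in> S" "norm q < 1"
  shows "\<exists>r\<in>S. (1 - q) * r = 1 \<and> r * (1 - q) = 1"
proof -
  have sm: "summable (\<lambda>n. q ^ n)" using q(2) by (rule complete_algebra_summable_geometric)
  have pw: "q ^ n \<in> S" for n by (induction n) (auto intro: S q)
  \<comment> \<open>Only nonempty partial sums are used, since the hypotheses do not place 0 in
    \<open>S\<close>.\<close>
  have part: "(\<Sum>k<Suc n. q ^ k) \<in> S" for n
    by (induction n) (auto intro: S pw simp del: power_Suc)
  have lim: "(\<lambda>n. \<Sum>k<Suc n. q ^ k) \<longlonglongrightarrow> suminf (\<lambda>n. q ^ n)"
    using summable_LIMSEQ[OF sm] by (rule LIMSEQ_Suc)
  have "suminf (\<lambda>n. q ^ n) \<in> S"
    by (rule closed_sequentially[OF S(1) _ lim]) (use part in auto)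
  moreover have "suminf (\<lambda>n. q ^ n) = 1 + q * suminf (\<lambda>n. q ^ n)"
    using suminf_split_head[OF sm] suminf_mult[OF sm, of q] by (simp add: algebra_simps)
  moreover have "suminf (\<lambda>n. q ^ n) = 1 + suminf (\<lambda>n. q ^ n) * q"
    using suminf_split_head[OF sm] suminf_mult2[OF sm, of q]
    by (simp add: algebra_simps power_commutes[symmetric])
  ultimately show ?thesis
    by (intro bexI[of _ "suminf (\<lambda>n. q ^ n)"]) (auto simp: algebra_simps)
qed

text \<open>With \<open>u = t + \<mu>\<close> the element is \<open>u (1 - (t - p) / u)\<close>, and
  \<open>norm (t - p) \<le> t < u\<close>, so the Neumann series applies.\<close>

lemma pos_invertible:
  fixes p :: "'a::cstar_algebra"
  assumes "pos p" "\<mu> > 0"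
  shows "\<exists>r. (p + \<mu> *\<^sub>R 1) * r = 1 \<and> r * (p + \<mu> *\<^sub>R 1) = 1"
proof -
  obtain t where t: "norm (t *\<^sub>R 1 - p) \<le> t" using assms by (auto simp: pos_def)
  then have "t \<ge> 0" using norm_ge_zero order.trans by blast
  define u where "u = t + \<mu>"
  have "u > 0" "norm (t *\<^sub>R 1 - p) < u" using t \<open>t \<ge> 0\<close> assms by (auto simp: u_def)
  then have "norm ((1/u) *\<^sub>R (t *\<^sub>R 1 - p)) < 1" by simp
  from neumann_inverse[of UNIV, OF _ _ _ _ _ this] obtain r
    where r: "(1 - (1/u) *\<^sub>R (t *\<^sub>R 1 - p)) * r = 1" "r * (1 - (1/u) *\<^sub>R (t *\<^sub>R 1 - p)) = 1"
    by auto
  have "p + \<mu> *\<^sub>R 1 = u *\<^sub>R (1 - (1/u) *\<^sub>R (t *\<^sub>R 1 - p))"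
    using \<open>u > 0\<close> by (simp add: scaleR_diff_right) (simp add: u_def algebra_simps)
  then show ?thesis using r \<open>u > 0\<close> by (intro exI[of _ "(1/u) *\<^sub>R r"]) simp
qed

text \<open>With \<open>h\<^sub>-\<close> the negative part of \<open>h = a\<^sup>*a\<close> and \<open>c = a h\<^sub>-\<close>, both \<open>-c\<^sup>*c = h\<^sub>-\<^sup>3\<close> and
  \<open>-cc\<^sup>*\<close> are positive, whereas \<open>c\<^sup>*c + cc\<^sup>*\<close> is a sum of squares.\<close>

lemma pos_star_mult: "pos (star a * (a :: 'a::cstar_algebra))"
proof -
  define h where "h = star a * a"
  have h: "star h = h" by (simp add: h_def star_mult star_star)
  obtain k where k: "pos k" "k * k = h * h" "\<forall>d. d * (h * h) = h * h * d \<longrightarrow> d * k = k * d"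
    using pos_sqrt[OF pos_square[OF h]] by blast
  have hk: "h * k = k * h" by (rule k(3)[rule_format]) (simp add: mult.assoc)
  \<comment> \<open>With \<open>k\<close> the absolute value of \<open>h\<close>, \<open>m\<close>
    and \<open>l\<close> are the negative and the positive part of \<open>h\<close>.\<close>
  define m where "m = (1/2) *\<^sub>R (k - h)"
  define l where "l = (1/2) *\<^sub>R (k + h)"
  have lm: "l * m = 0" "m * l = 0" using k(2) hk by (simp_all add: l_def m_def algebra_simps)
  have km: "l + m = k" by (simp add: l_def m_def scaleR_right_distrib[symmetric] scaleR_2[symmetric])
  have hm: "h = l - m" by (simp add: l_def m_def scaleR_diff_right[symmetric] scaleR_2[symmetric])
  have sm: "star m = m" by (simp add: m_def star_diff h posD[OF k(1)])
  have pm: "pos m"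
  proof (rule pos_of_invertible_shifts[OF sm])
    fix \<mu> :: real assume "\<mu> > 0"
    with pos_invertible[OF k(1)] obtain r where r: "(k + \<mu> *\<^sub>R 1) * r = 1" "r * (k + \<mu> *\<^sub>R 1) = 1" by blast
    let ?m = "m + \<mu> *\<^sub>R 1" and ?l = "l + \<mu> *\<^sub>R 1"
    \<comment> \<open>Because \<open>m\<close> and \<open>l\<close> annihilate each other,
      \<open>m + \<mu>\<close> divides \<open>\<mu> (k + \<mu>)\<close>, which is
      invertible.\<close>
    have ml: "?m * ?l = \<mu> *\<^sub>R (k + \<mu> *\<^sub>R 1)" "?l * ?m = \<mu> *\<^sub>R (k + \<mu> *\<^sub>R 1)"
      by (simp_all add: algebra_simps lm km[symmetric])
    have 1: "?m * ((1/\<mu>) *\<^sub>R (?l * r)) = 1" 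
      using ml r \<open>\<mu> > 0\<close> by (simp add: mult.assoc[symmetric])
    have 2: "((1/\<mu>) *\<^sub>R (r * ?l)) * ?m = 1"
      using ml r \<open>\<mu> > 0\<close> by (simp add: mult.assoc)
    show "\<exists>r. ?m * r = 1 \<and> r * ?m = 1" using two_sided_inverse[OF 1 2] 1 by blast
  qed
  define c where "c = a * m"
  have "star c * c = m * h * m" by (simp add: c_def star_mult sm h_def mult.assoc)
  then have cc: "- (star c * c) = m * m * m" by (simp add: hm algebra_simps lm)
  obtain v where v: "star v = v" "v * v = m * (m * m)"
    using pos_commuting_mult[OF pm pos_square[OF sm]] by (metis mult.assoc)
  have ncc: "pos (- (star c * c))" using pos_square[OF v(1)] v(2) cc by (simp add: mult.assoc)
  have "pos (- (c * star c))"
  proof (rule pos_of_invertible_shifts)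
    show "star (- (c * star c)) = - (c * star c)" by (simp add: star_minus star_mult star_star)
    fix \<mu> :: real assume "\<mu> > 0"
    with pos_invertible[OF ncc] obtain r where
      r: "(- (star c * c) + \<mu> *\<^sub>R 1) * r = 1" "r * (- (star c * c) + \<mu> *\<^sub>R 1) = 1" by blast
    \<comment> \<open>Standard transfer of invertibility from \<open>\<mu> - star c * c\<close> to
      \<open>\<mu> - c * star c\<close>: the inverse of the second is expressed through that of the
      first.\<close>
    let ?R = "(1/\<mu>) *\<^sub>R (1 + c * r * star c)"
    have e1: "star c * (c * r) = \<mu> *\<^sub>R r - 1" using r(1) by (simp add: algebra_simps)
    have e2: "r * (star c * c) = \<mu> *\<^sub>R r - 1" using r(2) by (simp add: algebra_simps)
    have "c * star c * (c * r * star c) = c * (star c * (c * r)) * star c" by (simp add: mult.assoc)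
    also have "\<dots> = \<mu> *\<^sub>R (c * r * star c) - c * star c" unfolding e1 by (simp add: algebra_simps)
    finally have f1: "c * star c * (c * r * star c) = \<mu> *\<^sub>R (c * r * star c) - c * star c" .
    have "c * r * star c * (c * star c) = c * (r * (star c * c)) * star c" by (simp add: mult.assoc)
    also have "\<dots> = \<mu> *\<^sub>R (c * r * star c) - c * star c" unfolding e2 by (simp add: algebra_simps)
    finally have f2: "c * r * star c * (c * star c) = \<mu> *\<^sub>R (c * r * star c) - c * star c" .
    have "(- (c * star c) + \<mu> *\<^sub>R 1) * (1 + c * r * star c) = \<mu> *\<^sub>R 1"
      using f1 by (simp add: ring_distribs scaleR_right_distrib)
    moreover have "(1 + c * r * star c) * (- (c * star c) + \<mu> *\<^sub>R 1) = \<mu> *\<^sub>R 1"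
      using f2 by (simp add: ring_distribs scaleR_right_distrib)
    ultimately show "\<exists>r. (- (c * star c) + \<mu> *\<^sub>R 1) * r = 1 \<and> r * (- (c * star c) + \<mu> *\<^sub>R 1) = 1"
      using \<open>\<mu> > 0\<close> by (intro exI[of _ ?R]) simp
  qed
  moreover have "pos (star c * c + c * star c)"
  proof -
    \<comment> \<open>Up to real factors, \<open>u\<close> and \<open>w\<close> are the real and
      imaginary parts of \<open>c\<close>.\<close>
    define u where "u = c + star c"
    define w where "w = scaleC \<i> (c - star c)"
    have "star u = u" "star w = w"
      by (simp_all add: u_def w_def star_add star_star star_scaleC star_diff scaleC_minus_left scaleC_diff_right)
    moreover have "u * u + w * w = 2 *\<^sub>R (star c * c + c * star c)"
      by (simp add: u_def w_def ring_distribs mult_scaleC_left mult_scaleC_right scaleC_scaleC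
          scaleC_minus_left scaleC_one scaleC_diff_right scaleR_2 scaleC_add_right scaleC_minus_right)
    ultimately have "pos (2 *\<^sub>R (star c * c + c * star c))" by (metis pos_add pos_square)
    from pos_scaleR[OF this, of "1/2"] show ?thesis by simp
  qed
  ultimately have "pos (star c * c)" using pos_add by fastforce
  from pos_norm_mono[OF this, of 0] ncc have "star c * c = 0" by simp
  then have "m * (m * m) = 0" using cc by (simp add: mult.assoc)
  then have "star (m * m) * (m * m) = 0" by (simp add: star_mult sm mult.assoc)
  then have "m * m = 0" using cstar_identity[of "m * m"] by simp
  then have "m = 0" using cstar_identity[of m] sm by simp
  then show ?thesis using km hm k(1) h_def by simp
qed

lemma pos_conj:
  assumes "pos (p :: 'a::cstar_algebra)" shows "pos (star c * p * c)"
proof -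
  obtain s where "pos s" "s * s = p" using pos_sqrt[OF assms] by blast
  then have "star (s * c) * (s * c) = star c * p * c"
    by (metis mult.assoc posD star_mult)
  then show ?thesis using pos_star_mult[of "s * c"] by simp
qed

section \<open>Imaginary parts and invertibility\<close>

text \<open>The closure properties that a Neumann series with complex scalars uses, without
  adjoints. \<open>B\<close>, the whole algebra and the algebras generated by variables are all
  instances, so inverses can be located in any of them.\<close>

definition closed_alg :: "'a::cstar_algebra set \<Rightarrow> bool" where
  "closed_alg S \<longleftrightarrow> 1 \<in> S \<and> closed S \<and> (\<forall>x\<in>S. \<forall>y\<in>S. x + y \<in> S \<and> x * y \<in> S) \<and>
     (\<forall>c. \<forall>x\<in>S. scaleC c x \<in> S)"

lemma closed_algD:
  assumes "closed_alg S"
  shows "1 \<in> S" "closed S" "x \<in> S \<Longrightarrow> y \<in> S \<Longrightarrow> x + y \<in> S" "x \<in> S \<Longrightarrow> y \<in> S \<Longrightarrow> x * y \<in> S"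
    "x \<in> S \<Longrightarrow> scaleC c x \<in> S" "x \<in> S \<Longrightarrow> r *\<^sub>R x \<in> S" "x \<in> S \<Longrightarrow> - x \<in> S"
    "x \<in> S \<Longrightarrow> y \<in> S \<Longrightarrow> x - y \<in> S" "0 \<in> S"
proof -
  have sc: "scaleC c x \<in> S" if "x \<in> S" for c x using assms that by (auto simp: closed_alg_def)
  have sr: "r *\<^sub>R x \<in> S" if "x \<in> S" for r x
    using sc[OF that, of "complex_of_real r"] by (simp add: scaleC_of_real)
  show "1 \<in> S" "closed S" "x \<in> S \<Longrightarrow> y \<in> S \<Longrightarrow> x + y \<in> S" "x \<in> S \<Longrightarrow> y \<in> S \<Longrightarrow> x * y \<in> S"
    using assms by (auto simp: closed_alg_def)
  show "x \<in> S \<Longrightarrow> scaleC c x \<in> S" "x \<in> S \<Longrightarrow> r *\<^sub>R x \<in> S" by (fact sc sr)+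
  show "x \<in> S \<Longrightarrow> - x \<in> S" using sr[of x "-1"] by simp
  show "0 \<in> S" using sr[of 1 0] assms by (simp add: closed_alg_def)
  show "x \<in> S \<Longrightarrow> y \<in> S \<Longrightarrow> x - y \<in> S"
    using sr[of y "-1"] assms by (auto simp: closed_alg_def dest: bspec[of _ _ x] bspec[of _ _ "-y"])
qed

lemma closed_alg_UNIV: "closed_alg UNIV"
  by (simp add: closed_alg_def)

lemma closed_alg_cstar_subalgebra: "cstar_subalgebra B \<Longrightarrow> closed_alg B"
  by (simp add: closed_alg_def cstar_subalgebra_def)

section \<open>Uniqueness of inverses and calculus of imaginary parts\<close>

lemma inv_el_eqI:
  fixes c :: "'a::cstar_algebra"
  assumes "c * d = 1" "d * c = 1" shows "inv_el c = d"
  unfolding inv_el_def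
proof (rule the_equality)
  show "c * d = 1 \<and> d * c = 1" using assms by simp
  fix e assume e: "c * e = 1 \<and> e * c = 1"
  have "e = e * (c * d)" using assms by simp
  also have "\<dots> = d" using e by (simp add: mult.assoc[symmetric])
  finally show "e = d" .
qed

lemma invertible_inD:
  fixes c :: "'a::cstar_algebra"
  assumes "invertible_in S c"
  shows "inv_el c \<in> S" "c * inv_el c = 1" "inv_el c * c = 1"
  using assms inv_el_eqI[of c] by (auto simp: invertible_in_def)

lemma Im_el_add: "Im_el (v + w) = Im_el v + Im_el (w :: 'a::cstar_algebra)"
  by (simp add: Im_el_def star_add scaleC_diff_right scaleC_add_right)

lemma Im_el_minus: "Im_el (- w) = - Im_el (w :: 'a::cstar_algebra)"
  by (simp add: Im_el_def star_minus scaleC_diff_right scaleC_minus_right)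

lemma Im_el_diff: "Im_el (v - w) = Im_el v - Im_el (w :: 'a::cstar_algebra)"
  using Im_el_add[of v "-w"] by (simp add: Im_el_minus)

lemma Im_el_star: "Im_el (star w) = - Im_el (w :: 'a::cstar_algebra)"
  by (simp add: Im_el_def star_star scaleC_diff_right)

lemma Im_el_selfadj: "star w = w \<Longrightarrow> Im_el (w :: 'a::cstar_algebra) = 0"
  by (simp add: Im_el_def)

lemma Im_el_scalar: "Im_el (scaleC z (1 :: 'a::cstar_algebra)) = Im z *\<^sub>R 1"
proof -
  have "1 / (2 * \<i>) * (z - cnj z) = complex_of_real (Im z)" by (simp add: complex_eq_iff)
  then show ?thesis
    by (simp add: Im_el_def star_scaleC scaleC_diff_left[symmetric] scaleC_scaleC scaleC_of_real
        del: times_divide_eq_left)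
qed

lemma Im_el_conj: "Im_el (star c * w * c) = star c * Im_el w * (c :: 'a::cstar_algebra)"
  by (simp add: Im_el_def star_mult star_star mult_scaleC_left mult_scaleC_right mult.assoc
      right_diff_distrib left_diff_distrib)

lemma norm_Im_el: "norm (Im_el w) \<le> norm (w :: 'a::cstar_algebra)"
  using norm_triangle_ineq4[of w "star w"] by (simp add: Im_el_def norm_scaleC norm_divide)

definition above :: "real \<Rightarrow> 'a::cstar_algebra \<Rightarrow> bool" where
  "above \<delta> w \<longleftrightarrow> pos (Im_el w - \<delta> *\<^sub>R 1)"

lemma above_diff_selfadj: "above \<delta> w \<Longrightarrow> star a = a \<Longrightarrow> above \<delta> (w - a)"
  by (simp add: above_def Im_el_diff Im_el_selfadj)

lemma above_scalar: "\<delta> \<le> Im z \<Longrightarrow> above \<delta> (scaleC z 1)"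
  using pos_scaleR_one[of "Im z - \<delta>"] by (simp add: above_def Im_el_scalar scaleR_diff_left)

text \<open>The imaginary part of \<open>star a * w * a\<close> is at least
  \<open>\<delta> *\<^sub>R (star a * a)\<close>; comparing norms and cancelling
  \<open>norm a\<close> gives the bound. As \<open>w\<close> need not be invertible for this, any
  inverse is controlled as soon as one exists.\<close>

lemma above_lower_bound:
  fixes w :: "'a::cstar_algebra"
  assumes "above \<delta> w" "\<delta> > 0"
  shows "\<delta> * norm a \<le> norm (w * a)"
proof -
  have "pos (star a * (Im_el w - \<delta> *\<^sub>R 1) * a)"
    using assms(1) by (intro pos_conj) (simp add: above_def)
  then have 1: "pos (Im_el (star a * w * a) - \<delta> *\<^sub>R (star a * a))"
    unfolding Im_el_conj by (simp add: right_diff_distrib left_diff_distrib)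
  have "pos (\<delta> *\<^sub>R (star a * a))" using assms(2) by (intro pos_scaleR pos_star_mult) simp
  from pos_norm_mono[OF this 1] have "\<delta> * (norm a)\<^sup>2 \<le> norm (Im_el (star a * w * a))"
    using assms(2) by (simp add: cstar_identity)
  also have "\<dots> \<le> norm (star a * w * a)" by (rule norm_Im_el)
  also have "\<dots> \<le> norm a * norm (w * a)"
    using norm_mult_ineq[of "star a" "w * a"] by (simp add: mult.assoc)
  finally have "norm a * (\<delta> * norm a) \<le> norm a * norm (w * a)" by (simp add: power2_eq_square mult_ac)
  then show ?thesis by (cases "a = 0") auto
qed

text \<open>The inverse of \<open>w + it\<close> has norm at most \<open>1/\<delta>\<close> wherever it exists, so invertibility
  propagates in steps of length \<open>\<delta>/2\<close> from large \<open>t\<close>, where the Neumann series converges, down to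
  \<open>t = 0\<close>; all inverses stay in the closed algebra \<open>S\<close>.\<close>

lemma above_invertible:
  fixes w :: "'a::cstar_algebra"
  assumes S: "closed_alg S" and w: "w \<in> S" "above \<delta> w" "\<delta> > 0"
  shows "invertible_in S w" and "norm (inv_el w) \<le> 1 / \<delta>"
proof -
  define W where "W t = w + scaleC (\<i> * complex_of_real t) 1" for t
  note S' = closed_algD[OF S]
  have WS: "W t \<in> S" for t by (auto simp: W_def intro: S' w)
  have Wab: "above \<delta> (W t)" if "t \<ge> 0" for t
    using pos_add[OF w(2)[unfolded above_def] pos_scaleR_one[OF that]]
    by (simp add: above_def W_def Im_el_add Im_el_scalar algebra_simps)
  have inv: "invertible_in S (W t)" if "t \<ge> 0" "t \<ge> norm w + 1 - real n * (\<delta> / 2)" for n t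
    using that
  proof (induction n arbitrary: t)
    case 0
    \<comment> \<open>For large \<open>t\<close>, \<open>w + i t = i t (1 - q)\<close> with
      \<open>norm q < 1\<close>.\<close>
    define q where "q = scaleC (\<i> / t) w"
    have t: "t > norm w" "t > 0" using 0 norm_ge_zero[of w] by linarith+
    have "norm q < 1" using t by (simp add: q_def norm_scaleC norm_divide)
    moreover have "q \<in> S" by (auto simp: q_def intro: S' w)
    ultimately obtain r where r: "r \<in> S" "(1 - q) * r = 1" "r * (1 - q) = 1"
      using neumann_inverse[of S q] S' by blast
    have W: "W t = scaleC (\<i> * complex_of_real t) (1 - q)"
      using t by (simp add: W_def q_def scaleC_diff_right scaleC_scaleC scaleC_minus_left scaleC_one)
    have "scaleC (1 / (\<i> * complex_of_real t)) r \<in> S" by (intro S' r)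
    then show ?case
      using r t unfolding W invertible_in_def
      by (intro bexI[of _ "scaleC (1 / (\<i> * complex_of_real t)) r"])
         (simp_all add: mult_scaleC_left mult_scaleC_right scaleC_scaleC scaleC_one)
  next
    case (Suc n)
    define t' where "t' = t + \<delta> / 2"
    have "invertible_in S (W t')"
      using Suc.prems w(3) by (intro Suc.IH) (simp_all add: t'_def field_simps)
    then obtain r where r: "r \<in> S" "W t' * r = 1" "r * W t' = 1" by (auto simp: invertible_in_def)
    have "\<delta> * norm r \<le> 1"
      using above_lower_bound[OF Wab, of t' r] r Suc.prems w(3) by (simp add: t'_def)
    then have nr: "norm r \<le> 1 / \<delta>" using w(3) by (simp add: field_simps)
    define q where "q = scaleC (\<i> * complex_of_real (\<delta> / 2)) r"
    have "norm q \<le> 1 / 2" using nr w(3) by (simp add: q_def norm_scaleC norm_mult field_simps)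
    moreover have "q \<in> S" by (auto simp: q_def intro: S' r)
    ultimately obtain u where u: "u \<in> S" "(1 - q) * u = 1" "u * (1 - q) = 1"
      using neumann_inverse[of S q] S' by fastforce
    have "W t' * q = scaleC (\<i> * complex_of_real (\<delta> / 2)) 1"
      by (simp add: q_def mult_scaleC_right r)
    then have Wt: "W t = W t' * (1 - q)"
      by (simp add: right_diff_distrib W_def t'_def distrib_left scaleC_add_left)
    have "W t * (u * r) = W t' * ((1 - q) * u) * r" by (simp add: Wt mult.assoc)
    then have "W t * (u * r) = 1" using u r by simp
    moreover have "u * r * W t = u * (r * W t') * (1 - q)" by (simp add: Wt mult.assoc)
    then have "u * r * W t = 1" using u r by simp
    ultimately show ?case unfolding invertible_in_def using S'(4)[OF u(1) r(1)] by blast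
  qed
  obtain n :: nat where "real n > (norm w + 1) / (\<delta> / 2)" using reals_Archimedean2 by blast
  then have "norm w + 1 - real n * (\<delta> / 2) \<le> 0" using w(3) by (simp add: field_simps)
  then have "invertible_in S (W 0)" by (intro inv[of 0 n]) auto
  then show i: "invertible_in S w" by (simp add: W_def)
  have "\<delta> * norm (inv_el w) \<le> 1"
    using above_lower_bound[OF w(2,3), of "inv_el w"] invertible_inD[OF i] by simp
  then show "norm (inv_el w) \<le> 1 / \<delta>" using w(3) by (simp add: field_simps)
qed

lemma pos_of_positive_in:
  fixes p :: "'a::cstar_algebra"
  assumes "star p = p"
    and inv: "\<And>z. z \<notin> complex_of_real ` {0..} \<Longrightarrow> invertible_in S (p - scaleC z 1)"
  shows "pos p"
proof (rule pos_of_invertible_shifts[OF assms(1)])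
  fix \<mu> :: real assume "\<mu> > 0"
  then have "complex_of_real (- \<mu>) \<notin> complex_of_real ` {0..}" by (auto simp del: of_real_minus)
  from inv[OF this] show "\<exists>r. (p + \<mu> *\<^sub>R 1) * r = 1 \<and> r * (p + \<mu> *\<^sub>R 1) = 1"
    by (auto simp: invertible_in_def scaleC_minus_left scaleC_of_real)
qed

text \<open>Off the real axis \<open>p - z\<close> or its negative lies above a positive level; on
  the negative axis it is a positive shift of \<open>p\<close>. This turns \<open>pos\<close> back
  into the spectral condition in which complete positivity is phrased.\<close>

lemma pos_invertible_in:
  fixes p :: "'a::cstar_algebra"
  assumes "pos p" "z \<notin> complex_of_real ` {0..}"
  shows "invertible_in UNIV (p - scaleC z 1)"
proof -
  have "z \<noteq> complex_of_real (Re z) \<or> Re z < 0" using assms(2) by fastforce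
  then consider "Im z \<noteq> 0" | "Im z = 0" "Re z < 0" by (auto simp: complex_eq_iff)
  then show ?thesis
  proof cases
    case 1
    consider "Im z < 0" | "Im z > 0" using 1 by linarith
    then show ?thesis
    proof cases
      case 1
      have "above (- Im z) (p - scaleC z 1)"
        by (simp add: above_def Im_el_diff Im_el_selfadj Im_el_scalar posD[OF assms(1)])
      then show ?thesis using above_invertible(1)[OF closed_alg_UNIV UNIV_I] 1 by (metis neg_0_less_iff_less)
    next
      case 2
      have "above (Im z) (- (p - scaleC z 1))"
        by (simp only: above_def Im_el_minus Im_el_diff Im_el_selfadj Im_el_scalar posD[OF assms(1)]) simp
      then have "invertible_in UNIV (- (p - scaleC z 1))"
        using above_invertible(1)[OF closed_alg_UNIV UNIV_I] 2 by blast
      then obtain r where "- (p - scaleC z 1) * r = 1" "r * - (p - scaleC z 1) = 1"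
        unfolding invertible_in_def by blast
      then have "(p - scaleC z 1) * - r = 1" "- r * (p - scaleC z 1) = 1"
        by (simp_all only: minus_mult_commute)
      then show ?thesis unfolding invertible_in_def by blast
    qed
  next
    case 2
    have "scaleC z 1 = Re z *\<^sub>R (1 :: 'a)"
      using 2 scaleC_of_real[of "Re z" "1 :: 'a"] by (simp add: complex_is_Real_iff of_real_Re)
    then show ?thesis using pos_invertible[OF assms(1), of "- Re z"] 2
      by (auto simp: invertible_in_def)
  qed
qed

text \<open>Here the level \<delta> is fixed as the reciprocal norm of the inverse imaginary part;
  it is the source of that norm in the final bound.\<close>

lemma upper_half_above:
  assumes "b \<in> upper_half (B :: 'a::cstar_algebra set)"
  shows "norm (inv_el (Im_el b)) > 0" "above (1 / norm (inv_el (Im_el b))) b" "b \<in> B"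
proof -
  have p: "positive_in B (Im_el b)" and i: "invertible_in B (Im_el b)" and b: "b \<in> B"
    using assms by (auto simp: upper_half_def)
  have "pos (Im_el b)" using p by (intro pos_of_positive_in[of _ B]) (auto simp: positive_in_def)
  moreover have "inv_el (Im_el b) \<noteq> 0" using invertible_inD(2)[OF i] by auto
  ultimately show "norm (inv_el (Im_el b)) > 0" "above (1 / norm (inv_el (Im_el b))) b"
    using pos_inverse_bound[OF _ invertible_inD(2,3)[OF i], of "norm (inv_el (Im_el b))"]
    by (auto simp: above_def)
  show "b \<in> B" by fact
qed

section \<open>Conditional expectations\<close>

locale cond_exp_space =
  fixes B :: "'a::cstar_algebra set" and E :: "'a \<Rightarrow> 'a"
  assumes space: "opval_cstar_prob_space B E"
begin

lemma closed_alg_B: "closed_alg B"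
  using space by (simp add: opval_cstar_prob_space_def closed_alg_cstar_subalgebra)

lemmas B_intros = closed_algD[OF closed_alg_B]

lemma B_star: "b \<in> B \<Longrightarrow> star b \<in> B"
  using space by (simp add: opval_cstar_prob_space_def cstar_subalgebra_def)

lemma E_in_B: "E a \<in> B"
  and E_add: "E (a + c) = E a + E c"
  and E_scaleC: "E (scaleC z a) = scaleC z (E a)"
  and E_B: "b \<in> B \<Longrightarrow> E b = b"
  and E_bimod: "b1 \<in> B \<Longrightarrow> b2 \<in> B \<Longrightarrow> E (b1 * a * b2) = b1 * E a * b2"
  using space by (auto simp: opval_cstar_prob_space_def cond_exp_def)

lemma E_scaleR: "E (r *\<^sub>R a) = r *\<^sub>R E a"
  using E_scaleC[of "complex_of_real r" a] by (simp add: scaleC_of_real)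

lemma E_zero: "E 0 = 0" and E_minus: "E (- a) = - E a"
  using E_scaleR[of 0 a] E_scaleR[of "-1" a] by simp_all

lemma E_diff: "E (a - c) = E a - E c"
  using E_add[of a "-c"] by (simp add: E_minus)

lemma E_one: "E 1 = 1"
  by (simp add: E_B B_intros)

lemma E_left: "b \<in> B \<Longrightarrow> E (b * a) = b * E a" and E_right: "b \<in> B \<Longrightarrow> E (a * b) = E a * b"
  using E_bimod[of b 1 a] E_bimod[of 1 b a] B_intros(1) by simp_all

text \<open>Complete positivity is applied to matrices of size one, with the spectral and the norm
  form of positivity exchanged on both sides.\<close>

lemma E_pos:
  assumes "pos p" shows "pos (E p)"
proof -
  have "mat_positive_in UNIV 1 (\<lambda>i j. p)"
    unfolding mat_positive_in_def
  proof (intro conjI allI impI)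
    fix z :: complex assume "z \<notin> complex_of_real ` {0..}"
    from pos_invertible_in[OF assms this] obtain d where
      "(p - scaleC z 1) * d = 1" "d * (p - scaleC z 1) = 1" by (auto simp: invertible_in_def)
    then show "mat_invertible_in UNIV 1 (\<lambda>i j. p - scaleC z (mat_id i j))"
      unfolding mat_invertible_in_def
      by (intro exI[of _ "\<lambda>_ _. d"]) (simp add: mat_mul_def mat_id_def)
  qed (use posD[OF assms] in auto)
  then have "mat_positive_in B 1 (\<lambda>i j. E p)"
    using space by (auto simp: opval_cstar_prob_space_def completely_positive_def)
  then show ?thesis
    by (intro pos_of_positive_in[of _ B])
       (auto simp: mat_positive_in_def mat_invertible_in_def mat_mul_def mat_id_def invertible_in_def)
qed

lemma E_selfadj:
  assumes "star h = h" shows "star (E h) = E h"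
proof -
  have "pos (norm h *\<^sub>R 1 - h)" using assms by (intro pos_norm_diff) auto
  from posD[OF E_pos[OF this]] show ?thesis by (simp add: E_diff E_scaleR E_one star_diff)
qed

lemma E_star: "E (star a) = star (E a)"
proof -
  define u where "u = a + star a"
  define v where "v = scaleC \<i> (a - star a)"
  have uv: "star u = u" "star v = v"
    by (simp_all add: u_def v_def star_add star_star star_scaleC star_diff scaleC_minus_left scaleC_diff_right)
  have vi: "scaleC (- \<i>) v = a - star a"
    by (simp add: v_def scaleC_scaleC scaleC_one)
  have a: "a = (1/2) *\<^sub>R (u + scaleC (- \<i>) v)" and sa: "star a = (1/2) *\<^sub>R (u - scaleC (- \<i>) v)"
    unfolding vi u_def by (simp_all add: scaleR_2[symmetric])
  have "E (star a) = (1/2) *\<^sub>R (E u - scaleC (- \<i>) (E v))"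
    unfolding sa by (simp add: E_scaleR E_diff E_scaleC)
  also have "\<dots> = star ((1/2) *\<^sub>R (E u + scaleC (- \<i>) (E v)))"
    using E_selfadj[OF uv(1)] E_selfadj[OF uv(2)]
    by (simp add: star_add star_diff star_scaleC scaleC_minus_left)
  also have "(1/2) *\<^sub>R (E u + scaleC (- \<i>) (E v)) = E a"
    by (subst a) (simp add: E_scaleR E_add E_scaleC)
  finally show ?thesis .
qed

text \<open>Positivity of \<open>E[z\<^sup>*z]\<close> for \<open>z = a - \<mu>c E[c\<^sup>*a]\<close>, with \<open>\<mu> = 1/\<parallel>E[c\<^sup>*c]\<parallel>\<close>.\<close>

lemma cauchy_schwarz:
  "(norm (E (star a * c)))\<^sup>2 \<le> norm (E (star a * a)) * norm (E (star c * c))"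
proof -
  define e where "e = E (star a * c)"
  define p where "p = E (star a * a)"
  define d where "d = E (star c * c)"
  have eB: "e \<in> B" "star e \<in> B" by (simp_all add: e_def E_in_B B_star)
  have se: "E (star c * a) = star e" using E_star[of "star a * c"] by (simp add: e_def star_mult star_star)
  have key: "(2 * \<mu> - \<mu>\<^sup>2 * norm d) * (norm e)\<^sup>2 \<le> norm p" if "2 * \<mu> - \<mu>\<^sup>2 * norm d \<ge> 0" for \<mu>
  proof -
    define z where "z = a - c * (\<mu> *\<^sub>R star e)"
    have "star z * z = star a * a - \<mu> *\<^sub>R (star a * c * star e) - \<mu> *\<^sub>R (e * (star c * a))
        + \<mu>\<^sup>2 *\<^sub>R (e * (star c * c) * star e)"
      by (simp add: z_def star_diff star_mult star_star right_diff_distrib left_diff_distrib mult.assoc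
          power2_eq_square scaleR_diff_right)
    then have "E (star z * z) = p - \<mu> *\<^sub>R (e * star e) - \<mu> *\<^sub>R (e * star e) + \<mu>\<^sup>2 *\<^sub>R (e * d * star e)"
      by (simp add: E_add E_diff E_scaleR E_bimod eB E_left E_right se p_def d_def e_def[symmetric])
    then have 1: "pos (p - (2 * \<mu>) *\<^sub>R (e * star e) + \<mu>\<^sup>2 *\<^sub>R (e * d * star e))"
      using E_pos[OF pos_star_mult[of z]] by (simp add: scaleR_2[symmetric] diff_diff_eq scaleR_left_distrib[symmetric])
    have "pos d" unfolding d_def by (intro E_pos pos_star_mult)
    then have "pos (norm d *\<^sub>R 1 - d)" by (intro pos_norm_diff) (auto simp: posD)
    from pos_conj[OF this, of "star e"] have "pos (norm d *\<^sub>R (e * star e) - e * d * star e)"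
      by (simp add: star_star right_diff_distrib left_diff_distrib)
    from pos_scaleR[OF this, of "\<mu>\<^sup>2"] have "pos ((\<mu>\<^sup>2 * norm d) *\<^sub>R (e * star e) - \<mu>\<^sup>2 *\<^sub>R (e * d * star e))"
      by (simp add: scaleR_diff_right)
    from pos_add[OF 1 this] have 2: "pos (p - (2 * \<mu> - \<mu>\<^sup>2 * norm d) *\<^sub>R (e * star e))"
      by (simp add: scaleR_diff_left algebra_simps)
    have "pos ((2 * \<mu> - \<mu>\<^sup>2 * norm d) *\<^sub>R (e * star e))"
      using pos_star_mult[of "star e"] that by (intro pos_scaleR) (auto simp: star_star)
    from pos_norm_mono[OF this 2] show ?thesis
      using that cstar_identity[of "star e"] by (simp add: star_star)
  qed
  show ?thesis
  proof (cases "norm d = 0")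
    case False
    have c: "2 * (1 / norm d) - (1 / norm d)\<^sup>2 * norm d = 1 / norm d"
      using False by (simp add: power2_eq_square field_simps)
    have "(1 / norm d) * (norm e)\<^sup>2 \<le> norm p" using key[of "1 / norm d"] unfolding c by simp
    then show ?thesis using False by (simp add: e_def[symmetric] p_def[symmetric] d_def[symmetric] field_simps)
  next
    case True
    have "e = 0"
    proof (rule ccontr)
      assume "e \<noteq> 0"
      \<comment> \<open>If \<open>norm d = 0\<close>, the factor \<open>2 * \<mu>\<close> in
        \<open>key\<close> is unbounded; this choice of \<open>\<mu>\<close> makes the left side
        equal to \<open>norm p + 1\<close>.\<close>
      then have "2 * ((norm p + 1) / (2 * (norm e)\<^sup>2)) * (norm e)\<^sup>2 = norm p + 1" by simp
      then show False using key[of "(norm p + 1) / (2 * (norm e)\<^sup>2)"] True by simp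
    qed
    then show ?thesis by (simp add: e_def)
  qed
qed

lemma cauchy_schwarz_sqrt:
  "norm (E (star a * c)) \<le> sqrt (norm (E (star a * a))) * sqrt (norm (E (star c * c)))"
  using real_le_rsqrt[OF cauchy_schwarz] by (simp add: real_sqrt_mult)

lemma E_pos_mono: "pos (b - a) \<Longrightarrow> pos a \<Longrightarrow> norm (E a) \<le> norm (E b)"
  by (rule pos_norm_mono[OF E_pos]) (simp_all add: E_pos flip: E_diff)

text \<open>Cauchy-Schwarz against 1 bounds \<open>norm (E a)\<close> by the root of
  \<open>norm (E (star a * a))\<close>, and \<open>star a * a\<close> lies below its norm.\<close>

lemma E_contractive: "norm (E a) \<le> norm a"
proof -
  have "pos (norm (star a * a) *\<^sub>R 1 - star a * a)"
    by (rule pos_norm_diff) (simp_all add: star_mult star_star)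
  from E_pos_mono[OF this pos_star_mult] have "norm (E (star a * a)) \<le> (norm a)\<^sup>2"
    by (simp add: E_scaleR E_one cstar_identity)
  moreover have "(norm (E a))\<^sup>2 \<le> norm (E (star a * a))"
    using cauchy_schwarz[of 1 a] by (simp add: E_one)
  ultimately have "(norm (E a))\<^sup>2 \<le> (norm a)\<^sup>2" by (rule order.trans[rotated])
  then show ?thesis by (rule power2_le_imp_le) simp
qed

lemma bounded_linear_E: "bounded_linear E"
  by (rule bounded_linear_intro[where K=1]) (simp_all add: E_add E_scaleR E_contractive)

lemma E_conj_lower:
  assumes "pos (k - \<delta> *\<^sub>R 1)"
  shows "pos (E (star c * k * c) - \<delta> *\<^sub>R E (star c * c))"
  using E_pos[OF pos_conj[OF assms, of c]]
  by (simp add: right_diff_distrib left_diff_distrib E_diff E_scaleR)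

end

section \<open>The F-transform\<close>

context cond_exp_space begin

definition F_transform :: "'a \<Rightarrow> 'a \<Rightarrow> 'a" where
  "F_transform x w = inv_el (E (inv_el (w - x)))"

context
  fixes x w :: 'a and \<delta> :: real
  assumes x: "star x = x" and w: "w \<in> B" "above \<delta> w" and \<delta>: "\<delta> > 0"
begin

lemma resolvent_inverse:
  "(w - x) * inv_el (w - x) = 1" "inv_el (w - x) * (w - x) = 1" "norm (inv_el (w - x)) \<le> 1 / \<delta>"
  using invertible_inD(2,3) above_invertible[OF closed_alg_UNIV UNIV_I above_diff_selfadj[OF w(2) x] \<delta>]
  by auto

text \<open>The element \<open>- Im_el G\<close> equals \<open>star G * Im_el (w - x) * G\<close>,
  which is at least \<delta> times \<open>star G * G\<close>, and \<open>star G * G\<close> is at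
  least \<open>1 / M\<close> because its inverse has norm at most \<open>M\<close>. So
  \<open>- E G\<close> lies above \<open>\<delta> / M\<close>. This level depends on
  \<open>norm (w - x)\<close> and serves for invertibility only.\<close>

lemma E_resolvent_invertible: "invertible_in B (E (inv_el (w - x)))"
proof -
  define G where "G = inv_el (w - x)"
  note G = resolvent_inverse(1,2)[folded G_def]
  define M where "M = (norm (w - x))\<^sup>2"
  have "w - x \<noteq> 0" using G by auto
  then have M: "M > 0" by (simp add: M_def)
  have "star G * star (w - x) = star ((w - x) * G)" "star (w - x) * star G = star (G * (w - x))"
    by (simp_all only: star_mult)
  then have Gs: "star G * star (w - x) = 1" "star (w - x) * star G = 1" using G by simp_all
  have "star G * G * ((w - x) * star (w - x)) = star G * (G * (w - x)) * star (w - x)"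
    "(w - x) * star (w - x) * (star G * G) = (w - x) * (star (w - x) * star G) * G"
    by (simp_all only: mult.assoc)
  then have inv: "star G * G * ((w - x) * star (w - x)) = 1" "(w - x) * star (w - x) * (star G * G) = 1"
    using G Gs by simp_all
  have "norm ((w - x) * star (w - x)) \<le> M"
    using cstar_identity[of "star (w - x)"] by (simp add: M_def star_star)
  from pos_inverse_bound[OF pos_star_mult inv this M]
  have "pos (E (star G * G - (1 / M) *\<^sub>R 1))" by (rule E_pos)
  then have "pos (E (star G * G) - (1 / M) *\<^sub>R 1)" by (simp add: E_diff E_scaleR E_one)
  then have p1: "pos (\<delta> *\<^sub>R (E (star G * G) - (1 / M) *\<^sub>R 1))" using \<delta> by (intro pos_scaleR) auto
  have "star G * (w - x) * G = star G" using G by (simp add: mult.assoc)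
  then have "star G * Im_el (w - x) * G = - Im_el G"
    using Im_el_conj[of G "w - x"] by (simp add: Im_el_star)
  moreover have "pos (E (star G * Im_el (w - x) * G) - \<delta> *\<^sub>R E (star G * G))"
    using above_diff_selfadj[OF w(2) x] by (intro E_conj_lower) (simp add: above_def)
  ultimately have p2: "pos (- E (Im_el G) - \<delta> *\<^sub>R E (star G * G))" by (simp add: E_minus)
  have "E (Im_el G) = Im_el (E G)" by (simp add: Im_el_def E_scaleC E_diff E_star)
  have "\<delta> *\<^sub>R (E (star G * G) - (1 / M) *\<^sub>R 1) + (- E (Im_el G) - \<delta> *\<^sub>R E (star G * G))
      = - E (Im_el G) - (\<delta> / M) *\<^sub>R 1"
    by (simp add: algebra_simps)
  then have "pos (- E (Im_el G) - (\<delta> / M) *\<^sub>R 1)" using pos_add[OF p1 p2] by metis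
  then have "above (\<delta> / M) (- E G)" using \<open>E (Im_el G) = Im_el (E G)\<close> by (simp add: above_def Im_el_minus)
  then have "invertible_in B (- E G)"
    using M \<delta> by (intro above_invertible(1)[OF closed_alg_B, of _ "\<delta> / M"]) (auto intro: B_intros E_in_B)
  then obtain r where r: "r \<in> B" "- E G * r = 1" "r * - E G = 1"
    unfolding invertible_in_def by blast
  then have "E G * - r = 1" "- r * E G = 1" "- r \<in> B"
    by (simp_all only: minus_mult_commute) (intro B_intros)
  then show ?thesis unfolding invertible_in_def G_def by blast
qed

text \<open>In the GNS picture \<open>c\<close> is the inverse of the compression of \<open>w - x\<close> to the kernel of \<open>E\<close>,
  applied to \<open>x\<close>; the explicit Schur complement formula makes Hilbert modules unnecessary.\<close>

lemma F_transform_expansion: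
  assumes Ex: "E x = 0"
  obtains c where "w - F_transform x w = E (x * c)"
    "E (star c * (w - x) * c) = E (star c * x)"
    "E (x * c) = E (x * inv_el w * x) + E (x * inv_el w * x * c)"
proof -
  define G where "G = inv_el (w - x)"
  note G = resolvent_inverse(1,2)[folded G_def]
  define g where "g = E G"
  note gi = invertible_inD[OF E_resolvent_invertible, folded G_def, folded g_def]
  define F where "F = F_transform x w"
  have Fdef: "F = inv_el g" by (simp add: F_def F_transform_def g_def G_def)
  note F = gi[folded Fdef]
  have wi: "invertible_in B w" by (rule above_invertible(1)[OF closed_alg_B w \<delta>])
  note wi = invertible_inD[OF wi]
  \<comment> \<open>The subtracted term makes \<open>E c = 0\<close>, since \<open>F\<close> inverts
    \<open>E G\<close>; and \<open>w - x\<close> maps \<open>c\<close> to \<open>x\<close> minus an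
    element of \<open>B\<close>.\<close>
  define c where "c = G * x - G * F * E (G * x)"
  have "G * w = 1 + G * x" using G(2) by (simp add: right_diff_distrib diff_eq_eq)
  then have "E (G * w) = 1 + E (G * x)" by (simp add: E_add E_one)
  then have EGx: "E (G * x) = g * w - 1" using w by (simp add: E_right g_def)
  then have FEGx: "F * E (G * x) = w - F" using F by (simp add: right_diff_distrib mult.assoc[symmetric])
  have Ec: "E c = 0"
    using F E_in_B[of "G * x"]
    by (simp add: c_def E_diff E_right[of "F * E (G * x)"] mult.assoc B_intros g_def[symmetric])
       (simp add: mult.assoc[symmetric])
  have wc: "(w - x) * c = x - F * E (G * x)"
  proof -
    have "(w - x) * c = (w - x) * G * x - (w - x) * G * F * E (G * x)"
      by (simp add: c_def right_diff_distrib mult.assoc del: left_diff_distrib)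
    then show ?thesis using G by simp
  qed
  have Exc: "E (x * c) = w - F"
  proof -
    have "E ((w - x) * c) = w * E c - E (x * c)" using w by (simp add: left_diff_distrib E_diff E_left)
    then have "- E (x * c) = E (x - F * E (G * x))" using Ec wc by simp
    also have "\<dots> = - (F * E (G * x))"
      using F(1) E_in_B by (simp add: E_diff Ex E_B B_intros)
    finally show ?thesis using FEGx by (metis neg_equal_iff_equal)
  qed
  show thesis
  proof
    show "w - F_transform x w = E (x * c)" using Exc by (simp add: F_def)
    \<comment> \<open>The correction term lies in \<open>B\<close>, so \<open>E c = 0\<close>
      removes it from the quadratic form.\<close>
    have "E (star c * (F * E (G * x))) = E (star c) * (F * E (G * x))"
      using F(1) E_in_B by (intro E_right B_intros)
    also have "E (star c) = 0" using Ec by (simp add: E_star)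
    finally have "E (star c * (F * E (G * x))) = 0" by simp
    then show "E (star c * (w - x) * c) = E (star c * x)"
      unfolding mult.assoc wc by (simp add: right_diff_distrib E_diff)
    \<comment> \<open>Solving the equation for \<open>c\<close> with the inverse of \<open>w\<close>
      and inserting the result into \<open>x * c\<close> produces the covariance term; the term from
      \<open>B\<close> disappears by \<open>E x = 0\<close>.\<close>
    have "w * c = x * c + x - F * E (G * x)" using wc by (simp add: left_diff_distrib algebra_simps)
    then have "inv_el w * (w * c) = inv_el w * (x * c + x - F * E (G * x))" by simp
    then have "c = inv_el w * (x * c) + inv_el w * x - inv_el w * F * E (G * x)"
      using wi by (simp add: mult.assoc[symmetric] distrib_left right_diff_distrib)
    then have "x * c = x * (inv_el w * (x * c) + inv_el w * x - inv_el w * F * E (G * x))" by simp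
    also have "\<dots> = x * inv_el w * x * c + x * inv_el w * x - x * (inv_el w * F * E (G * x))"
      by (simp add: distrib_left right_diff_distrib mult.assoc)
    finally have "E (x * c) = E (x * inv_el w * x * c) + E (x * inv_el w * x) - E (x * (inv_el w * F * E (G * x)))"
      by (simp add: E_add E_diff)
    moreover have "E (x * (inv_el w * F * E (G * x))) = E x * (inv_el w * F * E (G * x))"
      using F(1) wi(1) E_in_B by (intro E_right B_intros)
    ultimately show "E (x * c) = E (x * inv_el w * x) + E (x * inv_el w * x * c)"
      by (simp add: Ex)
  qed
qed

text \<open>The hypothesis makes \<open>E (star c * (w - x) * c)\<close> the adjoint of
  \<open>E (x * c)\<close>, and its imaginary part is bounded below through that of
  \<open>w\<close>. Both the estimate on \<open>c\<close> and the half-plane property rest on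
  this.\<close>

lemma E_conj_Im:
  assumes "E (star c * (w - x) * c) = E (star c * x)"
  shows "pos (- Im_el (E (x * c)) - \<delta> *\<^sub>R E (star c * c))"
proof -
  have EI: "E (Im_el a) = Im_el (E a)" for a by (simp add: Im_el_def E_scaleC E_diff E_star)
  have "E (star c * x) = star (E (x * c))" using E_star[of "x * c"] x by (simp add: star_mult)
  then have "- Im_el (E (x * c)) = E (Im_el (star c * (w - x) * c))"
    using assms by (simp add: EI Im_el_star)
  also have "\<dots> = E (star c * Im_el (w - x) * c)" by (simp only: Im_el_conj)
  finally show ?thesis
    using above_diff_selfadj[OF w(2) x] by (simp add: E_conj_lower above_def)
qed

text \<open>The estimate improves itself: \<open>\<delta> * e \<le> norm (E (x * c)) \<le> sqrt
  (norm (E (x * x))) * sqrt e\<close>, and one factor \<open>sqrt e\<close> cancels.\<close>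

lemma norm_E_conj_le:
  assumes "E (star c * (w - x) * c) = E (star c * x)"
  shows "sqrt (norm (E (star c * c))) \<le> sqrt (norm (E (x * x))) / \<delta>"
proof -
  define e where "e = norm (E (star c * c))"
  have "pos (\<delta> *\<^sub>R E (star c * c))" using \<delta> by (intro pos_scaleR E_pos pos_star_mult) simp
  from pos_norm_mono[OF this E_conj_Im[OF assms]] have "\<delta> * e \<le> norm (Im_el (E (x * c)))"
    using \<delta> pos_norm_mono norm_minus_cancel by (simp add: e_def)
  also have "\<dots> \<le> norm (E (x * c))" by (rule norm_Im_el)
  also have "\<dots> \<le> sqrt (norm (E (x * x))) * sqrt e"
    using cauchy_schwarz_sqrt[of x c] x by (simp add: e_def)
  finally have *: "sqrt e * (\<delta> * sqrt e) \<le> sqrt e * sqrt (norm (E (x * x)))"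
    by (simp add: mult_ac e_def)
  have "\<delta> * sqrt e \<le> sqrt (norm (E (x * x)))"
  proof (cases "e = 0")
    case False
    then have "sqrt e > 0" by (simp add: e_def)
    with * show ?thesis by (simp add: mult_le_cancel_left)
  qed simp
  then show ?thesis using \<delta> by (simp add: e_def field_simps)
qed

lemma F_transform_in_B: "F_transform x w \<in> B"
  and F_transform_inverse: "F_transform x w * E (inv_el (w - x)) = 1"
    "E (inv_el (w - x)) * F_transform x w = 1"
  using invertible_inD[OF E_resolvent_invertible] by (simp_all add: F_transform_def)

text \<open>Passing from \<open>w\<close> to the F-transform subtracts \<open>E (x * c)\<close>,
  whose imaginary part is at most 0. The level is kept without loss, so compositions stay in one
  half-plane.\<close>

lemma F_transform_above:
  assumes "E x = 0" shows "above \<delta> (F_transform x w)"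
proof -
  from F_transform_expansion[OF assms] obtain c where
    c: "w - F_transform x w = E (x * c)" "E (star c * (w - x) * c) = E (star c * x)" by metis
  have "pos (\<delta> *\<^sub>R E (star c * c))" using \<delta> by (intro pos_scaleR E_pos pos_star_mult) simp
  from pos_add[OF pos_add[OF E_conj_Im[OF c(2)] this] w(2)[unfolded above_def]]
  have "pos (Im_el (w - E (x * c)) - \<delta> *\<^sub>R 1)" by (simp add: Im_el_diff algebra_simps)
  moreover have "w - E (x * c) = F_transform x w" using c(1) by (metis diff_diff_eq2 add_diff_cancel_left')
  ultimately show ?thesis by (simp add: above_def)
qed

lemma norm_F_transform_diff:
  assumes "E x = 0" shows "norm (F_transform x w - w) \<le> norm (E (x * x)) / \<delta>"
proof -
  from F_transform_expansion[OF assms] obtain c where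
    c: "w - F_transform x w = E (x * c)" "E (star c * (w - x) * c) = E (star c * x)" by metis
  have "norm (w - F_transform x w) \<le> sqrt (norm (E (x * x))) * sqrt (norm (E (star c * c)))"
    using cauchy_schwarz_sqrt[of x c] x c by simp
  also have "\<dots> \<le> sqrt (norm (E (x * x))) * (sqrt (norm (E (x * x))) / \<delta>)"
    by (intro mult_left_mono norm_E_conj_le[OF c(2)]) simp
  finally show ?thesis by (simp add: norm_minus_commute)
qed

text \<open>The remainder is the pairing of \<open>c\<close> with
  \<open>star a = x * inv_el w * x\<close>. The moment of \<open>a\<close> is the quantity bounded
  by \<open>a4\<close> at a rescaled \<open>b\<close>, and \<open>inv_el w\<close> and
  \<open>c\<close> each contribute one factor \<open>1 / \<delta>\<close>.\<close>

lemma norm_F_transform_second_order: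
  assumes "E x = 0"
    and a4: "\<And>b. b \<in> B \<Longrightarrow> norm b = 1 \<Longrightarrow> norm (E (x * star b * (x * x) * b * x)) \<le> a4"
  shows "norm (w - F_transform x w - E (x * inv_el w * x)) \<le> sqrt (norm (E (x * x))) * sqrt a4 / \<delta>\<^sup>2"
proof -
  from F_transform_expansion[OF assms(1)] obtain c where
    c: "w - F_transform x w = E (x * c)" "E (star c * (w - x) * c) = E (star c * x)"
     "E (x * c) = E (x * inv_el w * x) + E (x * inv_el w * x * c)" by metis
  have wi: "invertible_in B w" "norm (inv_el w) \<le> 1 / \<delta>" 
    by (rule above_invertible[OF closed_alg_B w \<delta>])+
  note wB = invertible_inD[OF wi(1)]
  define b where "b = star (inv_el w)"
  define a where "a = x * b * x"
  have b: "b \<in> B" "norm b \<le> 1 / \<delta>" "b \<noteq> 0"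
    using wi wB by (auto simp: b_def B_star) (metis norm_star norm_zero mult_zero_right norm_eq_zero zero_neq_one)
  \<comment> \<open>\<open>a4\<close> controls unit elements only, so \<open>norm b\<close> is split
    off; \<open>b\<close> is nonzero as the adjoint of an inverse.\<close>
  define b1 where "b1 = (1 / norm b) *\<^sub>R b"
  have b1: "b1 \<in> B" "norm b1 = 1" "b = norm b *\<^sub>R b1" using b by (auto simp: b1_def intro: B_intros)
  have "star a * a = x * star b * (x * x) * b * x" by (simp add: a_def star_mult x mult.assoc)
  also have "\<dots> = (norm b)\<^sup>2 *\<^sub>R (x * star b1 * (x * x) * b1 * x)"
    by (subst (1 2) b1(3)) (simp add: power2_eq_square)
  finally have "norm (E (star a * a)) = (norm b)\<^sup>2 * norm (E (x * star b1 * (x * x) * b1 * x))"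
    by (simp add: E_scaleR)
  then have Ea: "norm (E (star a * a)) \<le> (norm b)\<^sup>2 * a4"
    using a4[OF b1(1,2)] by (simp add: mult_left_mono)
  have "a4 \<ge> 0" using a4[OF b1(1,2)] norm_ge_zero order.trans by blast
  have "sqrt (norm (E (star a * a))) \<le> norm b * sqrt a4"
    using real_sqrt_le_mono[OF Ea] by (simp add: real_sqrt_mult)
  also have "\<dots> \<le> (1 / \<delta>) * sqrt a4" using b \<open>a4 \<ge> 0\<close> by (intro mult_right_mono) auto
  finally have sa: "sqrt (norm (E (star a * a))) \<le> sqrt a4 / \<delta>" by simp
  have "star a = x * inv_el w * x" by (simp add: a_def b_def star_mult star_star x mult.assoc)
  then have "norm (w - F_transform x w - E (x * inv_el w * x)) = norm (E (star a * c))"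
    using c by simp
  also have "\<dots> \<le> (sqrt a4 / \<delta>) * (sqrt (norm (E (x * x))) / \<delta>)"
    using cauchy_schwarz_sqrt[of a c] sa norm_E_conj_le[OF c(2)] \<delta> \<open>a4 \<ge> 0\<close>
    by (elim order.trans) (intro mult_mono, auto)
  finally show ?thesis by (simp add: power2_eq_square mult.commute)
qed

end

end

section \<open>Monotone independence\<close>

lemma subspace_closure_normed:
  fixes S :: "'a::real_normed_vector set"
  assumes "subspace S" shows "subspace (closure S)"
proof (rule subspaceI)
  show "0 \<in> closure S" using closure_subset subspace_0[OF assms] by blast
next
  fix u v assume "u \<in> closure S" "v \<in> closure S"
  then obtain f g where "\<And>n. f n \<in> S" "f \<longlonglongrightarrow> u" "\<And>n. g n \<in> S" "g \<longlonglongrightarrow> v"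
    unfolding closure_sequential by blast
  then show "u + v \<in> closure S"
    unfolding closure_sequential
    by (intro exI[of _ "\<lambda>n. f n + g n"]) (auto intro: tendsto_add subspace_add[OF assms])
next
  fix c :: real and u assume "u \<in> closure S"
  then obtain f where "\<And>n. f n \<in> S" "f \<longlonglongrightarrow> u" unfolding closure_sequential by blast
  then show "c *\<^sub>R u \<in> closure S"
    unfolding closure_sequential
    by (intro exI[of _ "\<lambda>n. c *\<^sub>R f n"]) (auto intro: tendsto_intros subspace_scale[OF assms])
qed

lemma closure_span_image:
  fixes f :: "'a::real_normed_vector \<Rightarrow> 'b::real_normed_vector"
  assumes f: "bounded_linear f" and S: "\<And>s. s \<in> S \<Longrightarrow> f s \<in> closure (span T)"
    and c: "c \<in> closure (span S)"
  shows "f c \<in> closure (span T)"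
proof -
  have sub: "subspace (closure (span T))" by (intro subspace_closure_normed subspace_span)
  have "subspace (f -` closure (span T))"
    using bounded_linear.linear[OF f] sub by (rule linear_subspace_vimage)
  then have "span S \<subseteq> f -` closure (span T)" using S by (intro span_minimal) auto
  moreover have "closed (f -` closure (span T))"
    by (intro continuous_closed_vimage closed_closure linear_continuous_at f)
  ultimately have "closure (span S) \<subseteq> f -` closure (span T)" by (rule closure_minimal)
  then show ?thesis using c by auto
qed

lemma closure_span_vanish:
  fixes f :: "'a::real_normed_vector \<Rightarrow> 'b::real_normed_vector"
  assumes "bounded_linear f" "\<And>s. s \<in> S \<Longrightarrow> f s = 0" "c \<in> closure (span S)"
  shows "f c = 0"
proof -
  have "f c \<in> closure (span {})"
    by (rule closure_span_image[OF assms(1) _ assms(3)]) (simp add: assms(2))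
  then show ?thesis by simp
qed

lemma closure_span_base: "s \<in> S \<Longrightarrow> s \<in> closure (span (S :: 'a::real_normed_vector set))"
  using closure_subset[of "span S"] span_base[of s S] by blast

context cond_exp_space begin

text \<open>Letters carry their index, since one element may lie in several of the generated
  algebras while monotone independence compares indices.\<close>

definition is_word :: "(nat \<Rightarrow> 'a) \<Rightarrow> nat set \<Rightarrow> (nat \<times> 'a) list \<Rightarrow> bool" where
  "is_word x I ws \<longleftrightarrow> (\<forall>(i, a)\<in>set ws. i \<in> I \<and> a \<in> bimod_gen B (x i))"

abbreviation eval_word :: "(nat \<times> 'a) list \<Rightarrow> 'a" where
  "eval_word ws \<equiv> prod_list (map snd ws)"

definition words :: "(nat \<Rightarrow> 'a) \<Rightarrow> nat set \<Rightarrow> 'a set" where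
  "words x I = {eval_word ws |ws. ws \<noteq> [] \<and> is_word x I ws}"

text \<open>\<open>B\<close> is adjoined separately because the bimodule algebras need not contain
  the unit. The real span is enough: complex scalars lie in \<open>B\<close> and are absorbed by
  \<open>B\<close> or by a letter.\<close>

definition gen_alg :: "(nat \<Rightarrow> 'a) \<Rightarrow> nat set \<Rightarrow> 'a set" where
  "gen_alg x I = closure (span (B \<union> words x I))"

lemma words_left: "b \<in> B \<Longrightarrow> c \<in> words x I \<Longrightarrow> b * c \<in> words x I"
proof -
  assume b: "b \<in> B" and "c \<in> words x I"
  then obtain ws where ws: "ws \<noteq> []" "is_word x I ws" "c = eval_word ws" by (auto simp: words_def)
  then obtain i a vs where "ws = (i, a) # vs" by (cases ws) auto
  with ws b have "is_word x I ((i, b * a) # vs)" "b * c = eval_word ((i, b * a) # vs)"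
    by (auto simp: is_word_def mult.assoc intro: bimod_gen.lmult)
  then show ?thesis unfolding words_def by blast
qed

lemma words_right: "b \<in> B \<Longrightarrow> c \<in> words x I \<Longrightarrow> c * b \<in> words x I"
proof -
  assume b: "b \<in> B" and "c \<in> words x I"
  then obtain ws where ws: "ws \<noteq> []" "is_word x I ws" "c = eval_word ws" by (auto simp: words_def)
  then obtain i a vs where "ws = vs @ [(i, a)]" by (cases ws rule: rev_cases) auto
  with ws b have "is_word x I (vs @ [(i, a * b)])" "c * b = eval_word (vs @ [(i, a * b)])"
    by (auto simp: is_word_def mult.assoc intro: bimod_gen.rmult)
  then show ?thesis unfolding words_def by blast
qed

lemma words_mult: "c \<in> words x I \<Longrightarrow> d \<in> words x I \<Longrightarrow> c * d \<in> words x I"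
proof -
  assume "c \<in> words x I" "d \<in> words x I"
  then obtain us vs where "us \<noteq> []" "is_word x I us" "c = eval_word us" "is_word x I vs" "d = eval_word vs"
    by (auto simp: words_def)
  then have "us @ vs \<noteq> []" "is_word x I (us @ vs)" "c * d = eval_word (us @ vs)"
    by (auto simp: is_word_def)
  then show ?thesis unfolding words_def by blast
qed

lemma words_gen: "i \<in> I \<Longrightarrow> x i \<in> words x I"
  unfolding words_def by (auto simp: is_word_def intro!: exI[of _ "[(i, x i)]"] bimod_gen.gen)

lemma closed_alg_gen_alg: "closed_alg (gen_alg x I)"
proof -
  let ?Z = "B \<union> words x I"
  have Z: "s * t \<in> ?Z" if "s \<in> ?Z" "t \<in> ?Z" for s t
    using that by (auto intro: words_left words_right words_mult B_intros)
  have Zc: "scaleC c s \<in> ?Z" if "s \<in> ?Z" for c s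
    using Z[of "scaleC c 1" s] that B_intros by (auto simp: mult_scaleC_left)
  have 1: "u * t \<in> closure (span ?Z)" if "u \<in> closure (span ?Z)" "t \<in> ?Z" for u t
    by (rule closure_span_image[OF bounded_linear_mult_left _ that(1)])
       (use Z that(2) in \<open>blast intro: closure_span_base\<close>)
  have 2: "u * v \<in> closure (span ?Z)" if "u \<in> closure (span ?Z)" "v \<in> closure (span ?Z)" for u v
    by (rule closure_span_image[OF bounded_linear_mult_right _ that(2)]) (use 1 that(1) in blast)
  have 3: "scaleC c u \<in> closure (span ?Z)" if "u \<in> closure (span ?Z)" for c u
    by (rule closure_span_image[OF bounded_linear_scaleC _ that])
       (use Zc in \<open>blast intro: closure_span_base\<close>)
  have "subspace (closure (span ?Z))" by (intro subspace_closure_normed subspace_span)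
  then show ?thesis
    unfolding closed_alg_def gen_alg_def
    using 2 3 B_intros(1) closure_span_base[of 1 ?Z] by (auto simp: subspace_def)
qed

lemma gen_alg_B: "b \<in> B \<Longrightarrow> b \<in> gen_alg x I"
  and gen_alg_gen: "i \<in> I \<Longrightarrow> x i \<in> gen_alg x I"
  unfolding gen_alg_def
  by (rule closure_span_base, erule UnI1) (rule closure_span_base, erule UnI2[OF words_gen])

lemma words_single: "c \<in> words x {n} \<Longrightarrow> c \<in> bimod_gen B (x n)"
proof -
  assume "c \<in> words x {n}"
  then obtain ws where ws: "ws \<noteq> []" "is_word x {n} ws" "c = eval_word ws" by (auto simp: words_def)
  from ws(1,2) have "eval_word ws \<in> bimod_gen B (x n)"
    by (induction ws rule: list_nonempty_induct) (auto simp: is_word_def intro: bimod_gen.mult)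
  with ws show ?thesis by simp
qed

text \<open>The empty word included, these are the words that may precede a letter of index
  \<open>n\<close> that is to be a peak.\<close>

definition left_words :: "(nat \<Rightarrow> 'a) \<Rightarrow> nat \<Rightarrow> 'a set" where
  "left_words x n = {eval_word ws |ws. is_word x {1..n} ws \<and> (ws = [] \<or> fst (last ws) < n)}"

definition right_words :: "(nat \<Rightarrow> 'a) \<Rightarrow> nat \<Rightarrow> 'a set" where
  "right_words x n = {eval_word ws |ws. is_word x {1..n} ws \<and> (ws = [] \<or> fst (hd ws) < n)}"

text \<open>Multiplication by a lower variable ends every word in a lower letter. For an element of
  \<open>B\<close> the product is itself one letter, by the bimodule property.\<close>

lemma gen_alg_mult_lower:
  assumes "c \<in> gen_alg x {1..n}" "i \<in> {1..<n}"
  shows "c * x i \<in> closure (span (left_words x n))"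
  unfolding gen_alg_def
proof (rule closure_span_image[OF bounded_linear_mult_left _ assms(1)[unfolded gen_alg_def]],
    rule closure_span_base)
  fix s assume s: "s \<in> B \<union> words x {1..n}"
  show "s * x i \<in> left_words x n"
  proof (cases "s \<in> B")
    case True
    then have "is_word x {1..n} [(i, s * x i)]" using assms(2)
      by (auto simp: is_word_def intro: bimod_gen.intros)
    then show ?thesis unfolding left_words_def using assms(2) by (intro CollectI exI[of _ "[(i, s * x i)]"]) auto
  next
    case False
    with s obtain ws where "is_word x {1..n} ws" "s = eval_word ws" by (auto simp: words_def)
    then have "is_word x {1..n} (ws @ [(i, x i)])" "s * x i = eval_word (ws @ [(i, x i)])"
      using assms(2) by (auto simp: is_word_def intro: bimod_gen.intros)
    then show ?thesis unfolding left_words_def using assms(2) by (intro CollectI exI[of _ "ws @ [(i, x i)]"]) auto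
  qed
qed

lemma gen_alg_lower_mult:
  assumes "c \<in> gen_alg x {1..n}" "i \<in> {1..<n}"
  shows "x i * c \<in> closure (span (right_words x n))"
proof (rule closure_span_image[OF bounded_linear_mult_right _ assms(1)[unfolded gen_alg_def]],
    rule closure_span_base)
  fix s assume s: "s \<in> B \<union> words x {1..n}"
  show "x i * s \<in> right_words x n"
  proof (cases "s \<in> B")
    case True
    then have "is_word x {1..n} [(i, x i * s)]" using assms(2)
      by (auto simp: is_word_def intro: bimod_gen.intros)
    then show ?thesis unfolding right_words_def using assms(2) by (intro CollectI exI[of _ "[(i, x i * s)]"]) auto
  next
    case False
    with s obtain ws where "is_word x {1..n} ws" "s = eval_word ws" by (auto simp: words_def)
    then have "is_word x {1..n} ((i, x i) # ws)" "x i * s = eval_word ((i, x i) # ws)"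
      using assms(2) by (auto simp: is_word_def intro: bimod_gen.intros)
    then show ?thesis unfolding right_words_def using assms(2) by (intro CollectI exI[of _ "(i, x i) # ws"]) auto
  qed
qed

lemma monotone_word:
  assumes mon: "monotone_indep E {1..N} (\<lambda>i. bimod_gen B (x i))" and n: "n \<in> {1..N}"
    and us: "is_word x {1..n} us" "us = [] \<or> fst (last us) < n"
    and vs: "is_word x {1..n} vs" "vs = [] \<or> fst (hd vs) < n"
    and g: "g \<in> bimod_gen B (x n)"
  shows "E (eval_word us * g * eval_word vs) = E (eval_word us * E g * eval_word vs)"
proof -
  define ws where "ws = us @ (n, g) # vs"
  define w where "w k = snd (ws ! k)" for k
  define ix where "ix k = fst (ws ! k)" for k
  define j where "j = length us"
  have "\<forall>(i, a)\<in>set ws. i \<in> {1..N} \<and> a \<in> bimod_gen B (x i)"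
    using us vs g n by (fastforce simp: ws_def is_word_def)
  then have A: "\<forall>k<length ws. ix k \<in> {1..N} \<and> w k \<in> bimod_gen B (x (ix k))"
    by (metis (no_types, lifting) case_prodD ix_def w_def nth_mem prod.collapse)
  have B: "j < length ws" "ix j = n" "w j = g" by (simp_all add: j_def ws_def ix_def w_def)
  \<comment> \<open>The peak stands at position \<open>length us\<close>; \<open>0 < j\<close>
    therefore means that \<open>us\<close> is nonempty and ends with the left neighbour of the
    peak.\<close>
  have C: "0 < j \<longrightarrow> ix (j - 1) < ix j"
    using us(2) B(2) by (auto simp: ix_def ws_def j_def nth_append last_conv_nth)
  have D: "j + 1 < length ws \<longrightarrow> ix (j + 1) < ix j"
    using vs(2) B(2) by (auto simp: ix_def ws_def j_def nth_append hd_conv_nth)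
  have "E (prod_list (map w [0..<length ws])) = E (prod_list (map (w(j := E (w j))) [0..<length ws]))"
    using mon A B(1) C D unfolding monotone_indep_def by blast
  moreover have "map w [0..<length ws] = map snd ws"
    by (rule nth_equalityI) (simp_all add: w_def)
  moreover have "map (w(j := E (w j))) [0..<length ws] = map snd (us @ (n, E g) # vs)"
  proof (rule nth_equalityI)
    fix k assume "k < length (map (w(j := E (w j))) [0..<length ws])"
    then have k: "k < length ws" by simp
    consider "k < j" | "k = j" | m where "k = Suc (j + m)"
      by (metis less_iff_Suc_add linorder_neqE_nat)
    then show "map (w(j := E (w j))) [0..<length ws] ! k = map snd (us @ (n, E g) # vs) ! k"
      using k by cases (auto simp: nth_append w_def ws_def j_def simp del: upt_Suc)
  qed (simp add: ws_def)
  ultimately have "E (eval_word ws) = E (eval_word (us @ (n, E g) # vs))" by (simp only:)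
  then show ?thesis by (simp add: ws_def mult.assoc)
qed

text \<open>The expression is linear and continuous in each of \<open>c\<close>, \<open>G\<close>,
  \<open>d\<close>, so words suffice. There \<open>G\<close> is a single letter of index
  \<open>n\<close>, a peak between lower neighbours, or it lies in \<open>B\<close> and
  \<open>G - E G\<close> vanishes.\<close>

lemma monotone_resolvent_insert:
  assumes mon: "monotone_indep E {1..N} (\<lambda>i. bimod_gen B (x i))" and n: "n \<in> {1..N}"
    and c: "c \<in> closure (span (left_words x n))" and d: "d \<in> closure (span (right_words x n))"
    and G: "G \<in> gen_alg x {n}"
  shows "E (c * (G - E G) * d) = 0"
proof -
  have 1: "E (c * (G - E G) * d) = 0" if c: "c \<in> left_words x n" and d: "d \<in> right_words x n" for c d
  proof (rule closure_span_vanish[OF _ _ G[unfolded gen_alg_def]])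
    show "bounded_linear (\<lambda>G. E (c * (G - E G) * d))"
      by (rule bounded_linear_compose[OF bounded_linear_E bounded_linear_compose[OF
            bounded_linear_mult_left bounded_linear_compose[OF bounded_linear_mult_right
              bounded_linear_sub[OF bounded_linear_ident bounded_linear_E]]]])
    fix s assume s: "s \<in> B \<union> words x {n}"
    show "E (c * (s - E s) * d) = 0"
    proof (cases "s \<in> B")
      case False
      with s have "s \<in> bimod_gen B (x n)" using words_single by blast
      with c d have "E (c * s * d) = E (c * E s * d)"
        using monotone_word[OF mon n] by (auto simp: left_words_def right_words_def)
      then show ?thesis by (simp add: right_diff_distrib left_diff_distrib E_diff)
    qed (simp add: E_B E_zero)
  qed
  have 2: "E (c * (G - E G) * d) = 0" if d: "d \<in> right_words x n" for d
    by (rule closure_span_vanish[OF bounded_linear_compose[OF bounded_linear_E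
          bounded_linear_compose[OF bounded_linear_mult_left bounded_linear_mult_left]] _ c])
       (rule 1[OF _ d])
  show ?thesis
    by (rule closure_span_vanish[OF bounded_linear_compose[OF bounded_linear_E
          bounded_linear_mult_right] _ d]) (rule 2)
qed

text \<open>With \<open>L\<close> the sum of the lower variables, \<open>h\<close> the top one, \<open>R = (b - L - h)\<^sup>-\<^sup>1\<close>,
  \<open>G = (b - h)\<^sup>-\<^sup>1\<close> and \<open>R' = (F - L)\<^sup>-\<^sup>1\<close> one has \<open>R - R' = (1 + RL)(G - E[G])(1 + LR')\<close>, and
  monotone independence annihilates the right-hand side.\<close>

lemma monotone_convolution:
  assumes mon: "monotone_indep E {1..N} (\<lambda>i. bimod_gen B (x i))" and n: "Suc n \<le> N"
    and x: "\<And>j. j \<in> {1..N} \<Longrightarrow> star (x j) = x j" "\<And>j. j \<in> {1..N} \<Longrightarrow> E (x j) = 0"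
    and b: "b \<in> B" "above \<delta> b" and \<delta>: "\<delta> > 0"
  shows "E (inv_el (b - (\<Sum>i=1..Suc n. x i)))
       = E (inv_el (F_transform (x (Suc n)) b - (\<Sum>i=1..n. x i)))"
proof -
  define L where "L = (\<Sum>i=1..n. x i)"
  define h where "h = x (Suc n)"
  define F where "F = F_transform h b"
  define R where "R = inv_el (b - (L + h))"
  define G where "G = inv_el (b - h)"
  define R' where "R' = inv_el (F - L)"
  have sh: "star h = h" and Eh: "E h = 0" using x n by (auto simp: h_def)
  have sL: "star L = L" unfolding L_def star_sum by (rule sum.cong) (use x n in auto)
  note F = F_transform_in_B[OF sh b \<delta>, folded F_def] F_transform_inverse[OF sh b \<delta>, folded F_def G_def]
  have Fab: "above \<delta> F" unfolding F_def by (rule F_transform_above[OF sh b \<delta> Eh])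
  have LI: "L \<in> gen_alg x I" if "{1..n} \<subseteq> I" for I
    unfolding L_def
  proof -
    note S = closed_algD[OF closed_alg_gen_alg[of x I]]
    have "sum x J \<in> gen_alg x I" if "finite J" "J \<subseteq> I" for J
      using that
    proof (induction J)
      case empty
      show ?case using S(9) by simp
    next
      case (insert i J)
      then show ?case using S(3)[OF gen_alg_gen] by simp
    qed
    then show "sum x {1..n} \<in> gen_alg x I" using that by simp
  qed
  \<comment> \<open>The inverses are located in closed algebras: \<open>R\<close> and
    \<open>R'\<close> are then limits of combinations of words over \<open>B\<close> up to the top
    index, and \<open>G\<close> of words in the top variable alone.\<close>
  have iR: "invertible_in (gen_alg x {1..Suc n}) (b - (L + h))"
  proof (rule above_invertible(1)[OF closed_alg_gen_alg _ above_diff_selfadj[OF b(2)] \<delta>])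
    show "b - (L + h) \<in> gen_alg x {1..Suc n}"
      unfolding h_def
      by (rule closed_algD(8)[OF closed_alg_gen_alg gen_alg_B[OF b(1)]
            closed_algD(3)[OF closed_alg_gen_alg LI gen_alg_gen]]) auto
    show "star (L + h) = L + h" by (simp add: star_add sL sh)
  qed
  have iG: "invertible_in (gen_alg x {Suc n}) (b - h)"
  proof (rule above_invertible(1)[OF closed_alg_gen_alg _ above_diff_selfadj[OF b(2) sh] \<delta>])
    show "b - h \<in> gen_alg x {Suc n}"
      unfolding h_def by (rule closed_algD(8)[OF closed_alg_gen_alg gen_alg_B[OF b(1)] gen_alg_gen]) simp
  qed
  have iR': "invertible_in (gen_alg x {1..Suc n}) (F - L)"
  proof (rule above_invertible(1)[OF closed_alg_gen_alg _ above_diff_selfadj[OF Fab sL] \<delta>])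
    show "F - L \<in> gen_alg x {1..Suc n}"
      by (rule closed_algD(8)[OF closed_alg_gen_alg gen_alg_B[OF F(1)] LI]) simp
  qed
  note R = invertible_inD[OF iR, folded R_def] and G = invertible_inD[OF iG, folded G_def]
    and R' = invertible_inD[OF iR', folded R'_def]
  have sub: "subspace (closure (span S))" for S :: "'a set" by (intro subspace_closure_normed subspace_span)
  have one: "1 \<in> left_words x (Suc n)" "1 \<in> right_words x (Suc n)"
    by (auto simp: left_words_def right_words_def is_word_def intro!: exI[of _ "[]"])
  have "R * L = (\<Sum>i=1..n. R * x i)" by (simp add: L_def sum_distrib_left)
  also have "\<dots> \<in> closure (span (left_words x (Suc n)))"
    by (intro subspace_sum[OF sub] gen_alg_mult_lower R) auto
  finally have l: "1 + R * L \<in> closure (span (left_words x (Suc n)))"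
    by (rule subspace_add[OF sub closure_span_base[OF one(1)]])
  have "L * R' = (\<Sum>i=1..n. x i * R')" by (simp add: L_def sum_distrib_right)
  also have "\<dots> \<in> closure (span (right_words x (Suc n)))"
    by (intro subspace_sum[OF sub] gen_alg_lower_mult R') auto
  finally have r: "1 + L * R' \<in> closure (span (right_words x (Suc n)))"
    by (rule subspace_add[OF sub closure_span_base[OF one(2)]])
  \<comment> \<open>This is \<open>R * (b - (L + h)) = 1\<close> rearranged, and \<open>G\<close> on
    the right recovers \<open>R\<close>. Likewise \<open>(F - L) * R' = 1\<close> gives the right
    factor, where \<open>E G\<close> cancels \<open>F\<close>.\<close>
  have "1 + R * L = R * (b - h)" using R(3) by (simp add: right_diff_distrib distrib_left algebra_simps)
  then have e1: "(1 + R * L) * G = R" using G by (simp add: mult.assoc)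
  have "1 + L * R' = F * R'" using R'(2) by (simp add: left_diff_distrib algebra_simps)
  then have "E G * (1 + L * R') = E G * F * R'" by (simp only: mult.assoc)
  then have e2: "E G * (1 + L * R') = R'" by (simp only: F(3) mult_1)
  have "(1 + R * L) * (G - E G) * (1 + L * R')
      = (1 + R * L) * G * (1 + L * R') - (1 + R * L) * (E G * (1 + L * R'))"
    by (simp add: right_diff_distrib left_diff_distrib mult.assoc)
  also have "\<dots> = R - R'" unfolding e1 e2 by (simp add: algebra_simps)
  finally have "E (R - R') = 0"
    using monotone_resolvent_insert[OF mon _ l r G(1)] n by simp
  then have "E R = E R'" by (simp add: E_diff)
  moreover have "L + h = (\<Sum>i=1..Suc n. x i)" by (simp add: L_def h_def)
  ultimately show ?thesis unfolding R_def R'_def F_def by (simp only: L_def h_def)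
qed

end

section \<open>The Lindeberg argument\<close>

lemma norm_mult3_ineq: "norm (a * b * c) \<le> norm a * norm b * norm (c :: 'a::real_normed_algebra)"
  by (rule order.trans[OF norm_mult_ineq mult_right_mono[OF norm_mult_ineq norm_ge_zero]])

context cond_exp_space begin

lemma alpha2_upper:
  "j \<in> {1..N} \<Longrightarrow> norm (E (x j * x j)) \<le> alpha2 E N x"
  unfolding alpha2_def by (intro Max_ge) auto

text \<open>Contractivity of \<open>E\<close> makes the set under the supremum bounded; otherwise
  \<open>Sup\<close> would carry no information.\<close>

lemma alpha4_upper:
  assumes j: "j \<in> {1..N}" and b: "b \<in> B" "norm b = 1"
  shows "norm (E (x j * star b * (x j * x j) * b * x j)) \<le> alpha4 B E N x"
proof -
  let ?f = "\<lambda>i b. norm (E (x i * star b * (x i * x i) * b * x i))"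
  have "bdd_above (?f j ` {b \<in> B. norm b = 1})"
  proof (rule bdd_aboveI2)
    fix b assume "b \<in> {b \<in> B. norm b = 1}"
    then have "norm b = 1" by simp
    have "norm (x j * star b * (x j * x j) * b * x j)
        \<le> norm (x j * star b * (x j * x j)) * norm b * norm (x j)" by (rule norm_mult3_ineq)
    also have "\<dots> \<le> norm (x j) * norm (star b) * norm (x j * x j) * norm b * norm (x j)"
      by (intro mult_right_mono norm_mult3_ineq norm_ge_zero)
    finally show "?f j b \<le> norm (x j) * norm (x j * x j) * norm (x j)"
      using order.trans[OF E_contractive] \<open>norm b = 1\<close> by simp
  qed
  then have "?f j b \<le> (SUP b\<in>{b \<in> B. norm b = 1}. ?f j b)" using b by (intro cSUP_upper) auto
  also have "\<dots> \<le> alpha4 B E N x" unfolding alpha4_def using j by (intro Max_ge) auto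
  finally show ?thesis .
qed

lemma resolvent_identity:
  assumes "star L = L" "above \<delta> u" "above \<delta> v" "\<delta> > 0"
  shows "inv_el (u - L) - inv_el (v - L) = inv_el (u - L) * (v - u) * inv_el (v - L)"
proof -
  note u = invertible_inD[OF above_invertible(1)[OF closed_alg_UNIV UNIV_I above_diff_selfadj[OF assms(2,1)] assms(4)]]
  note v = invertible_inD[OF above_invertible(1)[OF closed_alg_UNIV UNIV_I above_diff_selfadj[OF assms(3,1)] assms(4)]]
  have "v - u = (v - L) - (u - L)" by simp
  then have "inv_el (u - L) * (v - u) * inv_el (v - L)
      = inv_el (u - L) * ((v - L) * inv_el (v - L)) - inv_el (u - L) * (u - L) * inv_el (v - L)"
    by (simp only: right_diff_distrib left_diff_distrib mult.assoc)
  then show ?thesis using u v by simp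
qed

lemma norm_E_resolvent_diff:
  assumes "star L = L" "above \<delta> u" "above \<delta> v" "\<delta> > 0"
  shows "norm (E (inv_el (u - L)) - E (inv_el (v - L))) \<le> norm (u - v) / \<delta>\<^sup>2"
proof -
  have n: "norm (inv_el (u - L)) \<le> 1 / \<delta>" "norm (inv_el (v - L)) \<le> 1 / \<delta>"
    using assms by (auto intro!: above_invertible(2)[OF closed_alg_UNIV UNIV_I] above_diff_selfadj)
  have "E (inv_el (u - L)) - E (inv_el (v - L)) = E (inv_el (u - L) * (v - u) * inv_el (v - L))"
    by (simp only: E_diff[symmetric] resolvent_identity[OF assms])
  then have "norm (E (inv_el (u - L)) - E (inv_el (v - L)))
      \<le> norm (inv_el (u - L) * (v - u) * inv_el (v - L))"
    using E_contractive by simp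
  also have "\<dots> \<le> norm (inv_el (u - L)) * norm (v - u) * norm (inv_el (v - L))"
    by (rule norm_mult3_ineq)
  also have "\<dots> \<le> (1 / \<delta>) * norm (v - u) * (1 / \<delta>)"
    using n assms(4) by (intro mult_mono) auto
  finally show ?thesis by (simp add: norm_minus_commute power2_eq_square)
qed

end

section \<open>Replacing one variable at a time\<close>

locale monotone_pair = cond_exp_space B E for B :: "'a::cstar_algebra set" and E +
  fixes N :: nat and x y :: "nat \<Rightarrow> 'a"
  assumes sa: "\<And>j. j \<in> {1..N} \<Longrightarrow> star (x j) = x j \<and> star (y j) = y j"
    and centered: "\<And>j. j \<in> {1..N} \<Longrightarrow> E (x j) = 0 \<and> E (y j) = 0"
    and var: "\<And>j b. j \<in> {1..N} \<Longrightarrow> b \<in> B \<Longrightarrow> E (x j * b * x j) = E (y j * b * y j)"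
    and mon_x: "monotone_indep E {1..N} (\<lambda>i. bimod_gen B (x i))"
    and mon_y: "monotone_indep E {1..N} (\<lambda>i. bimod_gen B (y i))"
begin

text \<open>The cost of replacing one variable, up to powers of the level.\<close>

definition K :: real where
  "K = sqrt (alpha2 E N x) * (sqrt (alpha4 B E N x) + sqrt (alpha4 B E N y))"

lemma star_sum_x: "n \<le> N \<Longrightarrow> star (\<Sum>i=1..n. x i) = (\<Sum>i=1..n. x i)"
  and star_sum_y: "n \<le> N \<Longrightarrow> star (\<Sum>i=1..n. y i) = (\<Sum>i=1..n. y i)"
  unfolding star_sum using sa by (auto intro!: sum.cong)

text \<open>Both F-transforms are within a second-order remainder of the same element
  \<open>w - E (x j * inv_el w * x j)\<close>, because the covariances agree on
  \<open>inv_el w\<close>, which lies in \<open>B\<close>.\<close>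

lemma F_transform_close:
  assumes j: "j \<in> {1..N}" and w: "w \<in> B" "above \<delta> w" and \<delta>: "\<delta> > 0"
  shows "norm (F_transform (x j) w - F_transform (y j) w) \<le> K / \<delta>\<^sup>2"
proof -
  note s = sa[OF j] centered[OF j]
  have wi: "inv_el w \<in> B" by (rule invertible_inD(1)[OF above_invertible(1)[OF closed_alg_B w \<delta>]])
  \<comment> \<open>Equality of covariances at 1 lets \<open>alpha2\<close> of \<open>x\<close>
    serve for both remainders.\<close>
  have e: "norm (E (y j * y j)) = norm (E (x j * x j))" using var[OF j B_intros(1)] by simp
  have a2: "sqrt (norm (E (x j * x j))) \<le> sqrt (alpha2 E N x)" using alpha2_upper[OF j] by simp
  have a4: "0 \<le> alpha4 B E N x" "0 \<le> alpha4 B E N y"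
    by (rule order.trans[OF norm_ge_zero alpha4_upper[OF j B_intros(1) norm_one]])+
  have "norm (w - F_transform (x j) w - E (x j * inv_el w * x j))
      \<le> sqrt (norm (E (x j * x j))) * sqrt (alpha4 B E N x) / \<delta>\<^sup>2"
    using s by (intro norm_F_transform_second_order[OF _ w \<delta>] alpha4_upper j) auto
  also have "\<dots> \<le> sqrt (alpha2 E N x) * sqrt (alpha4 B E N x) / \<delta>\<^sup>2"
    using a2 a4 by (intro divide_right_mono mult_right_mono) auto
  finally have 1: "norm (w - F_transform (x j) w - E (x j * inv_el w * x j))
      \<le> sqrt (alpha2 E N x) * sqrt (alpha4 B E N x) / \<delta>\<^sup>2" .
  have "norm (w - F_transform (y j) w - E (y j * inv_el w * y j))
      \<le> sqrt (norm (E (y j * y j))) * sqrt (alpha4 B E N y) / \<delta>\<^sup>2"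
    using s by (intro norm_F_transform_second_order[OF _ w \<delta>] alpha4_upper j) auto
  also have "\<dots> \<le> sqrt (alpha2 E N x) * sqrt (alpha4 B E N y) / \<delta>\<^sup>2"
    using a2 a4 unfolding e by (intro divide_right_mono mult_right_mono) auto
  finally have 2: "norm (w - F_transform (y j) w - E (x j * inv_el w * x j))
      \<le> sqrt (alpha2 E N x) * sqrt (alpha4 B E N y) / \<delta>\<^sup>2"
    by (simp add: var[OF j wi])
  have "F_transform (x j) w - F_transform (y j) w
      = (w - F_transform (y j) w - E (x j * inv_el w * x j)) - (w - F_transform (x j) w - E (x j * inv_el w * x j))"
    by simp
  then have "norm (F_transform (x j) w - F_transform (y j) w)
      \<le> norm (w - F_transform (y j) w - E (x j * inv_el w * x j)) + norm (w - F_transform (x j) w - E (x j * inv_el w * x j))"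
    using norm_triangle_ineq4 by metis
  also have "\<dots> \<le> K / \<delta>\<^sup>2" using 1 2 by (simp add: K_def distrib_left add_divide_distrib)
  finally show ?thesis .
qed

text \<open>Peeling off the top variables evaluates the shorter sums at different points
  \<open>u\<close> and \<open>v\<close>. The value for \<open>x\<close> at \<open>v\<close> is the
  intermediate term: the resolvent identity compares it with that for \<open>x\<close> at
  \<open>u\<close>, and the induction hypothesis, stated for every \<open>b\<close>, with that for
  \<open>y\<close> at \<open>v\<close>.\<close>

lemma E_resolvent_close:
  assumes "n \<le> N" "b \<in> B" "above \<delta> b" and \<delta>: "\<delta> > 0"
  shows "norm (E (inv_el (b - (\<Sum>i=1..n. x i))) - E (inv_el (b - (\<Sum>i=1..n. y i)))) \<le> real n * (K / \<delta> ^ 4)"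
  using assms(1-3)
proof (induction n arbitrary: b)
  case 0
  then show ?case by simp
next
  case (Suc n)
  define u where "u = F_transform (x (Suc n)) b"
  define v where "v = F_transform (y (Suc n)) b"
  have j: "Suc n \<in> {1..N}" using Suc.prems by simp
  note s = sa[OF j] centered[OF j]
  have u: "u \<in> B" "above \<delta> u" and v: "v \<in> B" "above \<delta> v"
    using s Suc.prems \<delta> by (auto simp: u_def v_def intro!: F_transform_in_B F_transform_above)
  let ?Gx = "\<lambda>w. E (inv_el (w - (\<Sum>i=1..n. x i)))" and ?Gy = "\<lambda>w. E (inv_el (w - (\<Sum>i=1..n. y i)))"
  have ex: "E (inv_el (b - (\<Sum>i=1..Suc n. x i))) = ?Gx u" unfolding u_def
    by (rule monotone_convolution[OF mon_x]) (use Suc.prems sa centered \<delta> in auto)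
  have ey: "E (inv_el (b - (\<Sum>i=1..Suc n. y i))) = ?Gy v" unfolding v_def
    by (rule monotone_convolution[OF mon_y]) (use Suc.prems sa centered \<delta> in auto)
  have "norm (?Gx u - ?Gx v) \<le> norm (u - v) / \<delta>\<^sup>2"
    using star_sum_x Suc.prems u v \<delta> by (intro norm_E_resolvent_diff) auto
  also have "\<dots> \<le> (K / \<delta>\<^sup>2) / \<delta>\<^sup>2"
    unfolding u_def v_def using F_transform_close[OF j Suc.prems(2,3) \<delta>] by (intro divide_right_mono) auto
  also have "\<dots> = K / \<delta> ^ 4" by (simp add: power2_eq_square power4_eq_xxxx)
  finally have "norm (?Gx u - ?Gx v) \<le> K / \<delta> ^ 4" .
  moreover have "norm (?Gx v - ?Gy v) \<le> real n * (K / \<delta> ^ 4)"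
    using Suc.prems by (intro Suc.IH v) auto
  moreover have "norm (?Gx u - ?Gy v) \<le> norm (?Gx u - ?Gx v) + norm (?Gx v - ?Gy v)"
    using norm_triangle_ineq[of "?Gx u - ?Gx v" "?Gx v - ?Gy v"] by simp
  moreover have "real (Suc n) * (K / \<delta> ^ 4) = K / \<delta> ^ 4 + real n * (K / \<delta> ^ 4)"
    by (simp only: of_nat_Suc ring_distribs mult_1)
  ultimately show ?case unfolding ex ey by linarith
qed

end

section \<open>Scalar-valued case\<close>

text \<open>The difference is estimated along the other three sides of a rectangle of width
  \<open>2 * R\<close> and height \<open>R\<close>. They keep distance at least \<open>R\<close>
  from 0 and have total length \<open>4 * R\<close>, so the bound is \<open>C / R\<^sup>2\<close>
  times \<open>4 * R\<close>.\<close>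

lemma primitive_diff_bound:
  fixes h H :: "complex \<Rightarrow> complex"
  assumes H: "\<And>z. Im z > 0 \<Longrightarrow> (H has_field_derivative h z) (at z)"
    and \<epsilon>: "\<epsilon> > 0" and R: "R > 0"
    and decay: "\<And>z. Im z \<ge> \<epsilon> \<Longrightarrow> cmod (h z) \<le> C / (cmod z)\<^sup>2"
  shows "cmod (H (Complex (-R) \<epsilon>) - H (Complex R \<epsilon>)) \<le> 4 * C / R"
proof -
  have "0 \<le> C / (cmod (Complex 0 \<epsilon>))\<^sup>2"
    by (rule order.trans[OF norm_ge_zero decay]) simp
  then have C: "C \<ge> 0" using \<epsilon> by (simp add: cmod_power2 zero_le_divide_iff)
  have bound: "cmod (H a - H b) \<le> C / R\<^sup>2 * cmod (a - b)"
    if seg: "\<And>z. z \<in> closed_segment a b \<Longrightarrow> Im z \<ge> \<epsilon> \<and> cmod z \<ge> R" for a b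
  proof (rule field_differentiable_bound[of "closed_segment a b" H h])
    fix z assume z: "z \<in> closed_segment a b"
    then have "Im z > 0" using seg[OF z] \<epsilon> by linarith
    then show "(H has_field_derivative h z) (at z within closed_segment a b)"
      by (rule has_field_derivative_at_within[OF H])
    have "C / (cmod z)\<^sup>2 \<le> C / R\<^sup>2"
      using seg[OF z] R C by (intro frac_le power_mono) auto
    then show "cmod (h z) \<le> C / R\<^sup>2" using decay[of z] seg[OF z] by linarith
  qed auto
  let ?a = "Complex (-R) \<epsilon>" and ?b = "Complex R \<epsilon>" and ?c = "Complex R (\<epsilon> + R)" and ?d = "Complex (-R) (\<epsilon> + R)"
  have 1: "cmod (H ?a - H ?d) \<le> C / R\<^sup>2 * cmod (?a - ?d)"
  proof (rule bound)
    fix z assume "z \<in> closed_segment ?a ?d"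
    then have "Re z = - R" "Im z \<in> {\<epsilon>..\<epsilon> + R}"
      using R by (auto simp: closed_segment_same_Re closed_segment_eq_real_ivl)
    then show "Im z \<ge> \<epsilon> \<and> cmod z \<ge> R" using abs_Re_le_cmod[of z] R by auto
  qed
  have 2: "cmod (H ?d - H ?c) \<le> C / R\<^sup>2 * cmod (?d - ?c)"
  proof (rule bound)
    fix z assume "z \<in> closed_segment ?d ?c"
    then have "Im z = \<epsilon> + R" by (auto simp: closed_segment_same_Im)
    then show "Im z \<ge> \<epsilon> \<and> cmod z \<ge> R" using abs_Im_le_cmod[of z] R \<epsilon> by auto
  qed
  have 3: "cmod (H ?c - H ?b) \<le> C / R\<^sup>2 * cmod (?c - ?b)"
  proof (rule bound)
    fix z assume "z \<in> closed_segment ?c ?b"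
    then have "Re z = R" "Im z \<in> {\<epsilon>..\<epsilon> + R}"
      using R by (auto simp: closed_segment_same_Re closed_segment_eq_real_ivl)
    then show "Im z \<ge> \<epsilon> \<and> cmod z \<ge> R" using abs_Re_le_cmod[of z] R by auto
  qed
  have n: "cmod (?a - ?d) = R" "cmod (?d - ?c) = 2 * R" "cmod (?c - ?b) = R"
    using R by (simp_all add: cmod_def real_sqrt_mult)
  have "cmod (H ?a - H ?b) \<le> cmod (H ?a - H ?d) + cmod (H ?d - H ?c) + cmod (H ?c - H ?b)"
    using norm_triangle_ineq[of "H ?a - H ?d" "H ?d - H ?c"]
      norm_triangle_ineq[of "H ?a - H ?c" "H ?c - H ?b"] by simp
  also have "\<dots> \<le> C / R\<^sup>2 * R + C / R\<^sup>2 * (2 * R) + C / R\<^sup>2 * R" using 1 2 3 unfolding n by linarith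
  also have "\<dots> = 4 * C / R" using R by (simp add: field_simps power2_eq_square)
  finally show ?thesis .
qed

text \<open>Removing \<open>1 / z\<close> leaves a function of quadratic decay, whose primitive
  \<open>H\<close> has a small increment. The part \<open>1 / z\<close> contributes the Poisson
  density with primitive \<open>arctan (t / \<epsilon>)\<close>, of total increment at most
  \<open>pi\<close>.\<close>

lemma nn_integral_interval_Cauchy_transform_le:
  fixes T :: "complex \<Rightarrow> complex"
  assumes hol: "T holomorphic_on {z. Im z > 0}" and \<epsilon>: "\<epsilon> > 0" and R: "R > 0"
    and neg: "\<And>z. Im z > 0 \<Longrightarrow> Im (T z) \<le> 0"
    and decay: "\<And>z. Im z \<ge> \<epsilon> \<Longrightarrow> cmod (T z - 1 / z) \<le> C / (cmod z)\<^sup>2"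
    and meas: "(\<lambda>t. - Im (T (Complex t \<epsilon>))) \<in> borel_measurable borel"
  shows "(\<integral>\<^sup>+ t. ennreal (- Im (T (Complex t \<epsilon>))) * indicator {-R..R} t \<partial>lborel) \<le> ennreal (pi + 4 * C / R)"
proof -
  let ?U = "{z. Im z > 0}"
  have U: "open ?U" "convex ?U" by (auto simp: open_halfspace_Im_gt convex_halfspace_Im_gt)
  have "(\<lambda>z. T z - 1 / z) holomorphic_on ?U" by (intro holomorphic_intros hol) auto
  from holomorphic_convex_primitive'[OF U(2,1) this] obtain H
    where "\<And>z. z \<in> ?U \<Longrightarrow> (H has_field_derivative (T z - 1 / z)) (at z within ?U)"
    by blast
  then have H: "\<And>z. Im z > 0 \<Longrightarrow> (H has_field_derivative (T z - 1 / z)) (at z)"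
    using at_within_open[OF _ U(1)] by (metis mem_Collect_eq)
  define P where "P t = arctan (t / \<epsilon>) - Im (H (Complex t \<epsilon>))" for t
  have "(P has_real_derivative - Im (T (Complex t \<epsilon>))) (at t)" for t
  proof -
    have "((\<lambda>t. Complex t \<epsilon>) has_vector_derivative 1) (at t)"
      by (auto simp: Complex_eq has_vector_derivative_def scaleR_conv_of_real intro!: derivative_eq_intros)
    from field_vector_diff_chain_at[OF this H] 
    have "(H \<circ> (\<lambda>t. Complex t \<epsilon>) has_vector_derivative (T (Complex t \<epsilon>) - 1 / Complex t \<epsilon>)) (at t)"
      using \<epsilon> by simp
    from bounded_linear.has_vector_derivative[OF bounded_linear_Im this]
    have "((\<lambda>t. Im (H (Complex t \<epsilon>))) has_real_derivative Im (T (Complex t \<epsilon>) - 1 / Complex t \<epsilon>)) (at t)"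
      by (simp only: has_real_derivative_iff_has_vector_derivative o_def)
    moreover have "((\<lambda>t. arctan (t / \<epsilon>)) has_real_derivative (inverse (1 + (t / \<epsilon>)\<^sup>2) * (1 / \<epsilon>))) (at t)"
      using \<epsilon> by (auto intro!: derivative_eq_intros)
    ultimately have "(P has_real_derivative (inverse (1 + (t / \<epsilon>)\<^sup>2) * (1 / \<epsilon>) - Im (T (Complex t \<epsilon>) - 1 / Complex t \<epsilon>))) (at t)"
      unfolding P_def by (intro DERIV_diff)
    moreover have "inverse (1 + (t / \<epsilon>)\<^sup>2) * (1 / \<epsilon>) - Im (T (Complex t \<epsilon>) - 1 / Complex t \<epsilon>) = - Im (T (Complex t \<epsilon>))"
    proof -
      have "t\<^sup>2 + \<epsilon>\<^sup>2 > 0" using \<epsilon> by (simp add: add_nonneg_pos)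
      have "inverse (1 + (t / \<epsilon>)\<^sup>2) * (1 / \<epsilon>) = \<epsilon> / (t\<^sup>2 + \<epsilon>\<^sup>2)"
        using \<epsilon> by (simp add: field_simps power2_eq_square)
      moreover have "Im (1 / Complex t \<epsilon>) = - \<epsilon> / (t\<^sup>2 + \<epsilon>\<^sup>2)" by (simp add: Im_divide)
      ultimately show ?thesis by simp
    qed
    ultimately show ?thesis by (simp only:)
  qed
  then have "(\<integral>\<^sup>+ t. ennreal (- Im (T (Complex t \<epsilon>))) * indicator {-R..R} t \<partial>lborel) = ennreal (P R - P (-R))"
    using R meas neg \<epsilon> by (intro nn_integral_FTC_Icc) auto
  also have "P R - P (- R) \<le> pi + 4 * C / R"
  proof -
    have "Im (H (Complex (-R) \<epsilon>)) - Im (H (Complex R \<epsilon>)) \<le> 4 * C / R"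
      using abs_Im_le_cmod[of "H (Complex (-R) \<epsilon>) - H (Complex R \<epsilon>)"]
        primitive_diff_bound[OF H \<epsilon> R decay] by simp
    moreover have "arctan (R / \<epsilon>) - arctan (- R / \<epsilon>) \<le> pi"
      using arctan_ubound[of "R / \<epsilon>"] by (simp add: arctan_minus)
    ultimately show ?thesis by (simp add: P_def)
  qed
  finally show ?thesis by (simp add: ennreal_leI)
qed

lemma nn_integral_Cauchy_transform_le:
  fixes T :: "complex \<Rightarrow> complex"
  assumes hol: "T holomorphic_on {z. Im z > 0}" and \<epsilon>: "\<epsilon> > 0"
    and neg: "\<And>z. Im z > 0 \<Longrightarrow> Im (T z) \<le> 0"
    and decay: "\<And>z. Im z \<ge> \<epsilon> \<Longrightarrow> cmod (T z - 1 / z) \<le> C / (cmod z)\<^sup>2"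
    and meas: "(\<lambda>t. - Im (T (Complex t \<epsilon>))) \<in> borel_measurable borel"
  shows "(\<integral>\<^sup>+ t. ennreal (- Im (T (Complex t \<epsilon>))) \<partial>lborel) \<le> ennreal pi"
proof -
  define g where "g t = - Im (T (Complex t \<epsilon>))" for t
  have meas: "g \<in> borel_measurable borel" using meas by (simp add: g_def[abs_def])
  have main: "(\<integral>\<^sup>+ t. ennreal (g t) * indicator {-R..R} t \<partial>lborel) \<le> ennreal (pi + 4 * C / R)" if "R > 0" for R
    unfolding g_def by (rule nn_integral_interval_Cauchy_transform_le) fact+
  have le_pi: "(\<integral>\<^sup>+ t. ennreal (g t) * indicator {- real n..real n} t \<partial>lborel) \<le> ennreal pi" for n
  proof (rule ennreal_le_epsilon)
    fix e :: real assume e: "0 < e"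
    \<comment> \<open>\<open>R \<ge> n\<close> enlarges the window, \<open>R \<ge> 4 * C / e\<close>
      makes the boundary error at most \<open>e\<close>, and the added 1 keeps \<open>R\<close>
      positive for \<open>n = 0\<close>.\<close>
    define R where "R = max (real n + 1) (4 * C / e)"
    have R: "R > 0" "real n \<le> R" by (simp_all add: R_def)
    have "4 * C / e \<le> R" by (simp add: R_def)
    then have Re: "4 * C / R \<le> e" using e R by (simp add: field_simps)
    have "(\<integral>\<^sup>+ t. ennreal (g t) * indicator {- real n..real n} t \<partial>lborel)
       \<le> (\<integral>\<^sup>+ t. ennreal (g t) * indicator {- R..R} t \<partial>lborel)"
      using R by (intro nn_integral_mono mult_left_mono) (auto simp: indicator_def)
    also have "\<dots> \<le> ennreal (pi + 4 * C / R)" by (rule main[OF R(1)])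
    also have "\<dots> \<le> ennreal (pi + e)" using Re by (intro ennreal_leI) simp
    also have "\<dots> = ennreal pi + ennreal e" using e by (intro ennreal_plus) auto
    finally show "(\<integral>\<^sup>+ t. ennreal (g t) * indicator {- real n..real n} t \<partial>lborel)
       \<le> ennreal pi + ennreal e" .
  qed
  have sup: "ennreal (g t) = (SUP n. ennreal (g t) * indicator {- real n..real n} t)" for t
  proof (rule antisym)
    obtain n :: nat where "\<bar>t\<bar> \<le> real n" using real_arch_simple by blast
    then have "ennreal (g t) \<le> ennreal (g t) * indicator {- real n..real n} t" by (simp add: abs_le_iff)
    also have "\<dots> \<le> (SUP n. ennreal (g t) * indicator {- real n..real n} t)" by (rule SUP_upper) simp
    finally show "ennreal (g t) \<le> (SUP n. ennreal (g t) * indicator {- real n..real n} t)" .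
    show "(SUP n. ennreal (g t) * indicator {- real n..real n} t) \<le> ennreal (g t)"
      by (rule SUP_least) (simp add: indicator_def)
  qed
  have "(\<integral>\<^sup>+ t. ennreal (g t) \<partial>lborel)
     = (\<integral>\<^sup>+ t. (SUP n. ennreal (g t) * indicator {- real n..real n} t) \<partial>lborel)"
    by (rule nn_integral_cong) (rule sup)
  also have "\<dots> = (SUP n. \<integral>\<^sup>+ t. ennreal (g t) * indicator {- real n..real n} t \<partial>lborel)"
  proof (rule nn_integral_monotone_convergence_SUP)
    show "incseq (\<lambda>n t. ennreal (g t) * indicator {- real n..real n} t)"
      by (auto simp: incseq_def le_fun_def indicator_def)
    show "(\<lambda>t. ennreal (g t) * indicator {- real n..real n} t) \<in> borel_measurable lborel" for n
      using meas by measurable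
  qed
  also have "\<dots> \<le> ennreal pi" by (rule SUP_least) (rule le_pi)
  finally show ?thesis by (simp add: g_def)
qed

section \<open>Scalar Cauchy transforms and half-plane maps\<close>

lemma scaleC_one_inject: "scaleC z (1 :: 'a::cstar_algebra) = scaleC w 1 \<longleftrightarrow> z = w"
proof
  assume "scaleC z (1 :: 'a) = scaleC w 1"
  then have "cmod (z - w) = 0"
    using norm_scaleC[of "z - w" "1 :: 'a"] by (simp add: scaleC_diff_left)
  then show "z = w" by simp
qed simp

text \<open>A class containing the compositions of F-transforms of centered variables. Bounded
  distance to the identity, on each half-plane away from the axis, preserves the asymptotics
  \<open>1 / z\<close> of a Cauchy transform after composition, and with it the mass bound.\<close>

definition near_id :: "(complex \<Rightarrow> complex) \<Rightarrow> bool" where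
  "near_id f \<longleftrightarrow> f holomorphic_on {z. Im z > 0} \<and> (\<forall>z. Im z > 0 \<longrightarrow> Im z \<le> Im (f z)) \<and>
     (\<forall>\<epsilon>>0. \<exists>C. \<forall>z. \<epsilon> \<le> Im z \<longrightarrow> cmod (f z - z) \<le> C)"

lemma near_id_ident: "near_id (\<lambda>z. z)"
  by (auto simp: near_id_def intro!: exI[of _ 0] holomorphic_intros)

text \<open>As \<open>f\<close> does not lower imaginary parts, \<open>g\<close> is evaluated in the
  same half-plane \<open>\<epsilon> \<le> Im z\<close>, and the two distances add up.\<close>

lemma near_id_compose:
  assumes f: "near_id f" and g: "near_id g" shows "near_id (\<lambda>z. g (f z))"
  unfolding near_id_def
proof (intro conjI allI impI)
  have im: "Im (f z) > 0" if "Im z > 0" for z using f that by (force simp: near_id_def)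
  show "(\<lambda>z. g (f z)) holomorphic_on {z. Im z > 0}"
    using holomorphic_on_compose_gen[of f "{z. Im z > 0}" g "{z. Im z > 0}"] f g im
    by (auto simp: near_id_def o_def)
  show "Im z \<le> Im (g (f z))" if "Im z > 0" for z
    using f g im[OF that] that by (force simp: near_id_def)
  fix \<epsilon> :: real assume \<epsilon>: "\<epsilon> > 0"
  then obtain C D where C: "\<And>z. \<epsilon> \<le> Im z \<Longrightarrow> cmod (f z - z) \<le> C"
    and D: "\<And>z. \<epsilon> \<le> Im z \<Longrightarrow> cmod (g z - z) \<le> D"
    using f g unfolding near_id_def by meson
  show "\<exists>C. \<forall>z. \<epsilon> \<le> Im z \<longrightarrow> cmod (g (f z) - z) \<le> C"
  proof (intro exI[of _ "D + C"] allI impI)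
    fix z assume z: "\<epsilon> \<le> Im z"
    then have "Im z \<le> Im (f z)" using f \<epsilon> by (simp add: near_id_def)
    with z have "\<epsilon> \<le> Im (f z)" by linarith
    then have "cmod (g (f z) - f z) \<le> D" by (rule D)
    with C[OF z] norm_triangle_ineq[of "g (f z) - f z" "f z - z"] show "cmod (g (f z) - z) \<le> D + C"
      by simp
  qed
qed

locale scalar_space = cond_exp_space B E for B :: "'a::cstar_algebra set" and E +
  fixes \<phi> :: "'a \<Rightarrow> complex"
  assumes B_scalar: "B = range (\<lambda>c. scaleC c 1)" and E_scalar: "\<And>a. E a = scaleC (\<phi> a) 1"
begin

lemma phi_add: "\<phi> (a + c) = \<phi> a + \<phi> c" and phi_diff: "\<phi> (a - c) = \<phi> a - \<phi> c"
  and phi_scaleC: "\<phi> (scaleC z a) = z * \<phi> a" and phi_one: "\<phi> 1 = 1"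
proof -
  note inj = scaleC_one_inject[where ?'a = 'a, THEN iffD1]
  show "\<phi> (a + c) = \<phi> a + \<phi> c"
    by (rule inj) (use E_add[of a c] in \<open>simp add: E_scalar scaleC_add_left\<close>)
  show "\<phi> (a - c) = \<phi> a - \<phi> c"
    by (rule inj) (use E_diff[of a c] in \<open>simp add: E_scalar scaleC_diff_left\<close>)
  show "\<phi> (scaleC z a) = z * \<phi> a"
    by (rule inj) (use E_scaleC[of z a] in \<open>simp add: E_scalar scaleC_scaleC\<close>)
  show "\<phi> 1 = 1"
    by (rule inj) (use E_one in \<open>simp add: E_scalar scaleC_one\<close>)
qed

lemma norm_E_scalar: "norm (E a) = cmod (\<phi> a)"
  by (simp add: E_scalar norm_scaleC)

lemma cmod_phi_le: "cmod (\<phi> a) \<le> norm a"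
  using E_contractive[of a] by (simp add: norm_E_scalar)

lemma scalar_in_B: "scaleC z 1 \<in> B"
  by (simp add: B_scalar)

definition cauchy :: "'a \<Rightarrow> complex \<Rightarrow> complex" where
  "cauchy L z = \<phi> (inv_el (scaleC z 1 - L))"

context
  fixes L :: 'a assumes L: "star L = L"
begin

lemma scalar_resolvent:
  assumes "Im z > 0"
  shows "(scaleC z 1 - L) * inv_el (scaleC z 1 - L) = 1" "inv_el (scaleC z 1 - L) * (scaleC z 1 - L) = 1"
    "norm (inv_el (scaleC z 1 - L)) \<le> 1 / Im z"
  by (rule resolvent_inverse[OF L scalar_in_B above_scalar[OF order_refl] assms])+

lemma scalar_resolvent_diff:
  assumes "Im z > 0" "Im w > 0"
  shows "inv_el (scaleC w 1 - L) - inv_el (scaleC z 1 - L)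
    = scaleC (z - w) (inv_el (scaleC w 1 - L) * inv_el (scaleC z 1 - L))"
proof -
  have "inv_el (scaleC w 1 - L) - inv_el (scaleC z 1 - L)
    = inv_el (scaleC w 1 - L) * (scaleC z 1 - scaleC w 1) * inv_el (scaleC z 1 - L)"
    by (rule resolvent_identity[OF L, of "min (Im z) (Im w)"]) (use assms in \<open>auto intro: above_scalar\<close>)
  then show ?thesis
    by (simp add: scaleC_diff_left[symmetric] mult_scaleC_left mult_scaleC_right)
qed

text \<open>By the resolvent identity the difference quotient is
  \<open>- \<phi> (G w * G z)\<close>, and the same identity bounds its distance from the limit by a
  multiple of \<open>cmod (w - z)\<close>.\<close>

lemma has_field_derivative_cauchy:
  assumes z: "Im z > 0"
  shows "(cauchy L has_field_derivative - \<phi> (inv_el (scaleC z 1 - L) * inv_el (scaleC z 1 - L))) (at z)"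
proof -
  define G where "G w = inv_el (scaleC w 1 - L)" for w
  have d: "G w - G z = scaleC (z - w) (G w * G z)" if "Im w > 0" for w
    unfolding G_def by (rule scalar_resolvent_diff[OF z that])
  have nz: "norm (G z) \<le> 1 / Im z" unfolding G_def by (rule scalar_resolvent(3)[OF z])
  \<comment> \<open>On this neighbourhood \<open>norm (G w) \<le> 2 / Im z\<close> holds
    uniformly.\<close>
  have "open {w. Im w > Im z / 2}" by (rule open_halfspace_Im_gt)
  moreover have "z \<in> {w. Im w > Im z / 2}" using z by simp
  ultimately have ev: "eventually (\<lambda>w. Im w > Im z / 2) (at z)"
    unfolding eventually_at_topological by (metis mem_Collect_eq)
  have est: "cmod ((cauchy L w - cauchy L z) / (w - z) - (- \<phi> (G z * G z))) \<le> cmod (w - z) * (2 / (Im z) ^ 3)"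
    if w: "Im w > Im z / 2" "w \<noteq> z" for w
  proof -
    have w0: "Im w > 0" using w z by linarith
    have "cauchy L w - cauchy L z = \<phi> (G w - G z)" by (simp add: cauchy_def G_def phi_diff)
    also have "\<dots> = (z - w) * \<phi> (G w * G z)" unfolding d[OF w0] by (rule phi_scaleC)
    finally have "(cauchy L w - cauchy L z) / (w - z) = - \<phi> (G w * G z)"
      using w(2) by (simp add: field_simps)
    then have "(cauchy L w - cauchy L z) / (w - z) - (- \<phi> (G z * G z)) = - \<phi> ((G w - G z) * G z)"
      by (simp add: left_diff_distrib phi_diff)
    then have "cmod ((cauchy L w - cauchy L z) / (w - z) - (- \<phi> (G z * G z))) \<le> norm ((G w - G z) * G z)"
      using cmod_phi_le by simp
    also have "\<dots> = cmod (w - z) * norm (G w * G z * G z)"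
      unfolding d[OF w0] by (simp add: mult_scaleC_left norm_scaleC norm_minus_commute)
    also have "norm (G w * G z * G z) \<le> norm (G w) * norm (G z) * norm (G z)" by (rule norm_mult3_ineq)
    also have "\<dots> \<le> (2 / Im z) * (1 / Im z) * (1 / Im z)"
    proof -
      have "norm (G w) \<le> 1 / Im w" unfolding G_def by (rule scalar_resolvent(3)[OF w0])
      also have "\<dots> \<le> 2 / Im z" using w z w0 by (simp add: field_simps)
      finally show ?thesis using nz z by (intro mult_mono) auto
    qed
    also have "\<dots> = 2 / (Im z) ^ 3" by (simp add: power3_eq_cube)
    finally show ?thesis by (simp add: mult_left_mono)
  qed
  have lim: "((\<lambda>w. cmod (w - z) * (2 / (Im z) ^ 3)) \<longlongrightarrow> 0) (at z)"
    by (rule tendsto_eq_intros refl tendsto_ident_at | simp)+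
  have "((\<lambda>w. (cauchy L w - cauchy L z) / (w - z) - (- \<phi> (G z * G z))) \<longlongrightarrow> 0) (at z)"
  proof (rule Lim_null_comparison[OF _ lim])
    show "eventually (\<lambda>w. norm ((cauchy L w - cauchy L z) / (w - z) - (- \<phi> (G z * G z)))
        \<le> cmod (w - z) * (2 / (Im z) ^ 3)) (at z)"
      using eventually_conj[OF ev eventually_neq_at_within[of z z UNIV]]
      by (rule eventually_mono) (use est in blast)
  qed
  from LIM_zero_cancel[OF this] show ?thesis by (simp add: has_field_derivative_iff G_def)
qed

lemma holomorphic_cauchy: "cauchy L holomorphic_on {z. Im z > 0}"
  unfolding holomorphic_on_def field_differentiable_def
  using has_field_derivative_at_within[OF has_field_derivative_cauchy] by blast

text \<open>For scalar arguments the imaginary part of \<open>scaleC z 1 - L\<close> is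
  \<open>Im z\<close> times 1, so \<open>- Im_el G\<close> is the same multiple of both
  \<open>star G * G\<close> and \<open>G * star G\<close>. Cauchy-Schwarz for a product of two
  resolvents meets one moment of each order.\<close>

lemma Im_cauchy:
  assumes z: "Im z > 0"
  defines "G \<equiv> inv_el (scaleC z 1 - L)"
  shows "Im (cauchy L z) \<le> 0"
    "norm (E (star G * G)) = - Im (cauchy L z) / Im z" "norm (E (G * star G)) = - Im (cauchy L z) / Im z"
proof -
  note G = scalar_resolvent(1,2)[OF z, folded G_def]
  have I: "Im_el (scaleC z 1 - L) = Im z *\<^sub>R 1" by (simp add: Im_el_diff Im_el_scalar Im_el_selfadj L)
  have "star G * (scaleC z 1 - L) * G = star G" using G by (simp add: mult.assoc)
  then have "- Im_el G = Im z *\<^sub>R (star G * G)"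
    using Im_el_conj[of G "scaleC z 1 - L"] by (simp add: I Im_el_star)
  then have 1: "Im_el G = - (Im z *\<^sub>R (star G * G))" by (metis minus_minus)
  have "star (scaleC z 1 - L) * star G = star (G * (scaleC z 1 - L))" by (simp only: star_mult)
  then have "G * (star (scaleC z 1 - L) * star G) = G" using G by simp
  then have 2: "Im_el G = - (Im z *\<^sub>R (G * star G))"
    using Im_el_conj[of "star G" "star (scaleC z 1 - L)"]
    by (simp add: I Im_el_star star_star mult.assoc)
  have "E (Im_el G) = Im_el (E G)" by (simp add: Im_el_def E_scaleC E_diff E_star)
  also have "\<dots> = Im (cauchy L z) *\<^sub>R 1" by (simp add: E_scalar Im_el_scalar cauchy_def G_def)
  finally have EI: "E (Im_el G) = Im (cauchy L z) *\<^sub>R 1" .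
  have E1: "E (star G * G) = (- Im (cauchy L z) / Im z) *\<^sub>R 1"
  proof -
    have "star G * G = (- 1 / Im z) *\<^sub>R Im_el G" using z by (simp add: 1)
    then show ?thesis by (simp add: E_scaleR EI E_minus)
  qed
  have E2: "E (G * star G) = (- Im (cauchy L z) / Im z) *\<^sub>R 1"
  proof -
    have "G * star G = (- 1 / Im z) *\<^sub>R Im_el G" using z by (simp add: 2)
    then show ?thesis by (simp add: E_scaleR EI E_minus)
  qed
  have "pos ((- Im (cauchy L z) / Im z) *\<^sub>R (1 :: 'a))" using E_pos[OF pos_star_mult[of G]] E1 by simp
  then have nn: "- Im (cauchy L z) / Im z \<ge> 0" by (simp only: pos_scaleR_one_iff)
  then show "Im (cauchy L z) \<le> 0" using z by (simp add: field_simps)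
  show "norm (E (star G * G)) = - Im (cauchy L z) / Im z" unfolding E1 norm_scaleR abs_of_nonneg[OF nn] by simp
  show "norm (E (G * star G)) = - Im (cauchy L z) / Im z" unfolding E2 norm_scaleR abs_of_nonneg[OF nn] by simp
qed

text \<open>Using \<open>scaleC z G = 1 + L * G\<close> twice gives
  \<open>z\<^sup>2 * (\<phi> G - 1 / z) = \<phi> (L + L * L * G)\<close>, which stays bounded for
  \<open>Im z \<ge> \<epsilon>\<close>.\<close>

lemma cauchy_decay:
  assumes z: "Im z \<ge> \<epsilon>" and \<epsilon>: "\<epsilon> > 0"
  shows "cmod (cauchy L z - 1 / z) \<le> (norm L + (norm L)\<^sup>2 / \<epsilon>) / (cmod z)\<^sup>2"
proof -
  have z0: "Im z > 0" "z \<noteq> 0" using z \<epsilon> by auto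
  define G where "G = inv_el (scaleC z 1 - L)"
  note G = scalar_resolvent[OF z0(1), folded G_def]
  have nG: "norm G \<le> 1 / \<epsilon>" using G(3) z \<epsilon> by (meson frac_le order.trans zero_le_one order_refl)
  have "scaleC z G = 1 + L * G" using G(1) by (simp add: left_diff_distrib mult_scaleC_left diff_eq_eq)
  then have "z * \<phi> G = 1 + \<phi> (L * G)" using phi_scaleC[of z G] by (simp add: phi_add phi_one)
  then have "cauchy L z - 1 / z = \<phi> (L * G) / z"
    using z0 by (simp add: cauchy_def G_def[symmetric] field_simps)
  moreover have "scaleC z (L * G) = L + L * L * G"
    using \<open>scaleC z G = 1 + L * G\<close> by (simp add: mult_scaleC_right[symmetric] distrib_left mult.assoc)
  then have "z * \<phi> (L * G) = \<phi> (L + L * L * G)" using phi_scaleC[of z "L * G"] by simp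
  then have "\<phi> (L * G) = \<phi> (L + L * L * G) / z" using z0 by (simp add: field_simps)
  ultimately have "cmod (cauchy L z - 1 / z) = cmod (\<phi> (L + L * L * G)) / (cmod z)\<^sup>2"
    by (simp add: norm_divide norm_mult power2_eq_square)
  also have "cmod (\<phi> (L + L * L * G)) \<le> norm L + norm (L * L * G)"
    by (rule order.trans[OF cmod_phi_le norm_triangle_ineq])
  also have "norm (L * L * G) \<le> norm L * norm L * norm G" by (rule norm_mult3_ineq)
  also have "\<dots> \<le> norm L * norm L * (1 / \<epsilon>)" using nG by (intro mult_left_mono) auto
  finally show ?thesis by (simp add: divide_right_mono power2_eq_square)
qed

text \<open>The factor 1/2 comes from the arithmetic-geometric mean inequality applied to the two
  moments of \<open>Im_cauchy\<close>, and \<open>1 / \<epsilon>\<close> from the imaginary parts.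
  Unlike a bound by norms, the result can be integrated over the real part.\<close>

lemma cauchy_diff:
  assumes u: "Im u \<ge> \<epsilon>" and v: "Im v \<ge> \<epsilon>" and \<epsilon>: "\<epsilon> > 0"
  shows "cmod (cauchy L u - cauchy L v) \<le> cmod (u - v) / (2 * \<epsilon>) * (- Im (cauchy L u) - Im (cauchy L v))"
proof -
  define A where "A = inv_el (scaleC u 1 - L)"
  define C where "C = inv_el (scaleC v 1 - L)"
  have uv: "Im u > 0" "Im v > 0" using u v \<epsilon> by auto
  have AC: "A - C = scaleC (v - u) (A * C)"
    unfolding A_def C_def by (rule scalar_resolvent_diff) (use uv in auto)
  have "cauchy L u - cauchy L v = \<phi> (A - C)" by (simp only: cauchy_def A_def C_def phi_diff)
  also have "\<dots> = (v - u) * \<phi> (A * C)" unfolding AC by (rule phi_scaleC)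
  finally have "cauchy L u - cauchy L v = (v - u) * \<phi> (A * C)" .
  then have e: "cmod (cauchy L u - cauchy L v) = cmod (u - v) * norm (E (star (star A) * C))"
    by (simp add: norm_mult norm_minus_commute norm_E_scalar star_star)
  define a where "a = - Im (cauchy L u) / Im u"
  define c where "c = - Im (cauchy L v) / Im v"
  have a: "norm (E (star (star A) * star A)) = a" unfolding star_star A_def a_def by (rule Im_cauchy(3)[OF uv(1)])
  have c: "norm (E (star C * C)) = c" unfolding C_def c_def by (rule Im_cauchy(2)[OF uv(2)])
  have ac0: "a \<ge> 0" "c \<ge> 0" using a c norm_ge_zero by metis+
  have ac: "a \<le> - Im (cauchy L u) / \<epsilon>" "c \<le> - Im (cauchy L v) / \<epsilon>"
    unfolding a_def c_def using Im_cauchy(1)[OF uv(1)] Im_cauchy(1)[OF uv(2)] u v \<epsilon>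
    by (intro frac_le; simp)+
  have "norm (E (star (star A) * C)) \<le> sqrt (a * c)"
    using cauchy_schwarz_sqrt[of "star A" C] unfolding a c by (simp only: real_sqrt_mult)
  also have "\<dots> \<le> (a + c) / 2" by (rule arith_geo_mean_sqrt[OF ac0])
  also have "\<dots> \<le> (- Im (cauchy L u) / \<epsilon> + - Im (cauchy L v) / \<epsilon>) / 2"
    by (intro divide_right_mono add_mono ac) simp
  also have "\<dots> = (- Im (cauchy L u) - Im (cauchy L v)) / (2 * \<epsilon>)" using \<epsilon> by (simp add: field_simps)
  finally have "cmod (u - v) * norm (E (star (star A) * C))
      \<le> cmod (u - v) * ((- Im (cauchy L u) - Im (cauchy L v)) / (2 * \<epsilon>))"
    by (intro mult_left_mono) auto
  then show ?thesis unfolding e by simp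
qed

lemma measurable_cauchy_near_id:
  assumes f: "near_id f" and \<epsilon>: "\<epsilon> > 0"
  shows "(\<lambda>t. cauchy L (f (Complex t \<epsilon>))) \<in> borel_measurable borel"
proof (rule borel_measurable_continuous_onI)
  have f1: "continuous_on {z. Im z > 0} f" and f2: "\<And>z. Im z > 0 \<Longrightarrow> Im z \<le> Im (f z)"
    using f by (auto simp: near_id_def intro: holomorphic_on_imp_continuous_on)
  have 1: "continuous_on UNIV (\<lambda>t. f (Complex t \<epsilon>))"
    by (rule continuous_on_compose2[OF f1]) (auto simp: Complex_eq \<epsilon> intro!: continuous_intros)
  have "Im (f (Complex t \<epsilon>)) > 0" for t using f2[of "Complex t \<epsilon>"] \<epsilon> by simp
  then show "continuous_on UNIV (\<lambda>t. cauchy L (f (Complex t \<epsilon>)))"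
    by (intro continuous_on_compose2[OF holomorphic_on_imp_continuous_on[OF holomorphic_cauchy] 1]) auto
qed

lemma nn_integral_cauchy_near_id:
  assumes f: "near_id f" and \<epsilon>: "\<epsilon> > 0"
  shows "(\<integral>\<^sup>+ t. ennreal (- Im (cauchy L (f (Complex t \<epsilon>)))) \<partial>lborel) \<le> ennreal pi"
proof -
  have f1: "f holomorphic_on {z. Im z > 0}" and f2: "\<And>z. Im z > 0 \<Longrightarrow> Im z \<le> Im (f z)"
    using f by (auto simp: near_id_def)
  have f3: "Im (f z) > 0" if "Im z > 0" for z using f2[OF that] that by linarith
  obtain C where C: "\<And>z. \<epsilon> \<le> Im z \<Longrightarrow> cmod (f z - z) \<le> C" using f \<epsilon> unfolding near_id_def by meson
  have C0: "C \<ge> 0" by (rule order.trans[OF norm_ge_zero C[of "Complex 0 \<epsilon>"]]) simp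
  define K where "K = norm L + (norm L)\<^sup>2 / \<epsilon>"
  have K0: "K \<ge> 0" using \<epsilon> by (simp add: K_def)
  \<comment> \<open>Chosen for \<open>cmod z \<le> cmod (f z) + C \<le> q * cmod (f z)\<close>,
    which holds since \<open>cmod (f z) \<ge> \<epsilon>\<close>.\<close>
  define q where "q = 1 + C / \<epsilon>"
  have q0: "q \<ge> 0" using C0 \<epsilon> by (simp add: q_def)
  show ?thesis
  \<comment> \<open>The first summand of the constant is the decay of \<open>cauchy L\<close> at
    \<open>f z\<close>, the second the distance of \<open>1 / f z\<close> from
    \<open>1 / z\<close>.\<close>
  proof (rule nn_integral_Cauchy_transform_le[where T = "\<lambda>z. cauchy L (f z)" and C = "K * q\<^sup>2 + C * q"])
    show "(\<lambda>z. cauchy L (f z)) holomorphic_on {z. Im z > 0}"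
      using holomorphic_on_compose_gen[OF f1 holomorphic_cauchy] f3 by (auto simp: o_def)
    show "Im (cauchy L (f z)) \<le> 0" if "Im z > 0" for z by (rule Im_cauchy(1)[OF f3[OF that]])
    show "(\<lambda>t. - Im (cauchy L (f (Complex t \<epsilon>)))) \<in> borel_measurable borel"
      using measurable_cauchy_near_id[OF f \<epsilon>] by measurable
    fix z assume z: "Im z \<ge> \<epsilon>"
    define w where "w = f z"
    have w: "Im w \<ge> \<epsilon>" using f2[of z] z \<epsilon> by (simp add: w_def)
    have pz: "cmod z > 0" "cmod w > 0" "z \<noteq> 0" "w \<noteq> 0" using z w \<epsilon> by auto
    have "cmod z \<le> cmod w + C" using C[OF z] norm_triangle_ineq3[of w z] by (simp add: w_def)
    also have "C \<le> C / \<epsilon> * cmod w"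
    proof -
      have "\<epsilon> \<le> cmod w" using w abs_Im_le_cmod[of w] by linarith
      then have "C / \<epsilon> * \<epsilon> \<le> C / \<epsilon> * cmod w" using C0 \<epsilon> by (intro mult_left_mono) auto
      then show ?thesis using \<epsilon> by simp
    qed
    finally have zw: "cmod z \<le> q * cmod w" by (simp add: q_def algebra_simps)
    then have r: "1 / cmod w \<le> q / cmod z" using pz by (simp add: field_simps)
    have "cmod (cauchy L w - 1 / w) \<le> K * (1 / cmod w)\<^sup>2"
      using cauchy_decay[OF w \<epsilon>] by (simp add: K_def power_divide)
    also have "\<dots> \<le> K * (q / cmod z)\<^sup>2" using r K0 pz by (intro mult_left_mono power_mono) auto
    finally have 1: "cmod (cauchy L w - 1 / w) \<le> K * q\<^sup>2 / (cmod z)\<^sup>2" by (simp add: power_divide)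
    have "1 / w - 1 / z = (z - w) / (w * z)" using pz by (simp add: field_simps)
    then have "cmod (1 / w - 1 / z) = cmod (w - z) * (1 / cmod w) * (1 / cmod z)"
      by (simp add: norm_divide norm_mult norm_minus_commute)
    also have "\<dots> \<le> C * (q / cmod z) * (1 / cmod z)"
      using C[OF z] r C0 q0 pz by (intro mult_mono) (auto simp: w_def[symmetric])
    finally have 2: "cmod (1 / w - 1 / z) \<le> C * q / (cmod z)\<^sup>2" by (simp add: power2_eq_square)
    have "cmod (cauchy L w - 1 / z) \<le> cmod (cauchy L w - 1 / w) + cmod (1 / w - 1 / z)"
      using norm_triangle_ineq[of "cauchy L w - 1 / w" "1 / w - 1 / z"] by simp
    also have "\<dots> \<le> (K * q\<^sup>2 + C * q) / (cmod z)\<^sup>2" using 1 2 by (simp add: add_divide_distrib)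
    finally show "cmod (cauchy L (f z) - 1 / z) \<le> (K * q\<^sup>2 + C * q) / (cmod z)\<^sup>2" by (simp add: w_def)
  qed (rule \<epsilon>)
qed

definition F_scalar :: "complex \<Rightarrow> complex" where
  "F_scalar z = \<phi> (F_transform L (scaleC z 1))"

lemma F_transform_scalar:
  assumes "Im z > 0" shows "F_transform L (scaleC z 1) = scaleC (F_scalar z) 1"
  using E_B[OF F_transform_in_B[OF L scalar_in_B above_scalar[OF order_refl] assms]]
  unfolding E_scalar F_scalar_def by (rule sym)

text \<open>Nonvanishing of the Cauchy transform is read off from the invertibility of the expected
  resolvent; it makes the F-transform holomorphic as a reciprocal.\<close>

lemma F_scalar_eq:
  assumes "Im z > 0" shows "cauchy L z \<noteq> 0" "F_scalar z = 1 / cauchy L z"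
proof -
  have "scaleC (F_scalar z * cauchy L z) (1 :: 'a) = scaleC 1 1"
    using F_transform_inverse(1)[OF L scalar_in_B above_scalar[OF order_refl] assms]
    unfolding F_transform_scalar[OF assms] E_scalar
    by (simp add: cauchy_def mult_scaleC_left scaleC_scaleC scaleC_one)
  then have "F_scalar z * cauchy L z = 1" by (simp only: scaleC_one_inject)
  then show "cauchy L z \<noteq> 0" by auto
  with \<open>F_scalar z * cauchy L z = 1\<close> show "F_scalar z = 1 / cauchy L z" by (simp add: eq_divide_eq)
qed

lemma near_id_F_scalar:
  assumes "E L = 0" shows "near_id F_scalar"
  unfolding near_id_def
proof (intro conjI allI impI)
  have "(\<lambda>z. 1 / cauchy L z) holomorphic_on {z. Im z > 0}"
    by (intro holomorphic_intros holomorphic_cauchy) (use F_scalar_eq in auto)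
  then show "F_scalar holomorphic_on {z. Im z > 0}"
    by (rule holomorphic_transform) (use F_scalar_eq in auto)
  show "Im z \<le> Im (F_scalar z)" if z: "Im z > 0" for z
  proof -
    have "above (Im z) (scaleC (F_scalar z) (1 :: 'a))"
      using F_transform_above[OF L scalar_in_B above_scalar[OF order_refl] z assms]
      by (simp add: F_transform_scalar[OF z])
    then show ?thesis by (simp add: above_def Im_el_scalar pos_scaleR_one_iff flip: scaleR_diff_left)
  qed
  fix \<epsilon> :: real assume \<epsilon>: "\<epsilon> > 0"
  show "\<exists>C. \<forall>z. \<epsilon> \<le> Im z \<longrightarrow> cmod (F_scalar z - z) \<le> C"
  proof (intro exI[of _ "norm (E (L * L)) / \<epsilon>"] allI impI)
    fix z assume z: "\<epsilon> \<le> Im z"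
    then have "Im z > 0" using \<epsilon> by linarith
    have "norm (F_transform L (scaleC z 1) - scaleC z 1) \<le> norm (E (L * L)) / \<epsilon>"
      by (rule norm_F_transform_diff[OF L scalar_in_B above_scalar[OF z] \<epsilon> assms])
    then show "cmod (F_scalar z - z) \<le> norm (E (L * L)) / \<epsilon>"
      unfolding F_transform_scalar[OF \<open>Im z > 0\<close>] scaleC_diff_left[symmetric] norm_scaleC by simp
  qed
qed

end

text \<open>Unit elements of \<open>B\<close> are phases, which cancel against their adjoints, so
  the supremum runs over a single value.\<close>

lemma alpha4_scalar: "N > 0 \<Longrightarrow> alpha4 B E N x = alpha4_tilde E N x"
proof -
  have "(SUP b\<in>{b \<in> B. norm b = 1}. norm (E (x i * star b * (x i * x i) * b * x i)))
      = norm (E (x i * x i * x i * x i))" for i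
  proof -
    have "norm (E (x i * star b * (x i * x i) * b * x i)) = norm (E (x i * x i * x i * x i))"
      if b: "b \<in> B" "norm b = 1" for b
    proof -
      from b obtain c where c: "b = scaleC c 1" "cmod c = 1" by (auto simp: B_scalar norm_scaleC)
      then have "x i * star b * (x i * x i) * b * x i = scaleC (c * cnj c) (x i * x i * x i * x i)"
        by (simp add: star_scaleC mult_scaleC_left mult_scaleC_right scaleC_scaleC mult.assoc)
      then show ?thesis using c by (simp add: E_scaleC norm_scaleC norm_mult)
    qed
    then have "(\<lambda>b. norm (E (x i * star b * (x i * x i) * b * x i))) ` {b \<in> B. norm b = 1}
        = {norm (E (x i * x i * x i * x i))}"
      using B_intros(1) by (auto simp: image_iff intro!: exI[of _ 1])
    then show ?thesis by simp
  qed
  then show ?thesis by (simp add: alpha4_def alpha4_tilde_def)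
qed

end

locale scalar_monotone_pair = monotone_pair B E N x y + scalar_space B E \<phi>
  for B :: "'a::cstar_algebra set" and E N x y \<phi>
begin

lemma cauchy_monotone_convolution:
  assumes n: "Suc n \<le> N" and z: "Im z > 0"
  shows "cauchy (\<Sum>i=1..Suc n. x i) z = cauchy (\<Sum>i=1..n. x i) (F_scalar (x (Suc n)) z)"
    "cauchy (\<Sum>i=1..Suc n. y i) z = cauchy (\<Sum>i=1..n. y i) (F_scalar (y (Suc n)) z)"
proof -
  have s: "star (x (Suc n)) = x (Suc n)" "star (y (Suc n)) = y (Suc n)" using sa n by auto
  have "E (inv_el (scaleC z 1 - (\<Sum>i=1..Suc n. x i)))
      = E (inv_el (F_transform (x (Suc n)) (scaleC z 1) - (\<Sum>i=1..n. x i)))"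
    by (rule monotone_convolution[OF mon_x n _ _ scalar_in_B above_scalar[OF order_refl] z])
       (use sa centered in auto)
  then show "cauchy (\<Sum>i=1..Suc n. x i) z = cauchy (\<Sum>i=1..n. x i) (F_scalar (x (Suc n)) z)"
    unfolding F_transform_scalar[OF s(1) z] E_scalar scaleC_one_inject cauchy_def .
  have "E (inv_el (scaleC z 1 - (\<Sum>i=1..Suc n. y i)))
      = E (inv_el (F_transform (y (Suc n)) (scaleC z 1) - (\<Sum>i=1..n. y i)))"
    by (rule monotone_convolution[OF mon_y n _ _ scalar_in_B above_scalar[OF order_refl] z])
       (use sa centered in auto)
  then show "cauchy (\<Sum>i=1..Suc n. y i) z = cauchy (\<Sum>i=1..n. y i) (F_scalar (y (Suc n)) z)"
    unfolding F_transform_scalar[OF s(2) z] E_scalar scaleC_one_inject cauchy_def .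
qed

lemma K_nonneg: "j \<in> {1..N} \<Longrightarrow> K \<ge> 0"
  using order.trans[OF norm_ge_zero alpha2_upper] order.trans[OF norm_ge_zero alpha4_upper[OF _ B_intros(1) norm_one]]
  by (simp add: K_def)

text \<open>Peeling off the top variable replaces \<open>f\<close> by its composition with an
  F-transform, and the two families lead to different maps. Hence the statement ranges over all
  \<open>f\<close> with \<open>near_id f\<close>, a class containing both.\<close>

lemma nn_integral_cauchy_close:
  assumes \<epsilon>: "\<epsilon> > 0" and "n \<le> N" "near_id f"
  shows "(\<integral>\<^sup>+ t. ennreal (cmod (cauchy (\<Sum>i=1..n. x i) (f (Complex t \<epsilon>)) - cauchy (\<Sum>i=1..n. y i) (f (Complex t \<epsilon>)))) \<partial>lborel)
     \<le> ennreal (real n * (K * pi / \<epsilon> ^ 3))"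
  using assms(2,3)
proof (induction n arbitrary: f)
  case 0
  then show ?case by simp
next
  case (Suc n)
  have j: "Suc n \<in> {1..N}" using Suc.prems by simp
  note s = sa[OF j] centered[OF j]
  have sx: "star (\<Sum>i=1..n. x i) = (\<Sum>i=1..n. x i)" and sy: "star (\<Sum>i=1..n. y i) = (\<Sum>i=1..n. y i)"
    using star_sum_x star_sum_y Suc.prems by auto
  define u where "u z = F_scalar (x (Suc n)) (f z)" for z
  define v where "v z = F_scalar (y (Suc n)) (f z)" for z
  have u: "near_id u" unfolding u_def[abs_def]
    by (rule near_id_compose[OF Suc.prems(2) near_id_F_scalar]) (use s in auto)
  have v: "near_id v" unfolding v_def[abs_def]
    by (rule near_id_compose[OF Suc.prems(2) near_id_F_scalar]) (use s in auto)
  let ?c = "\<lambda>t. Complex t \<epsilon>"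
  let ?Lx = "\<Sum>i=1..n. x i" and ?Ly = "\<Sum>i=1..n. y i"
  define a where "a t = - Im (cauchy ?Lx (u (?c t)))" for t
  define b where "b t = - Im (cauchy ?Lx (v (?c t)))" for t
  define q where "q t = cmod (cauchy ?Lx (v (?c t)) - cauchy ?Ly (v (?c t)))" for t
  \<comment> \<open>\<open>K / \<epsilon>\<^sup>2\<close> bounds the distance of \<open>u\<close>
    and \<open>v\<close>, and \<open>1 / (2 * \<epsilon>)\<close> is the weight from
    \<open>cauchy_diff\<close>; against the mass \<open>2 * pi\<close> this gives
    \<open>K * pi / \<epsilon> ^ 3\<close>.\<close>
  define k where "k = K / \<epsilon>\<^sup>2 / (2 * \<epsilon>)"
  have k: "k \<ge> 0" using K_nonneg[OF j] \<epsilon> by (simp add: k_def)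
  have near_id_ge: "\<epsilon> \<le> Im (g (?c t))" if "near_id g" for g t
    using that \<epsilon> unfolding near_id_def by (metis complex.sel(2))
  note Imf = near_id_ge[OF Suc.prems(2)] near_id_ge[OF u] near_id_ge[OF v]
  note Imf0 = order.strict_trans2[OF \<epsilon> Imf(1)] order.strict_trans2[OF \<epsilon> Imf(2)]
    order.strict_trans2[OF \<epsilon> Imf(3)]
  have ab: "a t \<ge> 0" "b t \<ge> 0" for t
    unfolding a_def b_def neg_0_le_iff_le by (intro Im_cauchy(1)[OF sx] Imf0)+
  have pt: "cmod (cauchy (\<Sum>i=1..Suc n. x i) (f (?c t)) - cauchy (\<Sum>i=1..Suc n. y i) (f (?c t)))
      \<le> k * (a t + b t) + q t" for t
  proof -
    have "norm (F_transform (x (Suc n)) (scaleC (f (?c t)) 1) - F_transform (y (Suc n)) (scaleC (f (?c t)) 1)) \<le> K / \<epsilon>\<^sup>2"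
      by (rule F_transform_close[OF j scalar_in_B above_scalar[OF Imf(1)] \<epsilon>])
    then have "norm (scaleC (u (?c t)) (1 :: 'a) - scaleC (v (?c t)) 1) \<le> K / \<epsilon>\<^sup>2"
      using F_transform_scalar[of "x (Suc n)", OF _ Imf0(1)] F_transform_scalar[of "y (Suc n)", OF _ Imf0(1)] s
      by (simp add: u_def v_def)
    then have uv: "cmod (u (?c t) - v (?c t)) \<le> K / \<epsilon>\<^sup>2"
      unfolding scaleC_diff_left[symmetric] norm_scaleC by simp
    have "cmod (cauchy ?Lx (u (?c t)) - cauchy ?Lx (v (?c t)))
        \<le> cmod (u (?c t) - v (?c t)) / (2 * \<epsilon>) * (- Im (cauchy ?Lx (u (?c t))) - Im (cauchy ?Lx (v (?c t))))"
      by (rule cauchy_diff[OF sx Imf(2,3) \<epsilon>])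
    also have "\<dots> = cmod (u (?c t) - v (?c t)) / (2 * \<epsilon>) * (a t + b t)" by (simp add: a_def b_def)
    also have "\<dots> \<le> k * (a t + b t)"
      unfolding k_def using uv ab[of t] \<epsilon> by (intro mult_right_mono divide_right_mono) auto
    finally have "cmod (cauchy ?Lx (u (?c t)) - cauchy ?Lx (v (?c t))) \<le> k * (a t + b t)" .
    moreover have "cmod (cauchy ?Lx (u (?c t)) - cauchy ?Ly (v (?c t)))
        \<le> cmod (cauchy ?Lx (u (?c t)) - cauchy ?Lx (v (?c t))) + q t"
      unfolding q_def
      using norm_triangle_ineq[of "cauchy ?Lx (u (?c t)) - cauchy ?Lx (v (?c t))" "cauchy ?Lx (v (?c t)) - cauchy ?Ly (v (?c t))"]
      by simp
    ultimately show ?thesis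
      unfolding cauchy_monotone_convolution[OF Suc.prems(1) Imf0(1)] u_def v_def by linarith
  qed
  have ma: "a \<in> borel_measurable borel" unfolding a_def[abs_def]
    using measurable_cauchy_near_id[OF sx u \<epsilon>] by measurable
  have mb: "b \<in> borel_measurable borel" unfolding b_def[abs_def]
    using measurable_cauchy_near_id[OF sx v \<epsilon>] by measurable
  have mq: "q \<in> borel_measurable borel" unfolding q_def[abs_def]
    using measurable_cauchy_near_id[OF sx v \<epsilon>] measurable_cauchy_near_id[OF sy v \<epsilon>] by measurable
  have Ia: "(\<integral>\<^sup>+ t. ennreal (a t) \<partial>lborel) \<le> ennreal pi" unfolding a_def
    by (rule nn_integral_cauchy_near_id[OF sx u \<epsilon>])
  have Ib: "(\<integral>\<^sup>+ t. ennreal (b t) \<partial>lborel) \<le> ennreal pi" unfolding b_def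
    by (rule nn_integral_cauchy_near_id[OF sx v \<epsilon>])
  have Iq: "(\<integral>\<^sup>+ t. ennreal (q t) \<partial>lborel) \<le> ennreal (real n * (K * pi / \<epsilon> ^ 3))" unfolding q_def
    by (rule Suc.IH) (use Suc.prems v in auto)
  have "(\<integral>\<^sup>+ t. ennreal (cmod (cauchy (\<Sum>i=1..Suc n. x i) (f (?c t)) - cauchy (\<Sum>i=1..Suc n. y i) (f (?c t)))) \<partial>lborel)
      \<le> (\<integral>\<^sup>+ t. ennreal (k * (a t + b t) + q t) \<partial>lborel)"
    by (intro nn_integral_mono ennreal_leI pt)
  also have "\<dots> = (\<integral>\<^sup>+ t. ennreal k * (ennreal (a t) + ennreal (b t)) + ennreal (q t) \<partial>lborel)"
  proof (rule nn_integral_cong)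
    fix t
    have "q t \<ge> 0" by (simp add: q_def)
    then show "ennreal (k * (a t + b t) + q t) = ennreal k * (ennreal (a t) + ennreal (b t)) + ennreal (q t)"
      using ab[of t] k by (simp add: ennreal_plus ennreal_mult)
  qed
  also have "\<dots> = ennreal k * ((\<integral>\<^sup>+ t. ennreal (a t) \<partial>lborel) + (\<integral>\<^sup>+ t. ennreal (b t) \<partial>lborel))
      + (\<integral>\<^sup>+ t. ennreal (q t) \<partial>lborel)"
    using ma mb mq by (simp add: nn_integral_add nn_integral_cmult)
  also have "\<dots> \<le> ennreal k * (ennreal pi + ennreal pi) + ennreal (real n * (K * pi / \<epsilon> ^ 3))"
    by (intro add_mono mult_left_mono Ia Ib Iq) auto
  also have "\<dots> = ennreal (k * (pi + pi) + real n * (K * pi / \<epsilon> ^ 3))"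
    using k K_nonneg[OF j] \<epsilon> by (simp add: ennreal_plus[symmetric] ennreal_mult[symmetric] del: ennreal_plus)
  also have "k * (pi + pi) + real n * (K * pi / \<epsilon> ^ 3) = real (Suc n) * (K * pi / \<epsilon> ^ 3)"
    using \<epsilon> by (simp add: k_def field_simps power2_eq_square power3_eq_cube)
  finally show ?case .
qed

end

theorem theorem1p2:
  fixes B :: "'a::cstar_algebra set" and E :: "'a \<Rightarrow> 'a"
    and N :: nat and x y :: "nat \<Rightarrow> 'a"
  assumes space: "opval_cstar_prob_space B E"
    and sa: "\<And>j. j \<in> {1..N} \<Longrightarrow> selfadj (x j) \<and> selfadj (y j)"
    and centered: "\<And>j. j \<in> {1..N} \<Longrightarrow> E (x j) = 0 \<and> E (y j) = 0"
    and var: "\<And>j b. j \<in> {1..N} \<Longrightarrow> b \<in> B \<Longrightarrow> E (x j * b * x j) = E (y j * b * y j)"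
    and mon_x: "monotone_indep E {1..N} (\<lambda>i. bimod_gen B (x i))"
    and mon_y: "monotone_indep E {1..N} (\<lambda>i. bimod_gen B (y i))"
  shows "(\<forall>\<bb>\<in>upper_half B.
            norm (E (resolvent (\<Sum>i=1..N. x i) \<bb>) - E (resolvent (\<Sum>i=1..N. y i) \<bb>))
            \<le> norm (inv_el (Im_el \<bb>)) ^ 4 * sqrt (alpha2 E N x)
               * (sqrt (alpha4 B E N x) + sqrt (alpha4 B E N y)) * real N)
       \<and> (\<forall>\<phi>::'a \<Rightarrow> complex.
            B = range (\<lambda>c. scaleC c 1) \<and> (\<forall>a. E a = scaleC (\<phi> a) 1) \<and>
            monotone_complete TYPE('a) \<and> normal_functional \<phi> \<and> faithful_functional \<phi> \<longrightarrow>
            (\<forall>\<epsilon>::real. \<epsilon> > 0 \<longrightarrow>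
               (\<integral>\<^sup>+ t. ennreal \<bar>Im (\<phi> (resolvent (\<Sum>i=1..N. x i) (scaleC (Complex t \<epsilon>) 1)))
                               - Im (\<phi> (resolvent (\<Sum>i=1..N. y i) (scaleC (Complex t \<epsilon>) 1)))\<bar> \<partial>lborel)
               \<le> ennreal (pi / \<epsilon> ^ 3 * sqrt (alpha2 E N x)
                   * (sqrt (alpha4_tilde E N x) + sqrt (alpha4_tilde E N y)) * real N)))"
proof -
  interpret monotone_pair B E N x y
    by standard (use space sa centered var mon_x mon_y in \<open>auto simp: selfadj_def\<close>)
  have first: "norm (E (resolvent (\<Sum>i=1..N. x i) b) - E (resolvent (\<Sum>i=1..N. y i) b))
      \<le> norm (inv_el (Im_el b)) ^ 4 * sqrt (alpha2 E N x)
        * (sqrt (alpha4 B E N x) + sqrt (alpha4 B E N y)) * real N" if b: "b \<in> upper_half B" for b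
  proof -
    note h = upper_half_above[OF b]
    have "norm (E (resolvent (\<Sum>i=1..N. x i) b) - E (resolvent (\<Sum>i=1..N. y i) b))
        \<le> real N * (K / (1 / norm (inv_el (Im_el b))) ^ 4)"
      unfolding resolvent_def using h by (intro E_resolvent_close) auto
    also have "\<dots> = norm (inv_el (Im_el b)) ^ 4 * sqrt (alpha2 E N x)
        * (sqrt (alpha4 B E N x) + sqrt (alpha4 B E N y)) * real N"
      using h(1) by (simp add: K_def power_divide)
    finally show ?thesis .
  qed
  have second: "(\<integral>\<^sup>+ t. ennreal \<bar>Im (\<phi> (resolvent (\<Sum>i=1..N. x i) (scaleC (Complex t \<epsilon>) 1)))
                     - Im (\<phi> (resolvent (\<Sum>i=1..N. y i) (scaleC (Complex t \<epsilon>) 1)))\<bar> \<partial>lborel)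
      \<le> ennreal (pi / \<epsilon> ^ 3 * sqrt (alpha2 E N x)
          * (sqrt (alpha4_tilde E N x) + sqrt (alpha4_tilde E N y)) * real N)"
    if B: "B = range (\<lambda>c. scaleC c 1)" and E: "\<forall>a. E a = scaleC (\<phi> a) 1" and \<epsilon>: "\<epsilon> > 0" for \<phi> \<epsilon>
  proof (cases "N = 0")
    \<comment> \<open>Both sums are empty and the integrand vanishes; the maxima over the empty set
      in the bound are multiplied by 0.\<close>
    case True
    then show ?thesis by simp
  next
    case False
    interpret scalar_monotone_pair B E N x y \<phi>
      by standard (use B E in auto)
    have "(\<integral>\<^sup>+ t. ennreal \<bar>Im (\<phi> (resolvent (\<Sum>i=1..N. x i) (scaleC (Complex t \<epsilon>) 1)))
                     - Im (\<phi> (resolvent (\<Sum>i=1..N. y i) (scaleC (Complex t \<epsilon>) 1)))\<bar> \<partial>lborel)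
        \<le> (\<integral>\<^sup>+ t. ennreal (cmod (cauchy (\<Sum>i=1..N. x i) (Complex t \<epsilon>) - cauchy (\<Sum>i=1..N. y i) (Complex t \<epsilon>))) \<partial>lborel)"
    proof (intro nn_integral_mono ennreal_leI)
      show "\<bar>Im (\<phi> (resolvent (\<Sum>i=1..N. x i) (scaleC (Complex t \<epsilon>) 1)))
            - Im (\<phi> (resolvent (\<Sum>i=1..N. y i) (scaleC (Complex t \<epsilon>) 1)))\<bar>
          \<le> cmod (cauchy (\<Sum>i=1..N. x i) (Complex t \<epsilon>) - cauchy (\<Sum>i=1..N. y i) (Complex t \<epsilon>))" for t
        unfolding cauchy_def resolvent_def minus_complex.sel(2)[symmetric] by (rule abs_Im_le_cmod)
    qed
    also have "\<dots> \<le> ennreal (real N * (K * pi / \<epsilon> ^ 3))"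
      by (rule nn_integral_cauchy_close[OF \<epsilon> order_refl near_id_ident])
    also have "real N * (K * pi / \<epsilon> ^ 3) = pi / \<epsilon> ^ 3 * sqrt (alpha2 E N x)
          * (sqrt (alpha4_tilde E N x) + sqrt (alpha4_tilde E N y)) * real N"
      using False by (simp add: K_def alpha4_scalar)
    finally show ?thesis .
  qed
  from first second show ?thesis by blast
qed

end
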